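(* Let $d=3$ and $\alpha_1=\alpha_2=\alpha_3=\alpha$ in the matrix model described in the context, and let $W^{0}(x)$ and $W^{1/2}(x)$ be the coefficients of $N$ and $N^{1/2}$, respectively, in the large-$N$ expansion of $W(x)=\langle\operatorname{tr}\frac1{x-M_1}\rangle$. With $\sigma(x)=\sqrt{x^2-\frac4{1-\alpha^2}}$ ($\sigma(x)\sim x$ at infinity), $$W^{1/2}(x)=\frac{\alpha^3}{(1-\alpha^2)\,\sigma(x)}\Bigl(x\bigl(xW^0(x)-1\bigr)+\frac{2}{(1-\alpha^2)(1-3\alpha^2)}W^0(x)\Bigr).$$ Equivalently, with $x(z)=\frac1{\sqrt{1-\alpha^2}}\bigl(z+\frac1z\bigr)$ (and $z\to\infty$ as $x\to\infty$), $$W^{1/2}(x(z))\,dx(z)=\frac{\alpha^3}{(1-\alpha^2)^{3/2}}\Bigl(\frac1{z^2}+\frac{3(1-\alpha^2)}{1-3\alpha^2}\Bigr)\frac{dz}{z^2};$$ in particular this form has no poles at $z=\pm1$.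
   Context: **Model.** $M_1,M_2,M_3$ are $N\times N$ Hermitian matrices with formal measure $$\prod_{c=1}^3 dM_c\ \exp\Bigl(-\tfrac N2\sum_c\operatorname{tr}M_c^2+\operatorname{tr}\sum_{p\ge2}\tfrac{N^{-p/2}}{p}\bigl(\sum_c\alpha\,\mathcal M_c\bigr)^p\Bigr),\qquad \mathcal M_c=\mathbb 1^{\otimes(c-1)}\otimes M_c\otimes\mathbb 1^{\otimes(3-c)}.$$ Expectations are formal power series in $\alpha$, obtained by expanding everything except the Gaussian weight $e^{-\frac N2\sum_c\operatorname{tr}M_c^2}$; coefficients are Laurent polynomials in $N^{1/2}$. The function $W(x)=\langle\operatorname{tr}\frac1{x-M_1}\rangle$ is understood as a series in $1/x$ and expands as $W(x)=N\bigl(W^0(x)+N^{-1/2}W^{1/2}(x)+O(N^{-1})\bigr)$. Identities are identities of expansions at $x=\infty$, perturbatively in $\alpha$. By color symmetry the result is the same for $M_2,M_3$. *)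

theory Defs
  imports
    "HOL-Analysis.Analysis"
    "HOL-Computational_Algebra.Formal_Laurent_Series"
    "Jordan_Normal_Form.Matrix"
begin

hide_const (open) Determinants.trace Finite_Cartesian_Product.mat Finite_Cartesian_Product.vec

section \<open>Matrices\<close>

definition mtrace :: "complex mat \<Rightarrow> complex" where
  "mtrace A = (\<Sum>i<dim_row A. A $$ (i, i))"

definition kron :: "complex mat \<Rightarrow> complex mat \<Rightarrow> complex mat" where
  "kron A B = mat (dim_row A * dim_row B) (dim_col A * dim_col B)
     (\<lambda>(i, j). A $$ (i div dim_row B, j div dim_col B) * B $$ (i mod dim_row B, j mod dim_col B))"

text \<open>The sum of the three operators \<open>1 \<otimes> \<dots> \<otimes> M c \<otimes> \<dots> \<otimes> 1\<close> (\<open>M c\<close> in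
  position \<open>c\<close>) on the threefold tensor power of \<open>\<complex>\<^sup>N\<close>.\<close>

definition color_sum :: "nat \<Rightarrow> (nat \<Rightarrow> complex mat) \<Rightarrow> complex mat" where
  "color_sum N M =
     kron (kron (M 1) (1\<^sub>m N)) (1\<^sub>m N) +
     kron (kron (1\<^sub>m N) (M 2)) (1\<^sub>m N) +
     kron (kron (1\<^sub>m N) (1\<^sub>m N)) (M 3)"

section \<open>Gaussian integration over three Hermitian matrices\<close>

text \<open>Real coordinates on triples of Hermitian matrices: for each colour \<open>c\<close>, \<open>y (c, i, i)\<close> is the
  \<open>i\<close>-th diagonal entry, and for \<open>i < j\<close> the numbers \<open>y (c, i, j)\<close> and \<open>y (c, j, i)\<close> are the real
  and imaginary part of the entry at \<open>(i, j)\<close>.\<close>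

definition coords :: "nat \<Rightarrow> (nat \<times> nat \<times> nat) set" where
  "coords N = {1..3} \<times> {..<N} \<times> {..<N}"

definition herm :: "nat \<Rightarrow> (nat \<times> nat \<times> nat \<Rightarrow> real) \<Rightarrow> nat \<Rightarrow> complex mat" where
  "herm N y c = mat N N (\<lambda>(i, j).
     if i = j then complex_of_real (y (c, i, i))
     else if i < j then Complex (y (c, i, j)) (y (c, j, i))
     else Complex (y (c, j, i)) (- y (c, i, j)))"

definition gauss_weight :: "nat \<Rightarrow> (nat \<Rightarrow> complex mat) \<Rightarrow> complex" where
  "gauss_weight N M = exp (- (of_nat N / 2) * (\<Sum>c\<in>{1..3}. mtrace (M c ^\<^sub>m 2)))"

definition gauss_integral :: "nat \<Rightarrow> ((nat \<Rightarrow> complex mat) \<Rightarrow> complex) \<Rightarrow> complex" where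
  "gauss_integral N f =
     (\<integral>y. f (herm N y) * gauss_weight N (herm N y) \<partial>(\<Pi>\<^sub>M i\<in>coords N. (lborel :: real measure)))"

definition gauss_expect :: "nat \<Rightarrow> ((nat \<Rightarrow> complex mat) \<Rightarrow> complex) \<Rightarrow> complex" where
  "gauss_expect N f = gauss_integral N f / gauss_integral N (\<lambda>_. 1)"

section \<open>The interacting model, perturbatively in the coupling\<close>

text \<open>In this section the formal variable of \<open>complex fps\<close> is \<open>\<alpha>\<close>.\<close>

definition potential :: "nat \<Rightarrow> (nat \<Rightarrow> complex mat) \<Rightarrow> complex fps" where
  "potential N M = Abs_fps (\<lambda>p.
     if p \<ge> 2 then of_real (real N powr (- (real p / 2)) / real p) * mtrace (color_sum N M ^\<^sub>m p)
     else 0)"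

definition gauss_expect_fps :: "nat \<Rightarrow> ((nat \<Rightarrow> complex mat) \<Rightarrow> complex fps) \<Rightarrow> complex fps" where
  "gauss_expect_fps N F = Abs_fps (\<lambda>m. gauss_expect N (\<lambda>M. fps_nth (F M) m))"

definition expect :: "nat \<Rightarrow> ((nat \<Rightarrow> complex mat) \<Rightarrow> complex) \<Rightarrow> complex fps" where
  "expect N f =
     gauss_expect_fps N (\<lambda>M. fps_const (f M) * fps_compose (fps_exp 1) (potential N M)) /
     gauss_expect_fps N (\<lambda>M. fps_compose (fps_exp 1) (potential N M))"

definition moment :: "nat \<Rightarrow> nat \<Rightarrow> complex fps" where
  "moment N k = expect N (\<lambda>M. mtrace (M 1 ^\<^sub>m k))"

section \<open>Large-N expansion\<close>

definition laurent_sqrtN :: "(nat \<Rightarrow> complex) \<Rightarrow> (int \<Rightarrow> complex) \<Rightarrow> bool" where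
  "laurent_sqrtN f L \<longleftrightarrow> finite {j. L j \<noteq> 0} \<and>
     (\<forall>N\<ge>1. f N = (\<Sum>j | L j \<noteq> 0. L j * of_real (sqrt (real N)) powi j))"

lemma laurent_sqrtN_unique:
  assumes "laurent_sqrtN f L" "laurent_sqrtN f L'"
  shows "L = L'"
proof -
  define S where "S = {j. L j \<noteq> 0} \<union> {j. L' j \<noteq> 0}"
  have fS: "finite S" using assms by (auto simp: S_def laurent_sqrtN_def)
  obtain B where B: "\<And>j. j \<in> S \<Longrightarrow> - B \<le> j"
    using finite_imp_Sup_less[of "uminus ` S"] fS
    by (metis bdd_below_finite bdd_below.E minus_minus)
  define p where "p = (\<Sum>j\<in>S. monom (L j - L' j) (nat (j + B)))"
  have root: "poly p (of_real (sqrt (real N))) = 0" if N: "N \<ge> 1" for N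
  proof -
    let ?w = "complex_of_real (sqrt (real N))"
    have w: "?w \<noteq> 0" using N by simp
    have "(\<Sum>j | K j \<noteq> 0. K j * ?w powi j) = (\<Sum>j\<in>S. K j * ?w powi j)"
      if "{j. K j \<noteq> 0} \<subseteq> S" for K
      using that fS by (intro sum.mono_neutral_left) auto
    hence "f N = (\<Sum>j\<in>S. L j * ?w powi j)" "f N = (\<Sum>j\<in>S. L' j * ?w powi j)"
      using assms N by (auto simp: laurent_sqrtN_def S_def)
    hence z: "(\<Sum>j\<in>S. (L j - L' j) * ?w powi j) = 0"
      by (simp add: left_diff_distrib sum_subtractf)
    have "poly p ?w = (\<Sum>j\<in>S. (L j - L' j) * ?w powi j * ?w powi B)"
      unfolding p_def poly_sum
    proof (intro sum.cong refl)
      fix j assume "j \<in> S"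
      hence "?w ^ nat (j + B) = ?w powi (j + B)" using B[of j] by (simp add: power_int_def)
      thus "poly (monom (L j - L' j) (nat (j + B))) ?w = (L j - L' j) * ?w powi j * ?w powi B"
        using w by (simp add: poly_monom power_int_add)
    qed
    also have "\<dots> = 0" using z by (simp flip: sum_distrib_right)
    finally show ?thesis .
  qed
  have p0: "p = 0"
  proof (rule ccontr)
    assume "p \<noteq> 0"
    hence "finite {x. poly p x = 0}" by (rule poly_roots_finite)
    moreover have "(\<lambda>N. complex_of_real (sqrt (real N))) ` {1..} \<subseteq> {x. poly p x = 0}"
      using root by auto
    moreover have "inj_on (\<lambda>N. complex_of_real (sqrt (real N))) {1..}"
      by (auto simp: inj_on_def)
    ultimately have "finite {1::nat..}" using finite_imageD finite_subset by blast
    thus False using infinite_Ici by blast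
  qed
  show ?thesis
  proof
    fix i
    show "L i = L' i"
    proof (cases "i \<in> S")
      case True
      have "coeff p (nat (i + B)) = (\<Sum>j\<in>S. if j = i then L j - L' j else 0)"
        unfolding p_def coeff_sum using B True
        by (intro sum.cong) (auto simp: nat_eq_iff dest!: B)
      thus ?thesis using p0 True fS by simp
    qed (auto simp: S_def)
  qed
qed

definition sqrtN_coeff :: "(nat \<Rightarrow> complex) \<Rightarrow> int \<Rightarrow> complex" where
  "sqrtN_coeff f = (THE L. laurent_sqrtN f L)"

text \<open>From here on \<open>complex fls\<close> is the field of Laurent series in \<open>\<alpha>\<close>, and \<open>complex fls fls\<close> the
  field of Laurent series at infinity in \<open>x\<close> (or in \<open>z\<close>) over it; the formal variable of the outer
  series is the reciprocal \<open>1/x\<close> (resp. \<open>1/z\<close>), so that \<open>x\<close> itself is \<open>fls_X_inv\<close>.\<close>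

text \<open>\<open>W_coeff j\<close> is the coefficient of \<open>N\<close> to the power \<open>j/2\<close> in
  \<open>W(x) = (\<Sum>k. moment N k / x ^ (k + 1))\<close>.\<close>

definition W_coeff :: "int \<Rightarrow> complex fls fls" where
  "W_coeff j = fps_to_fls (Abs_fps (\<lambda>n. case n of 0 \<Rightarrow> 0 | Suc k \<Rightarrow>
     fps_to_fls (Abs_fps (\<lambda>m. sqrtN_coeff (\<lambda>N. fps_nth (moment N k) m) j))))"

definition W0 :: "complex fls fls" where "W0 = W_coeff 2"
definition Whalf :: "complex fls fls" where "Whalf = W_coeff 1"

section \<open>Formal square roots and the spectral curve\<close>

definition fls_sqrt :: "'a::field fls \<Rightarrow> 'a fls" where
  "fls_sqrt f = (THE s. s ^ 2 = f \<and> fls_nth s (fls_subdegree s) = 1)"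

lemma fls_sqrt_eqI:
  fixes s :: "'a::field_char_0 fls"
  assumes "s ^ 2 = f" "fls_nth s (fls_subdegree s) = 1"
  shows "fls_sqrt f = s"
  unfolding fls_sqrt_def
proof (rule the_equality)
  fix t assume t: "t ^ 2 = f \<and> fls_nth t (fls_subdegree t) = 1"
  hence "t ^ 2 = s ^ 2" using assms by simp
  hence "t = s \<or> t = - s" by (simp only: power2_eq_iff)
  moreover have "t \<noteq> - s" using t assms by auto
  ultimately show "t = s" by blast
qed (use assms in auto)

definition alpha :: "complex fls fls" where "alpha = fls_const fls_X"

definition sqrt_one_minus_alpha2 :: "complex fls fls" where
  "sqrt_one_minus_alpha2 = fls_const (fls_sqrt (1 - fls_X ^ 2))"

definition x_var :: "complex fls fls" where "x_var = fls_X_inv"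

definition sigma_x :: "complex fls fls" where
  "sigma_x = fls_sqrt (x_var ^ 2 - 4 / (1 - alpha ^ 2))"

lemma fps_sqrt_exists:
  fixes f :: "'a::field_char_0 fps"
  assumes "fps_nth f 0 = 1"
  obtains r where "r ^ 2 = f" "fps_nth r 0 = 1"
proof
  show "fps_radical (\<lambda>_ _. 1) 2 f ^ 2 = f"
    using power_radical[of f "\<lambda>_ _. 1" 1] assms by (simp add: numeral_2_eq_2)
  show "fps_nth (fps_radical (\<lambda>_ _. 1) 2 f) 0 = 1" by simp
qed

lemma sqrt_one_minus_alpha2_squared: "sqrt_one_minus_alpha2 ^ 2 = 1 - alpha ^ 2"
proof -
  obtain r where r: "r ^ 2 = 1 - (fps_X :: complex fps) ^ 2" "fps_nth r 0 = 1"
    using fps_sqrt_exists[of "1 - (fps_X :: complex fps) ^ 2"] by auto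
  have "fps_to_fls r ^ 2 = fps_to_fls (r ^ 2)" by (simp add: fps_to_fls_power)
  also have "\<dots> = 1 - fls_X ^ 2" by (simp add: r fps_to_fls_power)
  finally have sq: "fps_to_fls r ^ 2 = 1 - fls_X ^ 2" .
  have "subdegree r = 0" using r by (simp add: subdegree_eq_0_iff)
  hence "fls_sqrt (1 - fls_X ^ 2) = fps_to_fls r"
    using r by (intro fls_sqrt_eqI sq) (simp add: fls_subdegree_fls_to_fps)
  hence "sqrt_one_minus_alpha2 ^ 2 = fls_const (1 - fls_X ^ 2)"
    by (simp only: sqrt_one_minus_alpha2_def sq flip: fls_const_power)
  thus ?thesis by (simp add: alpha_def fls_const_power flip: fls_minus_const)
qed

text \<open>The branch is fixed by \<open>\<sigma>(x) \<sim> x\<close> at infinity.\<close>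

lemma sigma_x:
  "sigma_x ^ 2 = x_var ^ 2 - 4 / (1 - alpha ^ 2)"
  "fls_subdegree sigma_x = -1" "fls_nth sigma_x (-1) = 1"
proof -
  define c :: "complex fls" where "c = 4 / (1 - fls_X ^ 2)"
  have c: "4 / (1 - alpha ^ 2) = fls_const c"
    unfolding c_def alpha_def
    by (simp add: fls_const_power fls_const_divide_const[symmetric] fls_minus_const[symmetric]
        fls_const_numeral)
  obtain r where r: "r ^ 2 = 1 - fps_const c * fps_X ^ 2" "fps_nth r 0 = 1"
    using fps_sqrt_exists[of "1 - fps_const c * fps_X ^ 2"] by auto
  define s where "s = x_var * fps_to_fls r"
  have X: "x_var * fls_X = 1" by (simp add: x_var_def fls_X_inv_times_conv_shift fls_X_conv_shift_1)
  have "fps_to_fls r ^ 2 = fps_to_fls (r ^ 2)" by (simp add: fps_to_fls_power)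
  also have "\<dots> = 1 - fls_const c * fls_X ^ 2"
    by (simp add: r fps_to_fls_power fls_times_fps_to_fls)
  finally have "s ^ 2 = x_var ^ 2 * (1 - fls_const c * fls_X ^ 2)"
    by (simp only: s_def power_mult_distrib)
  also have "\<dots> = x_var ^ 2 - fls_const c * (x_var * fls_X) ^ 2"
    by (simp only: power_mult_distrib) (simp add: algebra_simps)
  finally have "s ^ 2 = x_var ^ 2 - fls_const c * (x_var * fls_X) ^ 2" .
  hence sq: "s ^ 2 = x_var ^ 2 - 4 / (1 - alpha ^ 2)" by (simp add: X c)
  have r0: "r \<noteq> 0" "subdegree r = 0" using r by (auto simp: subdegree_eq_0_iff)
  have sub: "fls_subdegree s = -1"
    using r0 by (simp add: s_def x_var_def fls_subdegree_fls_to_fps)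
  have lead: "fls_nth s (-1) = 1"
    using r by (simp add: s_def x_var_def fls_X_inv_times_conv_shift)
  have "sigma_x = s" unfolding sigma_x_def using sub lead by (intro fls_sqrt_eqI sq) simp
  thus "sigma_x ^ 2 = x_var ^ 2 - 4 / (1 - alpha ^ 2)"
    "fls_subdegree sigma_x = -1" "fls_nth sigma_x (-1) = 1"
    using sq sub lead by auto
qed

definition z_var :: "complex fls fls" where "z_var = fls_X_inv"

definition x_of_z :: "complex fls fls" where
  "x_of_z = 1 / sqrt_one_minus_alpha2 * (z_var + 1 / z_var)"

text \<open>Substitution of \<open>x(z)\<close>: the series in \<open>1/x\<close> is composed with the power series \<open>1/x(z)\<close>
  in \<open>1/z\<close>, which has no constant term.\<close>

definition subst_x_of_z :: "complex fls fls \<Rightarrow> complex fls fls" where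
  "subst_x_of_z F = fls_compose_fps F (fls_regpart (1 / x_of_z))"

text \<open>The derivative \<open>d/dz\<close>, expressed through \<open>t = 1/z\<close> as \<open>- t\<^sup>2 d/dt\<close>.\<close>

definition dz_deriv :: "complex fls fls \<Rightarrow> complex fls fls" where
  "dz_deriv F = - (fls_X ^ 2) * fls_deriv F"

text \<open>One-forms \<open>f dz\<close> are represented by \<open>f\<close>.\<close>

definition Whalf_form :: "complex fls fls" where
  "Whalf_form = subst_x_of_z Whalf * dz_deriv x_of_z"

text \<open>\<open>F\<close> is the expansion at infinity of a rational function of \<open>z\<close> that is regular at \<open>c\<close>.\<close>

definition no_pole_at :: "'a::field fls \<Rightarrow> 'a \<Rightarrow> bool" where
  "no_pole_at F c \<longleftrightarrow> (\<exists>p q. poly q c \<noteq> 0 \<and>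
     F = poly (map_poly fls_const p) fls_X_inv / poly (map_poly fls_const q) fls_X_inv)"

end

(*
Gaussian integration by parts yields, for the interacting model, exact loop equations for
expectations of products of traces tr M_c^a. Writing tr M_c^a = N (m_a + N^(-1/2) s_a), where the
m_a are the moments of the semicircle law of variance 1/(1 - alpha^2), the terms involving only the
m_a cancel, and after division by N^(-1/2) every coefficient of the resulting equations is a
polynomial in N^(-1/2): the vertex of order alpha^p carries N^((3-p)/2) relative to the rescaled
equation and the quadratic vertex is absorbed by the m_a. Hence, by induction on the order in alpha
and on the degree, each alpha-coefficient of the expectation of a product of the s_a is a polynomial
in N^(-1/2), and its value at N^(-1/2) = 0 solves the linear recursion obtained by dropping the
positive powers. Only the vertices with p = 2 and p = 3 contribute to that recursion; its generating
function is W^(1/2).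
*)

theory Submission
  imports Defs "HOL-Probability.Probability"
begin

section \<open>Gaussian integration by parts\<close>

text \<open>The loop equation for one fluctuation contains products of two, and every vertex inserts
  three traces, so no finite family of expectations closes; all products must be treated at once.
  What makes the recursion well-founded is a trade-off: a vertex may raise the degree arbitrarily
  but costs its own order in \<alpha>, whereas the splitting of a trace and the contact terms keep
  the order and lower the degree. The quadratic vertex also reproduces the unknown itself with
  coefficient \<alpha>^2; moving it to the left gives the factor 1 - \<alpha>^2, and this fixes the
  variance of the semicircle law. With that choice the means cancel exactly at every finite N, so
  the division by N^(-1/2) creates no negative power. The cubic vertex is the source of the
  half-integer order: it gives the traces of the single matrices a nonzero mean, and the quadratic
  vertex feeds these means back into the other colours. The resulting linear system for the three
  first moments has the eigenvalue 1 - 3 \<alpha>^2 on colour-symmetric vectors, which is where this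
  factor of the result comes from.\<close>

definition gmom :: "real \<Rightarrow> nat \<Rightarrow> complex" where
  "gmom a n = (\<integral>y. complex_of_real (y ^ n * exp (- a * y ^ 2)) \<partial>lborel)"

text \<open>For this \<open>s\<close> the centred normal density of standard deviation
  \<open>s\<close> is exp (- a y^2) / K, so integrability and values both come from the known
  moments of the normal distribution.\<close>

lemma gauss_bochner:
  assumes a: "a > 0"
  defines "s \<equiv> 1 / sqrt (2 * a)"
  defines "K \<equiv> sqrt (2 * pi * s ^ 2)"
  shows "has_bochner_integral lborel (\<lambda>y. complex_of_real (y ^ (2 * k) * exp (- a * y ^ 2)))
      (of_real (K * (fact (2 * k) / ((2 / s\<^sup>2) ^ k * fact k))))"
    and "has_bochner_integral lborel (\<lambda>y. complex_of_real (y ^ (2 * k + 1) * exp (- a * y ^ 2))) 0"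
proof -
  have s: "s > 0" "s ^ 2 = 1 / (2 * a)" using a by (auto simp: s_def power_divide)
  have K: "K > 0" using s(1) unfolding K_def by (intro real_sqrt_gt_zero mult_pos_pos) auto
  have eq: "K * (normal_density 0 s y * (y - 0) ^ n) = y ^ n * exp (- a * y ^ 2)" for y n
    using K s a unfolding normal_density_def K_def[symmetric] by (simp add: field_simps)
  have "has_bochner_integral lborel (\<lambda>y. K * (normal_density 0 s y * (y - 0) ^ (2 * k)))
      (K * (fact (2 * k) / ((2 / s\<^sup>2) ^ k * fact k)))"
    by (intro has_bochner_integral_mult_right normal_moment_even s)
  thus "has_bochner_integral lborel (\<lambda>y. complex_of_real (y ^ (2 * k) * exp (- a * y ^ 2)))
      (of_real (K * (fact (2 * k) / ((2 / s\<^sup>2) ^ k * fact k))))"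
    unfolding eq by (intro has_bochner_integral_of_real)
  have "has_bochner_integral lborel (\<lambda>y. K * (normal_density 0 s y * (y - 0) ^ (2 * k + 1))) (K * 0)"
    by (intro has_bochner_integral_mult_right normal_moment_odd s)
  hence "has_bochner_integral lborel (\<lambda>y. complex_of_real (y ^ (2 * k + 1) * exp (- a * y ^ 2)))
      (of_real (K * 0))"
    unfolding eq by (intro has_bochner_integral_of_real)
  thus "has_bochner_integral lborel (\<lambda>y. complex_of_real (y ^ (2 * k + 1) * exp (- a * y ^ 2))) 0"
    by simp
qed

lemma integrable_gmom:
  assumes "a > 0"
  shows "integrable lborel (\<lambda>y. complex_of_real (y ^ n * exp (- a * y ^ 2)))"
proof (cases "even n")
  case True
  then obtain k where "n = 2 * k" by (rule evenE)
  thus ?thesis using gauss_bochner(1)[OF assms, of k] by (simp only: has_bochner_integral_iff)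
next
  case False
  then obtain k where "n = 2 * k + 1" by (rule oddE)
  thus ?thesis using gauss_bochner(2)[OF assms, of k] by (simp only: has_bochner_integral_iff)
qed

lemma gmom_0: "a > 0 \<Longrightarrow> gmom a 0 \<noteq> 0"
  using gauss_bochner(1)[of a 0] by (auto simp: has_bochner_integral_iff gmom_def)

text \<open>Integration by parts in one variable, obtained by comparing the closed forms of
  consecutive even moments, without differentiating anything. For \<open>n = 0\<close> the
  coefficient vanishes and the truncated \<open>n - 1\<close> does no harm.\<close>

lemma gmom_Suc:
  assumes a: "a > 0"
  shows "gmom a (Suc n) = of_nat n / (2 * of_real a) * gmom a (n - 1)"
proof (cases "even n")
  case True
  then obtain k where "n = 2 * k" by (rule evenE)
  hence odd: "odd (Suc n)" "n = 0 \<or> odd (n - 1)" by auto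
  have z: "gmom a j = 0" if "odd j" for j
    using that gauss_bochner(2)[OF a] by (auto simp: has_bochner_integral_iff gmom_def elim!: oddE)
  show ?thesis using odd z by auto
next
  case False
  then obtain k where k: "n = 2 * k + 1" by (rule oddE)
  define s where "s = 1 / sqrt (2 * a)"
  define K where "K = sqrt (2 * pi * s ^ 2)"
  have g: "gmom a (2 * k) = of_real (K * (fact (2 * k) / ((2 / s\<^sup>2) ^ k * fact k)))" for k
    using gauss_bochner(1)[OF a, of k]
    by (simp add: has_bochner_integral_iff gmom_def s_def K_def)
  have s2: "2 / s ^ 2 = 4 * a" using a by (simp add: s_def power_divide)
  have "fact (2 * Suc k) / ((4 * a) ^ Suc k * fact (Suc k)) =
      real n / (2 * a) * (fact (2 * k) / ((4 * a) ^ k * fact k))"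
  proof -
    have alg: "(p * q * F) / ((4 * a) * A * (r * G)) = q / (2 * a) * (F / (A * G))"
      if "p = 2 * r" "r > 0" "A > 0" "G > 0" for p q r F A G :: real
      using that a by (simp add: field_simps)
    have "fact (2 * Suc k) = (2 * real k + 2) * (2 * real k + 1) * fact (2 * k)"
      by (simp add: algebra_simps)
    hence "fact (2 * Suc k) / ((4 * a) ^ Suc k * fact (Suc k)) =
        ((2 * real k + 2) * (2 * real k + 1) * fact (2 * k)) /
        ((4 * a) * (4 * a) ^ k * ((real k + 1) * fact k))"
      by (simp add: algebra_simps)
    also have "\<dots> = (2 * real k + 1) / (2 * a) * (fact (2 * k) / ((4 * a) ^ k * fact k))"
      using a by (intro alg) auto
    finally show ?thesis by (simp add: k)
  qed
  hence "gmom a (2 * Suc k) = of_real (real n / (2 * a)) * gmom a (2 * k)"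
    unfolding g s2 by (simp only: of_real_mult[symmetric] mult.left_commute)
  thus ?thesis by (simp add: k)
qed

section \<open>Polynomials in the real coordinates and their Gaussian integrals\<close>

type_synonym conf = "nat \<times> nat \<times> nat \<Rightarrow> real"

text \<open>In tr M^2 the square of a diagonal coordinate occurs once and that of an off-diagonal
  one twice; the prefactor N / 2 of the weight turns this into the two values.\<close>

definition prec :: "nat \<Rightarrow> nat \<times> nat \<times> nat \<Rightarrow> real" where
  "prec N x = (case x of (c, i, j) \<Rightarrow> if i = j then real N / 2 else real N)"

definition weight :: "nat \<Rightarrow> conf \<Rightarrow> real" where
  "weight N y = (\<Prod>x\<in>coords N. exp (- prec N x * y x ^ 2))"

definition lebesgue_conf :: "nat \<Rightarrow> conf measure" where
  "lebesgue_conf N = (\<Pi>\<^sub>M i\<in>coords N. (lborel :: real measure))"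

definition cmono :: "nat \<Rightarrow> (nat \<times> nat \<times> nat \<Rightarrow> nat) \<Rightarrow> conf \<Rightarrow> complex" where
  "cmono N e y = (\<Prod>x\<in>coords N. of_real (y x) ^ e x)"

text \<open>Polynomials in the coordinates, as functions, together with all their partial derivatives.\<close>

inductive grad :: "nat \<Rightarrow> (conf \<Rightarrow> complex) \<Rightarrow> (nat \<times> nat \<times> nat \<Rightarrow> conf \<Rightarrow> complex) \<Rightarrow> bool"
  for N where
  grad_mono: "grad N (cmono N e) (\<lambda>x y. of_nat (e x) * cmono N (e(x := e x - 1)) y)"
| grad_add: "grad N f f' \<Longrightarrow> grad N g g' \<Longrightarrow> grad N (\<lambda>y. f y + g y) (\<lambda>x y. f' x y + g' x y)"
| grad_scale: "grad N f f' \<Longrightarrow> grad N (\<lambda>y. r * f y) (\<lambda>x y. r * f' x y)"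

definition gint :: "nat \<Rightarrow> (conf \<Rightarrow> complex) \<Rightarrow> complex" where
  "gint N f = (\<integral>y. f y * of_real (weight N y) \<partial>lebesgue_conf N)"

lemma finite_coords [simp]: "finite (coords N)"
  by (simp add: coords_def)

lemma prec_pos: "N > 0 \<Longrightarrow> prec N x > 0"
  by (auto simp: prec_def split: prod.splits)

interpretation lb: product_sigma_finite "\<lambda>_. lborel :: real measure"
  by standard

lemma mono_weight:
  "cmono N e y * of_real (weight N y) =
     (\<Prod>x\<in>coords N. complex_of_real (y x ^ e x * exp (- prec N x * y x ^ 2)))"
  by (simp add: cmono_def weight_def prod.distrib)

lemma integrable_mono:
  assumes "N > 0"
  shows "integrable (lebesgue_conf N) (\<lambda>y. cmono N e y * of_real (weight N y))"
  unfolding mono_weight lebesgue_conf_def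
  by (intro lb.product_integrable_prod finite_coords integrable_gmom prec_pos assms)

lemma gint_mono:
  assumes "N > 0"
  shows "gint N (cmono N e) = (\<Prod>x\<in>coords N. gmom (prec N x) (e x))"
  unfolding gint_def mono_weight lebesgue_conf_def
  unfolding gmom_def by (intro lb.product_integral_prod finite_coords integrable_gmom prec_pos assms)

lemma grad_integrable:
  assumes "N > 0" "grad N f g"
  shows "integrable (lebesgue_conf N) (\<lambda>y. f y * of_real (weight N y))"
  using assms(2)
proof induction
  case (grad_mono e)
  show ?case by (rule integrable_mono[OF assms(1)])
next
  case (grad_add f f' g g')
  thus ?case by (simp add: ring_distribs)
next
  case (grad_scale f f' r)
  thus ?case by (simp add: mult.assoc)
qed

lemma grad_partial:
  assumes "grad N f g" shows "\<exists>h. grad N (g x) h"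
  using assms
proof induction
  case (grad_mono e)
  show ?case using grad.grad_scale[OF grad.grad_mono] by blast
next
  case (grad_add f f' g g')
  thus ?case using grad.grad_add by blast
next
  case (grad_scale f f' r)
  thus ?case using grad.grad_scale by blast
qed

lemma gint_add:
  assumes "N > 0" "grad N f f'" "grad N g g'"
  shows "gint N (\<lambda>y. f y + g y) = gint N f + gint N g"
  using grad_integrable[OF assms(1,2)] grad_integrable[OF assms(1,3)]
  by (simp add: gint_def ring_distribs)

lemma gint_scale: "gint N (\<lambda>y. r * f y) = r * gint N f"
  by (simp add: gint_def mult.assoc)

lemma cmono_mult: "cmono N d y * cmono N e y = cmono N (\<lambda>x. d x + e x) y"
  by (simp add: cmono_def power_add prod.distrib)

lemma mono_upd:
  assumes "x \<in> coords N"
  shows "cmono N (e(x := n)) y = of_real (y x) ^ n * (\<Prod>z\<in>coords N - {x}. of_real (y z) ^ e z)"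
proof -
  have "cmono N (e(x := n)) y =
      of_real (y x) ^ n * (\<Prod>z\<in>coords N - {x}. of_real (y z) ^ (e(x := n)) z)"
    unfolding cmono_def using assms by (subst prod.remove[of _ x]) auto
  also have "(\<Prod>z\<in>coords N - {x}. complex_of_real (y z) ^ (e(x := n)) z) =
      (\<Prod>z\<in>coords N - {x}. of_real (y z) ^ e z)"
    by (intro prod.cong) auto
  finally show ?thesis .
qed

lemma coord_mult_mono:
  assumes "x \<in> coords N"
  shows "of_real (y x) * cmono N e y = cmono N (e(x := Suc (e x))) y"
proof -
  have "cmono N e y = cmono N (e(x := e x)) y" by simp
  also have "of_real (y x) * \<dots> = cmono N (e(x := Suc (e x))) y"
    unfolding mono_upd[OF assms] by simp
  finally show ?thesis .
qed

text \<open>On a monomial only the factor in the coordinate \<open>x\<close> changes, and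
  \<open>gmom_Suc\<close> acts there. The second claim shares the induction because additivity of
  the integral requires the products with the coordinate to be polynomials.\<close>

lemma stein:
  assumes N: "N > 0" and x: "x \<in> coords N" and g: "grad N f g"
  shows "gint N (\<lambda>y. of_real (y x) * f y) = gint N (g x) / (2 * of_real (prec N x))"
    and "\<exists>h. grad N (\<lambda>y. of_real (y x) * f y) h"
  using g
proof induction
  case (grad_mono e)
  have upd: "(\<Prod>z\<in>coords N. gmom (prec N z) ((e(x := n)) z)) =
      gmom (prec N x) n * (\<Prod>z\<in>coords N - {x}. gmom (prec N z) (e z))" for n
  proof -
    have "(\<Prod>z\<in>coords N. gmom (prec N z) ((e(x := n)) z)) =
        gmom (prec N x) n * (\<Prod>z\<in>coords N - {x}. gmom (prec N z) ((e(x := n)) z))"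
      using x by (subst prod.remove[of _ x]) auto
    also have "(\<Prod>z\<in>coords N - {x}. gmom (prec N z) ((e(x := n)) z)) =
        (\<Prod>z\<in>coords N - {x}. gmom (prec N z) (e z))"
      by (intro prod.cong) auto
    finally show ?thesis .
  qed
  { case 1
    show ?case
      unfolding coord_mult_mono[OF x] gint_scale gint_mono[OF N] upd gmom_Suc[OF prec_pos[OF N]]
      by simp }
  { case 2
    show ?case unfolding coord_mult_mono[OF x] using grad.grad_mono by blast }
next
  case (grad_add f f' g g')
  { case 1
    obtain h1 h2 where h: "grad N (f' x) h1" "grad N (g' x) h2"
      using grad_partial[OF grad_add.hyps(1)] grad_partial[OF grad_add.hyps(2)] by blast
    obtain h3 h4 where "grad N (\<lambda>y. of_real (y x) * f y) h3" "grad N (\<lambda>y. of_real (y x) * g y) h4"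
      using grad_add.IH(2,4) by blast
    from gint_add[OF N this]
    have "gint N (\<lambda>y. of_real (y x) * (f y + g y)) =
        gint N (\<lambda>y. of_real (y x) * f y) + gint N (\<lambda>y. of_real (y x) * g y)"
      by (simp add: distrib_left)
    thus ?case using grad_add.IH(1,3) gint_add[OF N h] by (simp add: add_divide_distrib) }
  { case 2
    show ?case using grad_add.IH(2,4) unfolding distrib_left by (elim exE) (rule exI, rule grad.grad_add) }
next
  case (grad_scale f f' r)
  { case 1
    have "gint N (\<lambda>y. of_real (y x) * (r * f y)) = r * gint N (\<lambda>y. of_real (y x) * f y)"
      unfolding gint_scale[symmetric] by (simp add: mult_ac)
    thus ?case using grad_scale.IH by (simp add: gint_scale) }
  { case 2
    show ?case using grad_scale.IH(2) unfolding mult.left_commute[of _ r]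
      by (elim exE) (rule exI, rule grad.grad_scale) }
qed

lemma mono_derivative_mult:
  assumes "x \<in> coords N"
  shows "of_nat (d x + e x) * cmono N ((\<lambda>z. d z + e z)(x := d x + e x - 1)) y =
    of_nat (d x) * cmono N (d(x := d x - 1)) y * cmono N e y +
    cmono N d y * (of_nat (e x) * cmono N (e(x := e x - 1)) y)"
proof -
  have split: "cmono N e y =
      of_real (y x) ^ e x * (\<Prod>z\<in>coords N - {x}. of_real (y z) ^ e z)" for e
    using mono_upd[OF assms, of e "e x"] by simp
  have p: "(\<Prod>z\<in>coords N - {x}. complex_of_real (y z) ^ (d z + e z)) =
      (\<Prod>z\<in>coords N - {x}. of_real (y z) ^ d z) * (\<Prod>z\<in>coords N - {x}. of_real (y z) ^ e z)"
    by (simp add: power_add prod.distrib)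
  show ?thesis
    unfolding mono_upd[OF assms] split[of d] split[of e] p
    by (cases "d x"; cases "e x") (simp_all add: algebra_simps power_add)
qed

text \<open>Exponents outside \<open>coords N\<close> do not affect the function, so a gradient is
  meaningful only on the coordinates; hence the restricted form of the product rule.\<close>

lemma grad_mult:
  assumes "grad N f f'" "grad N g g'"
  shows "\<exists>h. grad N (\<lambda>y. f y * g y) h \<and>
    (\<forall>x\<in>coords N. \<forall>y. h x y = f' x y * g y + f y * g' x y)"
  using assms(1)
proof induction
  case (grad_mono d)
  show ?case using assms(2)
  proof induction
    case (grad_mono e)
    have g: "grad N (\<lambda>y. cmono N d y * cmono N e y)
        (\<lambda>x y. of_nat (d x + e x) * cmono N ((\<lambda>z. d z + e z)(x := d x + e x - 1)) y)"
      unfolding cmono_mult by (rule grad.grad_mono)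
    show ?case by (rule exI, rule conjI, rule g) (intro ballI allI mono_derivative_mult)
  next
    case (grad_add f f' g g')
    then obtain h1 h2 where
      "grad N (\<lambda>y. cmono N d y * f y) h1" "grad N (\<lambda>y. cmono N d y * g y) h2"
      and h: "\<forall>x\<in>coords N. \<forall>y. h1 x y = of_nat (d x) * cmono N (d(x := d x - 1)) y * f y + cmono N d y * f' x y"
      "\<forall>x\<in>coords N. \<forall>y. h2 x y = of_nat (d x) * cmono N (d(x := d x - 1)) y * g y + cmono N d y * g' x y"
      by blast
    from grad.grad_add[OF this(1,2)] h show ?case
      unfolding distrib_left[symmetric] by (intro exI conjI) (assumption, simp add: algebra_simps fun_upd_def)
  next
    case (grad_scale f f' r)
    then obtain h1 where "grad N (\<lambda>y. cmono N d y * f y) h1"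
      and h: "\<forall>x\<in>coords N. \<forall>y. h1 x y = of_nat (d x) * cmono N (d(x := d x - 1)) y * f y + cmono N d y * f' x y"
      by blast
    from grad.grad_scale[OF this(1), of r] h show ?case
      unfolding mult.left_commute[of r] by (intro exI conjI) (assumption, simp add: algebra_simps fun_upd_def)
  qed
next
  case (grad_add f1 f1' f2 f2')
  then obtain h1 h2 where
    "grad N (\<lambda>y. f1 y * g y) h1" "grad N (\<lambda>y. f2 y * g y) h2"
    and h: "\<forall>x\<in>coords N. \<forall>y. h1 x y = f1' x y * g y + f1 y * g' x y"
    "\<forall>x\<in>coords N. \<forall>y. h2 x y = f2' x y * g y + f2 y * g' x y"
    by blast
  from grad.grad_add[OF this(1,2)] h show ?case
    unfolding distrib_right[symmetric] by (intro exI conjI) (assumption, simp add: algebra_simps fun_upd_def)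
next
  case (grad_scale f f' r)
  then obtain h1 where "grad N (\<lambda>y. f y * g y) h1"
    and h: "\<forall>x\<in>coords N. \<forall>y. h1 x y = f' x y * g y + f y * g' x y"
    by blast
  from grad.grad_scale[OF this(1), of r] h show ?case
    unfolding mult.assoc[symmetric] by (intro exI conjI) (assumption, simp add: algebra_simps fun_upd_def)
qed

section \<open>Derivatives with respect to matrix entries\<close>

text \<open>The entry \<open>(i, j)\<close> of a Hermitian matrix as a linear form, applied to the coordinates \<open>g\<close>.\<close>

definition entry_form :: "nat \<Rightarrow> nat \<Rightarrow> nat \<Rightarrow> (nat \<times> nat \<times> nat \<Rightarrow> complex) \<Rightarrow> complex" where
  "entry_form c i j g = (if i = j then g (c, i, i)
     else if i < j then g (c, i, j) + \<i> * g (c, j, i) else g (c, j, i) - \<i> * g (c, i, j))"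

definition entry :: "nat \<Rightarrow> nat \<Rightarrow> nat \<Rightarrow> conf \<Rightarrow> complex" where
  "entry c i j y = entry_form c i j (\<lambda>x. of_real (y x))"

lemma herm_entry: "i < N \<Longrightarrow> j < N \<Longrightarrow> herm N y c $$ (i, j) = entry c i j y"
  by (auto simp: herm_def entry_def entry_form_def complex_eq_iff)

lemma herm_dim [simp]: "dim_row (herm N y c) = N" "dim_col (herm N y c) = N"
  by (simp_all add: herm_def)

lemma herm_carrier [simp]: "herm N y c \<in> carrier_mat N N"
  by (simp add: herm_def)

lemma coords_iff: "(c, i, j) \<in> coords N \<longleftrightarrow> c \<in> {1..3} \<and> i < N \<and> j < N"
  by (auto simp: coords_def)

lemma gauss_weight_herm:
  "gauss_weight N (herm N y) = of_real (weight N y)"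
proof -
  \<comment> \<open>The product of the entries (i, j) and (j, i) will be written as
    \<open>h c i j + h c j i\<close>, which counts a diagonal square twice; therefore it is
    halved.\<close>
  define h where "h c i j = (if i = j then 1 / 2 else 1) * y (c, i, j) ^ 2" for c i j
  have ee: "entry c i j y * entry c j i y = of_real (h c i j + h c j i)" for c i j
    by (auto simp: entry_def entry_form_def h_def complex_eq_iff power2_eq_square algebra_simps)
  have tr: "mtrace (herm N y c ^\<^sub>m 2) = of_real (2 * (\<Sum>i<N. \<Sum>j<N. h c i j))" for c
  proof -
    have "mtrace (herm N y c ^\<^sub>m 2) = (\<Sum>i<N. \<Sum>j<N. entry c i j y * entry c j i y)"
      by (simp add: mtrace_def numeral_2_eq_2)
        (intro sum.cong refl, simp add: scalar_prod_def herm_entry atLeast0LessThan)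
    also have "\<dots> = of_real ((\<Sum>i<N. \<Sum>j<N. h c i j) + (\<Sum>i<N. \<Sum>j<N. h c j i))"
      by (simp only: ee of_real_sum of_real_add sum.distrib)
    also have "(\<Sum>i<N. \<Sum>j<N. h c j i) = (\<Sum>i<N. \<Sum>j<N. h c i j)"
      by (rule sum.swap)
    finally show ?thesis by simp
  qed
  have "- (real N / 2) * (\<Sum>c\<in>{1..3}. 2 * (\<Sum>i<N. \<Sum>j<N. h c i j)) =
      (\<Sum>c\<in>{1..3}. \<Sum>i<N. \<Sum>j<N. - prec N (c, i, j) * y (c, i, j) ^ 2)"
    unfolding sum_distrib_left by (intro sum.cong) (auto simp: h_def prec_def)
  also have "\<dots> = (\<Sum>x\<in>coords N. - prec N x * y x ^ 2)"
    unfolding coords_def sum.cartesian_product by (intro sum.cong) auto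
  finally have S: "- (real N / 2) * (\<Sum>c\<in>{1..3}. 2 * (\<Sum>i<N. \<Sum>j<N. h c i j)) = \<dots>" .
  have "gauss_weight N (herm N y) =
      exp (of_real (- (real N / 2) * (\<Sum>c\<in>{1..3}. 2 * (\<Sum>i<N. \<Sum>j<N. h c i j))))"
    unfolding gauss_weight_def tr by simp
  also have "\<dots> = of_real (exp (\<Sum>x\<in>coords N. - prec N x * y x ^ 2))"
    unfolding S exp_of_real ..
  also have "exp (\<Sum>x\<in>coords N. - prec N x * y x ^ 2) = weight N y"
    unfolding weight_def by (rule exp_sum) simp
  finally show ?thesis .
qed

lemma gauss_integral_eq: "gauss_integral N f = gint N (\<lambda>y. f (herm N y))"
  by (simp add: gauss_integral_def gint_def lebesgue_conf_def gauss_weight_herm)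

lemma grad_const: "grad N (\<lambda>y. r) (\<lambda>x y. 0)"
proof -
  have "grad N (\<lambda>y. r * cmono N (\<lambda>_. 0) y) (\<lambda>x y. r * (of_nat 0 * cmono N ((\<lambda>_. 0)(x := 0 - 1)) y))"
    by (rule grad_scale, rule grad_mono)
  thus ?thesis by (simp add: cmono_def)
qed

lemma grad_coord:
  assumes "x \<in> coords N"
  shows "grad N (\<lambda>y. of_real (y x)) (\<lambda>z y. if z = x then 1 else 0)"
proof -
  have 1: "cmono N (\<lambda>z. if z = x then 1 else 0) = (\<lambda>y. of_real (y x))"
    using assms by (auto simp: cmono_def fun_eq_iff if_distrib[of "\<lambda>n. _ ^ n"] prod.delta cong: if_cong)
  have 2: "(\<lambda>z y. of_nat (if z = x then 1 else 0) *
        cmono N ((\<lambda>z. if z = x then 1 else 0)(z := (if z = x then 1 else 0) - 1)) y) =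
      (\<lambda>z y. if z = x then 1 else 0)"
    by (auto simp: cmono_def fun_eq_iff intro!: prod.neutral)
  show ?thesis using grad_mono[of N "\<lambda>z. if z = x then 1 else 0"] unfolding 1 2 .
qed

lemma grad_entry_form:
  assumes "(c, i, j) \<in> coords N" "\<And>x. x \<in> coords N \<Longrightarrow> grad N (F x) (G x)"
  shows "grad N (\<lambda>y. entry_form c i j (\<lambda>x. F x y)) (\<lambda>z y. entry_form c i j (\<lambda>x. G x z y))"
proof -
  have c: "(c, i, j) \<in> coords N" "(c, j, i) \<in> coords N" "(c, i, i) \<in> coords N"
    using assms(1) by (auto simp: coords_iff)
  note g = c[THEN assms(2)]
  consider "i = j" | "i < j" | "j < i" by linarith
  thus ?thesis
  proof cases
    case 1
    thus ?thesis using g by (simp add: entry_form_def)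
  next
    case 2
    thus ?thesis using grad_add[OF g(1) grad_scale[OF g(2), of \<i>]] by (simp add: entry_form_def)
  next
    case 3
    thus ?thesis using grad_add[OF g(2) grad_scale[OF g(1), of "- \<i>"]]
      by (simp add: entry_form_def)
  qed
qed

lemma gint_entry_form:
  assumes N: "N > 0" and "(c, i, j) \<in> coords N" "\<And>x. x \<in> coords N \<Longrightarrow> \<exists>h. grad N (F x) h"
  shows "gint N (\<lambda>y. entry_form c i j (\<lambda>x. F x y)) = entry_form c i j (\<lambda>x. gint N (F x))"
proof -
  obtain G where G: "\<And>x. x \<in> coords N \<Longrightarrow> grad N (F x) (G x)" using assms(3) by metis
  have c: "(c, i, j) \<in> coords N" "(c, j, i) \<in> coords N" "(c, i, i) \<in> coords N"
    using assms(2) by (auto simp: coords_iff)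
  note g = c[THEN G]
  consider "i = j" | "i < j" | "j < i" by linarith
  thus ?thesis
  proof cases
    case 1
    thus ?thesis by (simp add: entry_form_def)
  next
    case 2
    thus ?thesis using gint_add[OF N g(1) grad_scale[OF g(2), of \<i>]]
      by (simp add: entry_form_def gint_scale)
  next
    case 3
    have "gint N (\<lambda>y. - \<i> * F (c, i, j) y) = - \<i> * gint N (F (c, i, j))" by (rule gint_scale)
    thus ?thesis using 3 gint_add[OF N g(2) grad_scale[OF g(1), of "- \<i>"]]
      by (simp add: entry_form_def)
  qed
qed

lemma entry_form_linear:
  "entry_form c i j (\<lambda>x. g x + h x) = entry_form c i j g + entry_form c i j h"
  "entry_form c i j (\<lambda>x. r * g x) = r * entry_form c i j g"
  "entry_form c i j (\<lambda>x. g x * r) = entry_form c i j g * r"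
  "entry_form c i j (\<lambda>x. 0) = 0"
  by (auto simp: entry_form_def algebra_simps)

lemma entry_form_cong:
  assumes "(c, i, j) \<in> coords N" "\<And>x. x \<in> coords N \<Longrightarrow> g x = h x"
  shows "entry_form c i j g = entry_form c i j h"
  using assms by (auto simp: entry_form_def coords_iff)

text \<open>\<open>mder N c i j f f'\<close>: the function \<open>f\<close> is a polynomial in the matrix entries and \<open>f'\<close> is its
  derivative with respect to the entry \<open>(j, i)\<close> of \<open>M c\<close>, all entries being treated as independent.\<close>

definition mder :: "nat \<Rightarrow> nat \<Rightarrow> nat \<Rightarrow> nat \<Rightarrow> (conf \<Rightarrow> complex) \<Rightarrow> (conf \<Rightarrow> complex) \<Rightarrow> bool" where
  "mder N c i j f f' \<longleftrightarrow> (\<exists>g. grad N f g \<and>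
     (\<forall>y. f' y = of_nat N * entry_form c i j (\<lambda>x. g x y / (2 * of_real (prec N x)))))"

context
  fixes N c i j :: nat
  assumes cij: "(c, i, j) \<in> coords N"
begin

lemma mder_const: "mder N c i j (\<lambda>y. r) (\<lambda>y. 0)"
  unfolding mder_def using grad_const[of N r] by (intro exI conjI, assumption)
    (simp add: entry_form_linear)

lemma mder_add:
  assumes "mder N c i j f f'" "mder N c i j g g'"
  shows "mder N c i j (\<lambda>y. f y + g y) (\<lambda>y. f' y + g' y)"
proof -
  from assms obtain f1 g1 where *: "grad N f f1" "grad N g g1"
    "\<And>y. f' y = of_nat N * entry_form c i j (\<lambda>x. f1 x y / (2 * of_real (prec N x)))"
    "\<And>y. g' y = of_nat N * entry_form c i j (\<lambda>x. g1 x y / (2 * of_real (prec N x)))"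
    unfolding mder_def by blast
  show ?thesis unfolding mder_def using grad_add[OF *(1,2)]
    by (intro exI conjI, assumption) (simp add: *(3,4) add_divide_distrib entry_form_linear algebra_simps)
qed

lemma mder_mult:
  assumes "mder N c i j f f'" "mder N c i j g g'"
  shows "mder N c i j (\<lambda>y. f y * g y) (\<lambda>y. f' y * g y + f y * g' y)"
proof -
  from assms obtain f1 g1 where *: "grad N f f1" "grad N g g1"
    "\<And>y. f' y = of_nat N * entry_form c i j (\<lambda>x. f1 x y / (2 * of_real (prec N x)))"
    "\<And>y. g' y = of_nat N * entry_form c i j (\<lambda>x. g1 x y / (2 * of_real (prec N x)))"
    unfolding mder_def by blast
  from grad_mult[OF *(1,2)] obtain h where h: "grad N (\<lambda>y. f y * g y) h"
    "\<And>x y. x \<in> coords N \<Longrightarrow> h x y = f1 x y * g y + f y * g1 x y" by blast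
  have "of_nat N * entry_form c i j (\<lambda>x. h x y / (2 * of_real (prec N x))) = f' y * g y + f y * g' y" for y
  proof -
    have "entry_form c i j (\<lambda>x. h x y / (2 * of_real (prec N x))) =
        entry_form c i j (\<lambda>x. f1 x y / (2 * of_real (prec N x)) * g y + f y * (g1 x y / (2 * of_real (prec N x))))"
      by (intro entry_form_cong[OF cij]) (simp add: h(2) add_divide_distrib)
    thus ?thesis unfolding *(3,4) by (simp only: entry_form_linear) (simp only: algebra_simps)
  qed
  thus ?thesis unfolding mder_def by (intro exI[of _ h] conjI h(1)) simp
qed

lemma mder_sum:
  assumes "finite A" "\<And>a. a \<in> A \<Longrightarrow> mder N c i j (f a) (f' a)"
  shows "mder N c i j (\<lambda>y. \<Sum>a\<in>A. f a y) (\<lambda>y. \<Sum>a\<in>A. f' a y)"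
  using assms
proof (induction rule: finite_induct)
  case empty
  show ?case using mder_const[of 0] by simp
next
  case (insert a A)
  thus ?case using mder_add[of "f a" "f' a"] by simp
qed

text \<open>Off the diagonal the formula in \<open>mder\<close> is half the real partial derivative
  plus or minus i times half the imaginary one, that is, the Wirtinger derivative in the entry (j,
  i). It treats an entry and its conjugate as independent, hence the Kronecker deltas.\<close>

lemma mder_entry:
  assumes "N > 0" "(c', p, q) \<in> coords N"
  shows "mder N c i j (entry c' p q) (\<lambda>y. if c' = c \<and> p = j \<and> q = i then 1 else 0)"
proof -
  define G where "G = (\<lambda>z (y :: conf). entry_form c' p q (\<lambda>x. if z = x then 1 else 0))"
  have g: "grad N (entry c' p q) G"
    unfolding entry_def G_def using grad_entry_form[OF assms(2) grad_coord] by simp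
  have "i = j \<or> i < j \<or> j < i" "p = q \<or> p < q \<or> q < p" by linarith+
  hence "of_nat N * entry_form c i j (\<lambda>x. G x y / (2 * of_real (prec N x)))
      = (if c' = c \<and> p = j \<and> q = i then 1 else 0)" for y
    using assms(1) by (elim disjE) (simp_all add: G_def entry_form_def prec_def, (intro impI conjI; elim conjE; linarith)+)
  thus ?thesis unfolding mder_def by (intro exI[of _ G] conjI g) simp
qed

text \<open>The factors 1 / (2 prec) that \<open>stein\<close> produces are the variances of the
  coordinates; \<open>mder\<close> contains them multiplied by N, so that the covariance 1 / N of
  the entries (i, j) and (j, i) appears uniformly, on and off the diagonal.\<close>

lemma stein_entry:
  assumes N: "N > 0" and f: "mder N c i j f f'"
  shows "gint N (\<lambda>y. entry c i j y * f y) = gint N f' / of_nat N"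
proof -
  from f obtain g where g: "grad N f g"
    "\<And>y. f' y = of_nat N * entry_form c i j (\<lambda>x. g x y / (2 * of_real (prec N x)))"
    unfolding mder_def by blast
  have "gint N (\<lambda>y. entry c i j y * f y) =
      gint N (\<lambda>y. entry_form c i j (\<lambda>x. of_real (y x) * f y))"
    by (simp add: entry_def entry_form_linear)
  also have "\<dots> = entry_form c i j (\<lambda>x. gint N (\<lambda>y. of_real (y x) * f y))"
    by (intro gint_entry_form[OF N cij] stein(2)[OF N _ g(1)])
  also have "\<dots> = entry_form c i j (\<lambda>x. gint N (g x) / (2 * of_real (prec N x)))"
    by (intro entry_form_cong[OF cij] stein(1)[OF N _ g(1)])
  also have "\<dots> = entry_form c i j (\<lambda>x. gint N (\<lambda>y. inverse (2 * of_real (prec N x)) * g x y))"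
    by (intro entry_form_cong[OF cij], subst gint_scale) (simp only: divide_inverse mult.commute)
  also have "\<dots> = gint N (\<lambda>y. entry_form c i j (\<lambda>x. inverse (2 * of_real (prec N x)) * g x y))"
  proof (intro gint_entry_form[OF N cij, symmetric])
    fix x
    obtain h where "grad N (g x) h" using grad_partial[OF g(1)] by blast
    thus "\<exists>h. grad N (\<lambda>y. inverse (2 * of_real (prec N x)) * g x y) h"
      by (intro exI, rule grad_scale)
  qed
  also have "\<dots> = gint N f' / of_nat N"
  proof -
    have f': "f' = (\<lambda>y. of_nat N * entry_form c i j (\<lambda>x. inverse (2 * of_real (prec N x)) * g x y))"
      by (rule ext) (simp only: g(2) divide_inverse mult.commute)
    show ?thesis using N by (simp add: f' gint_scale[of N "of_nat N"])
  qed
  finally show ?thesis .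
qed

end

section \<open>Loop equations of the Gaussian model\<close>

definition mpow :: "nat \<Rightarrow> nat \<Rightarrow> nat \<Rightarrow> nat \<Rightarrow> nat \<Rightarrow> conf \<Rightarrow> complex" where
  "mpow N c k i j y = (herm N y c ^\<^sub>m k) $$ (i, j)"

definition tr_pow :: "nat \<Rightarrow> nat \<Rightarrow> nat \<Rightarrow> conf \<Rightarrow> complex" where
  "tr_pow N c a y = mtrace (herm N y c ^\<^sub>m a)"

lemma mpow_0: "i < N \<Longrightarrow> j < N \<Longrightarrow> mpow N c 0 i j y = (if i = j then 1 else 0)"
  by (simp add: mpow_def)

lemma mpow_Suc:
  "i < N \<Longrightarrow> j < N \<Longrightarrow> mpow N c (Suc k) i j y = (\<Sum>q<N. mpow N c k i q y * entry c q j y)"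
  by (auto simp: mpow_def scalar_prod_def atLeast0LessThan herm_entry intro!: sum.cong)

lemma mpow_add:
  assumes "i < N" "j < N"
  shows "(\<Sum>q<N. mpow N c k i q y * mpow N c l q j y) = mpow N c (k + l) i j y"
  using assms(2)
proof (induction l arbitrary: j)
  case 0
  have "(\<Sum>q<N. mpow N c k i q y * mpow N c 0 q j y) = (\<Sum>q<N. if q = j then mpow N c k i q y else 0)"
    using 0 by (intro sum.cong) (auto simp: mpow_0)
  thus ?case using 0 by simp
next
  case (Suc l)
  have "(\<Sum>q<N. mpow N c k i q y * mpow N c (Suc l) q j y) =
      (\<Sum>q<N. \<Sum>p<N. mpow N c k i q y * mpow N c l q p y * entry c p j y)"
    using Suc.prems by (intro sum.cong) (auto simp: mpow_Suc sum_distrib_left mult.assoc)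
  also have "\<dots> = (\<Sum>p<N. (\<Sum>q<N. mpow N c k i q y * mpow N c l q p y) * entry c p j y)"
    by (subst sum.swap) (simp add: sum_distrib_right)
  also have "\<dots> = mpow N c (k + Suc l) i j y"
    using Suc assms(1) by (simp add: mpow_Suc)
  finally show ?case .
qed

lemma tr_pow_eq: "tr_pow N c a y = (\<Sum>i<N. mpow N c a i i y)"
  by (simp add: tr_pow_def mtrace_def mpow_def)

lemma tr_pow_0: "tr_pow N c 0 y = of_nat N"
  by (simp add: tr_pow_eq mpow_0)

section \<open>Polynomial functions and derivatives of matrix powers and traces\<close>

definition poly_fun :: "nat \<Rightarrow> (conf \<Rightarrow> complex) \<Rightarrow> bool" where
  "poly_fun N f \<longleftrightarrow> (\<exists>g. grad N f g)"

lemma poly_fun_const: "poly_fun N (\<lambda>y. r)"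
  unfolding poly_fun_def using grad_const by blast

lemma poly_fun_add: "poly_fun N f \<Longrightarrow> poly_fun N g \<Longrightarrow> poly_fun N (\<lambda>y. f y + g y)"
  unfolding poly_fun_def by (elim exE) (rule exI, rule grad_add)

lemma poly_fun_mult: "poly_fun N f \<Longrightarrow> poly_fun N g \<Longrightarrow> poly_fun N (\<lambda>y. f y * g y)"
  unfolding poly_fun_def using grad_mult by blast

lemma poly_fun_sum:
  assumes "finite A" "\<And>a. a \<in> A \<Longrightarrow> poly_fun N (f a)"
  shows "poly_fun N (\<lambda>y. \<Sum>a\<in>A. f a y)"
  using assms
proof (induction rule: finite_induct)
  case empty
  show ?case using poly_fun_const[of N 0] by simp
next
  case (insert a A)
  thus ?case using poly_fun_add[of N "f a"] by simp
qed

lemma gint_add':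
  assumes "N > 0" "poly_fun N f" "poly_fun N g"
  shows "gint N (\<lambda>y. f y + g y) = gint N f + gint N g"
  using assms gint_add unfolding poly_fun_def by blast

lemma gint_sum:
  assumes "N > 0" "finite A" "\<And>a. a \<in> A \<Longrightarrow> poly_fun N (f a)"
  shows "gint N (\<lambda>y. \<Sum>a\<in>A. f a y) = (\<Sum>a\<in>A. gint N (f a))"
  using assms(2,3)
proof (induction rule: finite_induct)
  case empty
  show ?case by (simp add: gint_def)
next
  case (insert a A)
  have "gint N (\<lambda>y. f a y + (\<Sum>b\<in>A. f b y)) = gint N (f a) + gint N (\<lambda>y. \<Sum>b\<in>A. f b y)"
    using insert by (intro gint_add'[OF assms(1)] poly_fun_sum) auto
  thus ?case using insert by simp
qed

lemma gint_sum2: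
  assumes "N > 0" "finite A" "finite B" "\<And>a b. a \<in> A \<Longrightarrow> b \<in> B \<Longrightarrow> poly_fun N (f a b)"
  shows "gint N (\<lambda>y. \<Sum>a\<in>A. \<Sum>b\<in>B. f a b y) = (\<Sum>a\<in>A. \<Sum>b\<in>B. gint N (f a b))"
proof -
  have "gint N (\<lambda>y. \<Sum>a\<in>A. \<Sum>b\<in>B. f a b y) = (\<Sum>a\<in>A. gint N (\<lambda>y. \<Sum>b\<in>B. f a b y))"
    using assms by (intro gint_sum poly_fun_sum) auto
  also have "\<dots> = (\<Sum>a\<in>A. \<Sum>b\<in>B. gint N (f a b))"
    using assms by (intro sum.cong gint_sum) auto
  finally show ?thesis .
qed

lemma mder_poly:
  assumes "(c, i, j) \<in> coords N" "mder N c i j f f'"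
  shows "poly_fun N f" "poly_fun N f'"
proof -
  from assms(2) obtain g where g: "grad N f g"
    "\<And>y. f' y = of_nat N * entry_form c i j (\<lambda>x. g x y / (2 * of_real (prec N x)))"
    unfolding mder_def by blast
  thus "poly_fun N f" unfolding poly_fun_def by blast
  from grad_partial[OF g(1)] obtain h where h: "\<And>x. grad N (g x) (h x)" by metis
  have f': "f' = (\<lambda>y. of_nat N * entry_form c i j (\<lambda>x. inverse (2 * of_real (prec N x)) * g x y))"
    by (rule ext) (simp only: g(2) divide_inverse mult.commute)
  show "poly_fun N f'"
    unfolding poly_fun_def f'
    by (rule exI, rule grad_scale, rule grad_entry_form[OF assms(1)], rule grad_scale, rule h)
qed

lemma poly_fun_entry:
  assumes "(c, i, j) \<in> coords N" shows "poly_fun N (entry c i j)"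
  unfolding poly_fun_def entry_def
  by (rule exI, rule grad_entry_form[OF assms], rule grad_coord)

lemma poly_fun_mpow:
  assumes "c \<in> {1..3}" "i < N" "j < N"
  shows "poly_fun N (mpow N c k i j)"
  using assms(3)
proof (induction k arbitrary: j)
  case 0
  have "mpow N c 0 i j = (\<lambda>y. if i = j then 1 else 0)"
    using 0 assms by (auto simp: mpow_0)
  thus ?case using poly_fun_const by simp
next
  case (Suc k)
  have "mpow N c (Suc k) i j = (\<lambda>y. \<Sum>q<N. mpow N c k i q y * entry c q j y)"
    using Suc.prems assms by (auto simp: mpow_Suc)
  thus ?case using Suc assms
    by (simp only:) (intro poly_fun_sum poly_fun_mult poly_fun_entry; simp add: coords_iff)
qed

lemma poly_fun_tr_pow: "c \<in> {1..3} \<Longrightarrow> poly_fun N (tr_pow N c a)"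
  unfolding tr_pow_eq[abs_def] by (intro poly_fun_sum poly_fun_mpow) auto

text \<open>Noncommutative Leibniz rule: deleting the factor that follows the first \<open>l\<close>
  cuts the word in two, with \<open>j\<close> and \<open>i\<close> as the new free indices. The
  induction splits off the last factor, whose derivative supplies the summand
  \<open>l = k\<close>.\<close>

lemma mder_mpow:
  assumes N: "N > 0" and c: "(c, i, j) \<in> coords N" and ab: "c' \<in> {1..3}" "a < N" "b < N"
  shows "mder N c i j (mpow N c' k a b)
    (\<lambda>y. if c' = c then \<Sum>l<k. mpow N c l a j y * mpow N c (k - 1 - l) i b y else 0)"
  using ab(3)
proof (induction k arbitrary: b)
  case 0
  have "mpow N c' 0 a b = (\<lambda>y. if a = b then 1 else 0)"
    using 0 ab by (auto simp: mpow_0)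
  moreover have "(\<lambda>y. if c' = c then \<Sum>l<0. mpow N c l a j y * mpow N c (0 - 1 - l) i b y else 0) =
      (\<lambda>y. 0)" by auto
  ultimately show ?case using mder_const[OF c] by simp
next
  case (Suc k)
  have ij: "i < N" "j < N" using c by (auto simp: coords_iff)
  have f: "mpow N c' (Suc k) a b = (\<lambda>y. \<Sum>q<N. mpow N c' k a q y * entry c' q b y)"
    using Suc.prems ab by (auto simp: mpow_Suc)
  have d: "mder N c i j (\<lambda>y. \<Sum>q<N. mpow N c' k a q y * entry c' q b y)
    (\<lambda>y. \<Sum>q<N. (if c' = c then \<Sum>l<k. mpow N c l a j y * mpow N c (k - 1 - l) i q y else 0) * entry c' q b y
       + mpow N c' k a q y * (if c' = c \<and> q = j \<and> b = i then 1 else 0))"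
    using ab Suc by (intro mder_sum[OF c] mder_mult[OF c] mder_entry[OF c] N Suc.IH)
      (auto simp: coords_iff)
  have "(\<Sum>q<N. (\<Sum>l<k. mpow N c l a j y * mpow N c (k - 1 - l) i q y) * entry c q b y
       + mpow N c k a q y * (if q = j \<and> b = i then 1 else 0)) =
     (\<Sum>l<Suc k. mpow N c l a j y * mpow N c (Suc k - 1 - l) i b y)" for y
  proof -
    have "(\<Sum>q<N. (\<Sum>l<k. mpow N c l a j y * mpow N c (k - 1 - l) i q y) * entry c q b y) =
        (\<Sum>l<k. \<Sum>q<N. mpow N c l a j y * mpow N c (k - 1 - l) i q y * entry c q b y)"
      by (subst sum.swap) (simp add: sum_distrib_right)
    also have "\<dots> = (\<Sum>l<k. mpow N c l a j y * (\<Sum>q<N. mpow N c (k - 1 - l) i q y * entry c q b y))"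
      by (simp add: sum_distrib_left mult.assoc)
    also have "\<dots> = (\<Sum>l<k. mpow N c l a j y * mpow N c (Suc k - 1 - l) i b y)"
      using ij Suc.prems
      by (intro sum.cong refl) (simp add: mpow_Suc[symmetric] Suc_diff_Suc)
    finally have 1: "(\<Sum>q<N. (\<Sum>l<k. mpow N c l a j y * mpow N c (k - 1 - l) i q y) * entry c q b y) = \<dots>" .
    have "(\<Sum>q<N. mpow N c k a q y * (if q = j \<and> b = i then 1 else 0)) =
        (\<Sum>q<N. if q = j then mpow N c k a q y * (if b = i then 1 else 0) else 0)"
      by (intro sum.cong) auto
    also have "\<dots> = mpow N c k a j y * mpow N c 0 i b y"
      using ij Suc.prems by (simp add: mpow_0)
    finally show ?thesis using 1 by (simp add: sum.distrib)
  qed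
  hence "(\<lambda>y. \<Sum>q<N. (if c' = c then \<Sum>l<k. mpow N c l a j y * mpow N c (k - 1 - l) i q y else 0) * entry c' q b y
       + mpow N c' k a q y * (if c' = c \<and> q = j \<and> b = i then 1 else 0)) =
    (\<lambda>y. if c' = c then \<Sum>l<Suc k. mpow N c l a j y * mpow N c (Suc k - 1 - l) i b y else 0)"
    by (cases "c' = c") auto
  thus ?case using d unfolding f by simp
qed

text \<open>\<open>F'\<close> is the derivative of the polynomial \<open>F\<close> in the direction \<open>M c \<mapsto> (M c) ^ k\<close>.\<close>

definition tder :: "nat \<Rightarrow> nat \<Rightarrow> nat \<Rightarrow> (conf \<Rightarrow> complex) \<Rightarrow> (conf \<Rightarrow> complex) \<Rightarrow> bool" where
  "tder N c k F F' \<longleftrightarrow> (\<exists>g. (\<forall>i<N. \<forall>j<N. mder N c i j F (g i j)) \<and>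
     (\<forall>y. F' y = (\<Sum>i<N. \<Sum>j<N. mpow N c k j i y * g i j y)))"

context
  fixes N c k :: nat
  assumes N: "N > 0" and c: "c \<in> {1..3}"
begin

lemma tder_const: "tder N c k (\<lambda>y. r) (\<lambda>y. 0)"
  unfolding tder_def using c
  by (intro exI[of _ "\<lambda>i j y. 0"] conjI allI impI mder_const) (auto simp: coords_iff)

lemma tder_add:
  assumes "tder N c k F F'" "tder N c k G G'"
  shows "tder N c k (\<lambda>y. F y + G y) (\<lambda>y. F' y + G' y)"
proof -
  from assms obtain f g where
    "\<And>i j. i < N \<Longrightarrow> j < N \<Longrightarrow> mder N c i j F (f i j)" "\<And>i j. i < N \<Longrightarrow> j < N \<Longrightarrow> mder N c i j G (g i j)"
    and *: "\<And>y. F' y = (\<Sum>i<N. \<Sum>j<N. mpow N c k j i y * f i j y)"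
    "\<And>y. G' y = (\<Sum>i<N. \<Sum>j<N. mpow N c k j i y * g i j y)"
    unfolding tder_def by blast
  thus ?thesis unfolding tder_def using c
    by (intro exI[of _ "\<lambda>i j y. f i j y + g i j y"] conjI allI impI mder_add)
      (auto simp: coords_iff * sum.distrib distrib_left)
qed

lemma tder_mult:
  assumes "tder N c k F F'" "tder N c k G G'"
  shows "tder N c k (\<lambda>y. F y * G y) (\<lambda>y. F' y * G y + F y * G' y)"
proof -
  from assms obtain f g where
    m: "\<And>i j. i < N \<Longrightarrow> j < N \<Longrightarrow> mder N c i j F (f i j)" "\<And>i j. i < N \<Longrightarrow> j < N \<Longrightarrow> mder N c i j G (g i j)"
    and *: "\<And>y. F' y = (\<Sum>i<N. \<Sum>j<N. mpow N c k j i y * f i j y)"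
    "\<And>y. G' y = (\<Sum>i<N. \<Sum>j<N. mpow N c k j i y * g i j y)"
    unfolding tder_def by blast
  have "F' y * G y + F y * G' y =
      (\<Sum>i<N. \<Sum>j<N. mpow N c k j i y * (f i j y * G y + F y * g i j y))" for y
    unfolding * by (simp add: sum_distrib_left sum_distrib_right sum.distrib[symmetric] algebra_simps)
  thus ?thesis unfolding tder_def using c m
    by (intro exI[of _ "\<lambda>i j y. f i j y * G y + F y * g i j y"] conjI allI impI mder_mult)
      (auto simp: coords_iff)
qed

lemma tder_sum:
  assumes "finite A" "\<And>a. a \<in> A \<Longrightarrow> tder N c k (f a) (f' a)"
  shows "tder N c k (\<lambda>y. \<Sum>a\<in>A. f a y) (\<lambda>y. \<Sum>a\<in>A. f' a y)"
  using assms
proof (induction rule: finite_induct)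
  case empty
  show ?case using tder_const[of 0] by simp
next
  case (insert a A)
  thus ?case using tder_add[of "f a" "f' a"] by simp
qed

lemma tder_poly:
  assumes "tder N c k F F'"
  shows "poly_fun N F" "poly_fun N F'"
proof -
  from assms obtain g where g: "\<And>i j. i < N \<Longrightarrow> j < N \<Longrightarrow> mder N c i j F (g i j)"
    and F': "F' = (\<lambda>y. \<Sum>i<N. \<Sum>j<N. mpow N c k j i y * g i j y)"
    unfolding tder_def by blast
  have cij: "(c, i, j) \<in> coords N" if "i < N" "j < N" for i j using that c by (simp add: coords_iff)
  show "poly_fun N F" using mder_poly(1)[OF cij g] N by blast
  show "poly_fun N F'" unfolding F' using c
    by (intro poly_fun_sum poly_fun_mult poly_fun_mpow mder_poly(2)[OF cij g]) auto
qed

text \<open>By cyclicity all \<open>a\<close> ways of cutting the word leave the same power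
  \<open>a - 1\<close>, which is then contracted with the power \<open>k\<close>. At
  \<open>a = 0\<close> the truncated exponent meets the coefficient zero.\<close>

lemma tder_tr_pow:
  assumes c': "c' \<in> {1..3}"
  shows "tder N c k (tr_pow N c' a) (\<lambda>y. if c' = c then of_nat a * tr_pow N c (k + a - 1) y else 0)"
proof -
  define g where "g i j y = (\<Sum>p<N. if c' = c then
      \<Sum>l<a. mpow N c l p j y * mpow N c (a - 1 - l) i p y else 0)" for i j y
  have m: "mder N c i j (tr_pow N c' a) (g i j)" if "i < N" "j < N" for i j
    unfolding tr_pow_eq[abs_def] g_def[abs_def] using that c c'
    by (intro mder_sum mder_mpow N) (auto simp: coords_iff)
  have gc: "g i j y = of_nat a * mpow N c (a - 1) i j y" if "i < N" "j < N" "c' = c" for i j y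
  proof -
    have "g i j y = (\<Sum>l<a. \<Sum>p<N. mpow N c (a - 1 - l) i p y * mpow N c l p j y)"
      unfolding g_def using that by (subst sum.swap) (simp add: mult.commute)
    also have "\<dots> = (\<Sum>l<a. mpow N c (a - 1) i j y)"
      using that by (intro sum.cong) (auto simp: mpow_add)
    finally show ?thesis by simp
  qed
  have "(if c' = c then of_nat a * tr_pow N c (k + a - 1) y else 0) =
      (\<Sum>i<N. \<Sum>j<N. mpow N c k j i y * g i j y)" for y
  proof (cases "c' = c \<and> a > 0")
    case True
    have "(\<Sum>i<N. \<Sum>j<N. mpow N c k j i y * g i j y) =
        of_nat a * (\<Sum>j<N. \<Sum>i<N. mpow N c k j i y * mpow N c (a - 1) i j y)"
      using True gc by (subst sum.swap) (simp add: sum_distrib_left mult_ac)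
    also have "\<dots> = of_nat a * tr_pow N c (k + (a - 1)) y"
      by (simp add: mpow_add tr_pow_eq)
    finally show ?thesis using True by simp
  next
    case False
    hence "g i j y = 0" if "i < N" "j < N" for i j using gc[OF that] by (cases "c' = c") (auto simp: g_def)
    thus ?thesis using False by simp
  qed
  thus ?thesis unfolding tder_def using m by blast
qed

text \<open>Schwinger-Dyson equation: one factor of the trace is integrated by parts, entry by
  entry. Where the derivative hits the remaining power \<open>k\<close>, the trace splits into two,
  which gives the sum over \<open>l\<close>; where it hits \<open>F\<close>, it gives
  \<open>F'\<close>.\<close>

lemma loop_equation:
  assumes "tder N c k F F'"
  shows "of_nat N * gint N (\<lambda>y. tr_pow N c (Suc k) y * F y) =
    (\<Sum>l<k. gint N (\<lambda>y. tr_pow N c l y * tr_pow N c (k - 1 - l) y * F y)) + gint N F'"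
proof -
  from assms obtain g where g: "\<And>i j. i < N \<Longrightarrow> j < N \<Longrightarrow> mder N c i j F (g i j)"
    and F': "F' = (\<lambda>y. \<Sum>i<N. \<Sum>j<N. mpow N c k j i y * g i j y)"
    unfolding tder_def by blast
  have cij: "(c, i, j) \<in> coords N" if "i < N" "j < N" for i j using that c by (simp add: coords_iff)
  note pF = tder_poly[OF assms]
  define D where "D i j y = (\<Sum>l<k. mpow N c l j j y * mpow N c (k - 1 - l) i i y) * F y +
      mpow N c k j i y * g i j y" for i j y
  have m: "mder N c i j (\<lambda>y. mpow N c k j i y * F y) (D i j)" if "i < N" "j < N" for i j
    using mder_mult[OF cij[OF that] mder_mpow[OF N cij[OF that] c that(2,1)] g[OF that], of k]
    unfolding D_def by simp
  have "tr_pow N c (Suc k) y * F y = (\<Sum>i<N. \<Sum>j<N. entry c i j y * (mpow N c k j i y * F y))" for y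
  proof -
    have "tr_pow N c (Suc k) y * F y = (\<Sum>j<N. \<Sum>i<N. entry c i j y * (mpow N c k j i y * F y))"
      unfolding tr_pow_eq by (simp add: mpow_Suc sum_distrib_right sum_distrib_left mult_ac)
    also have "\<dots> = (\<Sum>i<N. \<Sum>j<N. entry c i j y * (mpow N c k j i y * F y))"
      by (rule sum.swap)
    finally show ?thesis .
  qed
  hence "gint N (\<lambda>y. tr_pow N c (Suc k) y * F y) =
      (\<Sum>i<N. \<Sum>j<N. gint N (\<lambda>y. entry c i j y * (mpow N c k j i y * F y)))"
    using c by (simp only:) (intro gint_sum2[OF N] poly_fun_mult poly_fun_entry poly_fun_mpow pF cij; simp)
  also have "\<dots> = (\<Sum>i<N. \<Sum>j<N. gint N (D i j) / of_nat N)"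
    using stein_entry[OF cij N m] by simp
  also have "\<dots> = (\<Sum>i<N. \<Sum>j<N. gint N (D i j)) / of_nat N"
    by (simp add: sum_divide_distrib)
  also have "(\<Sum>i<N. \<Sum>j<N. gint N (D i j)) = gint N (\<lambda>y. \<Sum>i<N. \<Sum>j<N. D i j y)"
    by (intro gint_sum2[OF N, symmetric] mder_poly(2)[OF cij m]) auto
  also have "(\<lambda>y. \<Sum>i<N. \<Sum>j<N. D i j y) =
      (\<lambda>y. (\<Sum>l<k. tr_pow N c l y * tr_pow N c (k - 1 - l) y * F y) + F' y)"
  proof
    fix y
    have "(\<Sum>i<N. \<Sum>j<N. (\<Sum>l<k. mpow N c l j j y * mpow N c (k - 1 - l) i i y)) =
        (\<Sum>l<k. \<Sum>i<N. \<Sum>j<N. mpow N c l j j y * mpow N c (k - 1 - l) i i y)"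
      by (subst (2) sum.swap) (subst sum.swap, rule refl)
    also have "\<dots> = (\<Sum>l<k. tr_pow N c l y * tr_pow N c (k - 1 - l) y)"
      unfolding tr_pow_eq sum_product by (subst (2) sum.swap) (rule refl)
    finally show "(\<Sum>i<N. \<Sum>j<N. D i j y) =
        (\<Sum>l<k. tr_pow N c l y * tr_pow N c (k - 1 - l) y * F y) + F' y"
      unfolding D_def F' by (simp add: sum.distrib sum_distrib_right[symmetric])
  qed
  also have "gint N \<dots> = (\<Sum>l<k. gint N (\<lambda>y. tr_pow N c l y * tr_pow N c (k - 1 - l) y * F y)) + gint N F'"
    using c pF by (subst gint_add'[OF N]) 
      (auto intro!: poly_fun_sum poly_fun_mult poly_fun_tr_pow simp: gint_sum[OF N] poly_fun_mult poly_fun_tr_pow)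
  finally show ?thesis using N by simp
qed

end

section \<open>The trace of a power of the Kronecker sum\<close>

lemma sum_div_mod:
  fixes f :: "nat \<Rightarrow> nat \<Rightarrow> 'a::comm_monoid_add"
  shows "(\<Sum>i<n * m. f (i div m) (i mod m)) = (\<Sum>a<n. \<Sum>b<m. f a b)"
proof (cases "m = 0")
  case False
  have lt: "a * m + b < n * m" if "a < n" "b < m" for a b
  proof -
    have "a * m + b < Suc a * m" using that by simp
    also have "\<dots> \<le> n * m" using that by (intro mult_le_mono1) simp
    finally show ?thesis .
  qed
  have "(\<Sum>i<n * m. f (i div m) (i mod m)) = (\<Sum>(a, b)\<in>{..<n} \<times> {..<m}. f a b)"
    using False
    by (intro sum.reindex_bij_witness[of _ "\<lambda>(a, b). a * m + b" "\<lambda>i. (i div m, i mod m)"])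
      (auto simp: less_mult_imp_div_less intro: lt)
  thus ?thesis by (simp add: sum.cartesian_product)
qed simp

lemma sum_rotate:
  "(\<Sum>u\<in>A. \<Sum>v\<in>B. \<Sum>k\<in>C. f u v k) = (\<Sum>k\<in>C. \<Sum>u\<in>A. \<Sum>v\<in>B. f u v k)"
proof -
  have "(\<Sum>u\<in>A. \<Sum>v\<in>B. \<Sum>k\<in>C. f u v k) = (\<Sum>u\<in>A. \<Sum>k\<in>C. \<Sum>v\<in>B. f u v k)"
    by (intro sum.cong refl, rule sum.swap)
  also have "\<dots> = (\<Sum>k\<in>C. \<Sum>u\<in>A. \<Sum>v\<in>B. f u v k)" by (rule sum.swap)
  finally show ?thesis .
qed

lemma eq_iff_div_mod: "i = j \<longleftrightarrow> i div m = j div m \<and> i mod m = j mod (m::nat)"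
  by (metis div_mult_mod_eq)

lemma kron_index:
  "i < dim_row A * dim_row B \<Longrightarrow> j < dim_col A * dim_col B \<Longrightarrow> kron A B $$ (i, j) =
     A $$ (i div dim_row B, j div dim_col B) * B $$ (i mod dim_row B, j mod dim_col B)"
  by (simp add: kron_def)

lemma kron_dim [simp]:
  "dim_row (kron A B) = dim_row A * dim_row B" "dim_col (kron A B) = dim_col A * dim_col B"
  by (simp_all add: kron_def)

text \<open>Symbolic form of multiplying a binomial expansion by one more factor: raising the total
  degree means raising the index of \<open>x\<close> or that of \<open>y\<close>.\<close>

lemma pascal_sum:
  fixes x y :: "nat \<Rightarrow> 'a::comm_semiring_1"
  shows "(\<Sum>k\<le>p. of_nat (p choose k) * (x (Suc k) * y (p - k) + x k * y (Suc p - k))) =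
    (\<Sum>k\<le>Suc p. of_nat (Suc p choose k) * (x k * y (Suc p - k)))"
proof -
  define g where "g k = x k * y (Suc p - k)" for k
  have "(\<Sum>k\<le>p. of_nat (p choose k) * g k) = (\<Sum>k\<le>Suc p. of_nat (p choose k) * g k)"
    by (simp add: binomial_eq_0)
  also have "\<dots> = g 0 + (\<Sum>k\<le>p. of_nat (p choose Suc k) * g (Suc k))"
    by (subst sum.atMost_Suc_shift) simp
  finally have 1: "(\<Sum>k\<le>p. of_nat (p choose k) * g k) = \<dots>" .
  have "(\<Sum>k\<le>Suc p. of_nat (Suc p choose k) * g k) =
      g 0 + (\<Sum>k\<le>p. of_nat ((p choose k) + (p choose Suc k)) * g (Suc k))"
    by (subst sum.atMost_Suc_shift) (simp add: add.commute)
  also have "\<dots> = (\<Sum>k\<le>p. of_nat (p choose k) * g (Suc k)) + (\<Sum>k\<le>p. of_nat (p choose k) * g k)"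
    unfolding 1 by (simp add: of_nat_add distrib_right sum.distrib add_ac)
  also have "\<dots> = (\<Sum>k\<le>p. of_nat (p choose k) * (x (Suc k) * y (p - k) + x k * y (Suc p - k)))"
    by (simp add: g_def sum.distrib distrib_left)
  finally show ?thesis by (simp add: g_def)
qed

text \<open>The two summands of the Kronecker sum commute, so this is the binomial theorem. Arguing
  on entries, the induction multiplies by one factor, whose Kronecker deltas collapse one of the two
  index sums, and Pascal's rule recombines the terms.\<close>

lemma kron_sum_pow_index:
  fixes A B :: "complex mat"
  assumes A: "A \<in> carrier_mat n n" and B: "B \<in> carrier_mat m m"
    and ij: "i < n * m" "j < n * m"
  shows "((kron A (1\<^sub>m m) + kron (1\<^sub>m n) B) ^\<^sub>m p) $$ (i, j) =
    (\<Sum>k\<le>p. of_nat (p choose k) *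
      ((A ^\<^sub>m k) $$ (i div m, j div m) * (B ^\<^sub>m (p - k)) $$ (i mod m, j mod m)))"
  using ij(2)
proof (induction p arbitrary: j)
  case 0
  have "m > 0" using ij by (cases m) auto
  thus ?case using 0 ij A B eq_iff_div_mod[of i j m]
    by (auto simp: less_mult_imp_div_less mult.commute)
next
  case (Suc p)
  let ?S = "kron A (1\<^sub>m m) + kron (1\<^sub>m n) B"
  have dim: "dim_row A = n" "dim_col A = n" "dim_row B = m" "dim_col B = m" using A B by auto
  have m: "m > 0" using ij by (cases m) auto
  define a b a' b' where "a = i div m" and "b = i mod m" and "a' = j div m" and "b' = j mod m"
  have lt: "a < n" "a' < n" "b < m" "b' < m"
    using ij Suc.prems m by (simp_all add: a_def b_def a'_def b'_def less_mult_imp_div_less mult.commute)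
  have S: "?S $$ (q, j) = A $$ (q div m, a') * (if q mod m = b' then 1 else 0) +
      (if q div m = a' then 1 else 0) * B $$ (q mod m, b')" if "q < n * m" for q
    using that Suc.prems m
    by (simp add: dim kron_index a'_def b'_def less_mult_imp_div_less mult.commute)
  have "(?S ^\<^sub>m Suc p) $$ (i, j) = (\<Sum>q<n * m. (?S ^\<^sub>m p) $$ (i, q) * ?S $$ (q, j))"
    using ij Suc.prems by (simp add: scalar_prod_def dim atLeast0LessThan)
  also have "\<dots> = (\<Sum>q<n * m. (\<lambda>u v. (\<Sum>k\<le>p. of_nat (p choose k) * ((A ^\<^sub>m k) $$ (a, u) * (B ^\<^sub>m (p - k)) $$ (b, v))) *
      (A $$ (u, a') * (if v = b' then 1 else 0) + (if u = a' then 1 else 0) * B $$ (v, b'))) (q div m) (q mod m))"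
    by (intro sum.cong refl) (simp add: Suc.IH S a_def b_def)
  also have "\<dots> = (\<Sum>u<n. \<Sum>v<m. \<Sum>k\<le>p. of_nat (p choose k) * ((A ^\<^sub>m k) $$ (a, u) * (B ^\<^sub>m (p - k)) $$ (b, v)) *
      (A $$ (u, a') * (if v = b' then 1 else 0) + (if u = a' then 1 else 0) * B $$ (v, b')))"
    by (subst sum_div_mod) (simp add: sum_distrib_right)
  also have "\<dots> = (\<Sum>k\<le>p. \<Sum>u<n. \<Sum>v<m. of_nat (p choose k) * ((A ^\<^sub>m k) $$ (a, u) * (B ^\<^sub>m (p - k)) $$ (b, v)) *
      (A $$ (u, a') * (if v = b' then 1 else 0) + (if u = a' then 1 else 0) * B $$ (v, b')))"
    by (rule sum_rotate)
  also have "\<dots> = (\<Sum>k\<le>p. of_nat (p choose k) *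
      ((A ^\<^sub>m Suc k) $$ (a, a') * (B ^\<^sub>m (p - k)) $$ (b, b') + (A ^\<^sub>m k) $$ (a, a') * (B ^\<^sub>m (Suc p - k)) $$ (b, b')))"
  proof (intro sum.cong refl)
    fix k assume k: "k \<in> {..p}"
    have A': "(\<Sum>u<n. (A ^\<^sub>m k) $$ (a, u) * A $$ (u, a')) = (A ^\<^sub>m Suc k) $$ (a, a')"
      using lt by (simp add: scalar_prod_def dim atLeast0LessThan)
    have B': "(\<Sum>v<m. (B ^\<^sub>m (p - k)) $$ (b, v) * B $$ (v, b')) = (B ^\<^sub>m (Suc p - k)) $$ (b, b')"
      using lt k by (simp add: scalar_prod_def dim atLeast0LessThan Suc_diff_le)
    have "(\<Sum>u<n. \<Sum>v<m. of_nat (p choose k) * ((A ^\<^sub>m k) $$ (a, u) * (B ^\<^sub>m (p - k)) $$ (b, v)) *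
        (A $$ (u, a') * (if v = b' then 1 else 0) + (if u = a' then 1 else 0) * B $$ (v, b'))) =
      of_nat (p choose k) * ((\<Sum>u<n. \<Sum>v<m. ((A ^\<^sub>m k) $$ (a, u) * A $$ (u, a')) * (if v = b' then (B ^\<^sub>m (p - k)) $$ (b, v) else 0)) +
       (\<Sum>u<n. \<Sum>v<m. (if u = a' then (A ^\<^sub>m k) $$ (a, u) else 0) * ((B ^\<^sub>m (p - k)) $$ (b, v) * B $$ (v, b'))))"
      unfolding sum.distrib[symmetric] sum_distrib_left
      by (intro sum.cong refl) (simp add: algebra_simps)
    also have "\<dots> = of_nat (p choose k) * ((\<Sum>u<n. (A ^\<^sub>m k) $$ (a, u) * A $$ (u, a')) * (B ^\<^sub>m (p - k)) $$ (b, b') +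
       (A ^\<^sub>m k) $$ (a, a') * (\<Sum>v<m. (B ^\<^sub>m (p - k)) $$ (b, v) * B $$ (v, b')))"
      unfolding sum_product[symmetric] using lt by simp
    finally show "(\<Sum>u<n. \<Sum>v<m. of_nat (p choose k) * ((A ^\<^sub>m k) $$ (a, u) * (B ^\<^sub>m (p - k)) $$ (b, v)) *
        (A $$ (u, a') * (if v = b' then 1 else 0) + (if u = a' then 1 else 0) * B $$ (v, b'))) =
      of_nat (p choose k) * ((A ^\<^sub>m Suc k) $$ (a, a') * (B ^\<^sub>m (p - k)) $$ (b, b') +
        (A ^\<^sub>m k) $$ (a, a') * (B ^\<^sub>m (Suc p - k)) $$ (b, b'))"
      unfolding A' B' .
  qed
  also have "\<dots> = (\<Sum>k\<le>Suc p. of_nat (Suc p choose k) *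
      ((A ^\<^sub>m k) $$ (a, a') * (B ^\<^sub>m (Suc p - k)) $$ (b, b')))"
    by (rule pascal_sum)
  finally show ?case by (simp only: a_def b_def a'_def b'_def)
qed

lemma mtrace_kron_sum_pow:
  fixes A B :: "complex mat"
  assumes A: "A \<in> carrier_mat n n" and B: "B \<in> carrier_mat m m"
  shows "mtrace ((kron A (1\<^sub>m m) + kron (1\<^sub>m n) B) ^\<^sub>m p) =
    (\<Sum>k\<le>p. of_nat (p choose k) * (mtrace (A ^\<^sub>m k) * mtrace (B ^\<^sub>m (p - k))))"
proof -
  have dim: "dim_row A = n" "dim_col A = n" "dim_row B = m" "dim_col B = m" using A B by auto
  have "mtrace ((kron A (1\<^sub>m m) + kron (1\<^sub>m n) B) ^\<^sub>m p) =
    (\<Sum>i<n * m. (\<lambda>u v. \<Sum>k\<le>p. of_nat (p choose k) * ((A ^\<^sub>m k) $$ (u, u) * (B ^\<^sub>m (p - k)) $$ (v, v))) (i div m) (i mod m))"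
    unfolding mtrace_def
    by (intro sum.cong) (auto simp: dim kron_sum_pow_index[OF A B])
  also have "\<dots> = (\<Sum>u<n. \<Sum>v<m. \<Sum>k\<le>p. of_nat (p choose k) * ((A ^\<^sub>m k) $$ (u, u) * (B ^\<^sub>m (p - k)) $$ (v, v)))"
    by (rule sum_div_mod)
  also have "\<dots> = (\<Sum>k\<le>p. \<Sum>u<n. \<Sum>v<m. of_nat (p choose k) * ((A ^\<^sub>m k) $$ (u, u) * (B ^\<^sub>m (p - k)) $$ (v, v)))"
    by (rule sum_rotate)
  also have "\<dots> = (\<Sum>k\<le>p. of_nat (p choose k) * (mtrace (A ^\<^sub>m k) * mtrace (B ^\<^sub>m (p - k))))"
    unfolding mtrace_def sum_product by (simp add: dim sum_distrib_left)
  finally show ?thesis .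
qed

lemma kron_one: "kron (1\<^sub>m n) (1\<^sub>m m) = 1\<^sub>m (n * m)"
proof (rule eq_matI)
  fix i j assume "i < dim_row (1\<^sub>m (n * m) :: complex mat)" "j < dim_col (1\<^sub>m (n * m) :: complex mat)"
  moreover from this have "m > 0" by (cases m) auto
  moreover note eq_iff_div_mod[of i j m]
  ultimately show "kron (1\<^sub>m n) (1\<^sub>m m) $$ (i, j) = (1\<^sub>m (n * m) :: complex mat) $$ (i, j)"
    by (auto simp: kron_index less_mult_imp_div_less mult.commute)
qed auto

lemma kron_add_left:
  assumes "A \<in> carrier_mat n n" "A' \<in> carrier_mat n n" "B \<in> carrier_mat m m"
  shows "kron A B + kron A' B = kron (A + A') B"
  using assms by (intro eq_matI) (auto simp: kron_index less_mult_imp_div_less mult.commute algebra_simps)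

text \<open>Exponential generating functions turn binomial convolutions into products, so the
  symmetry of the trinomial sum in its three arguments becomes commutativity of
  multiplication.\<close>

definition egf :: "(nat \<Rightarrow> complex) \<Rightarrow> complex fps" where
  "egf f = Abs_fps (\<lambda>n. f n / fact n)"

text \<open>\<open>multi p f g h\<close> is the sum of \<open>p! / (a! b! d!) f a g b h d\<close> over \<open>a + b + d = p\<close>.\<close>

definition multi :: "nat \<Rightarrow> (nat \<Rightarrow> complex) \<Rightarrow> (nat \<Rightarrow> complex) \<Rightarrow> (nat \<Rightarrow> complex) \<Rightarrow> complex" where
  "multi p f g h = fact p * fps_nth (egf f * egf g * egf h) p"

lemma egf_mult: "egf f * egf g = egf (\<lambda>p. \<Sum>k\<le>p. of_nat (p choose k) * (f k * g (p - k)))"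
proof (rule fps_ext)
  fix p
  have "f k / fact k * (g (p - k) / fact (p - k)) = of_nat (p choose k) * (f k * g (p - k)) / fact p"
    if "k \<le> p" for k
    using that by (simp add: binomial_fact)
  thus "fps_nth (egf f * egf g) p = fps_nth (egf (\<lambda>p. \<Sum>k\<le>p. of_nat (p choose k) * (f k * g (p - k)))) p"
    by (simp add: egf_def fps_mult_nth sum_divide_distrib atLeast0AtMost)
qed

lemma multi_sum:
  "multi p f g h = (\<Sum>k\<le>p. \<Sum>l\<le>k. of_nat ((p choose k) * (k choose l)) * (f l * g (k - l) * h (p - k)))"
proof -
  have "multi p f g h = (\<Sum>k\<le>p. of_nat (p choose k) * ((\<Sum>l\<le>k. of_nat (k choose l) * (f l * g (k - l))) * h (p - k)))"
    unfolding multi_def egf_mult by (simp add: egf_def)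
  thus ?thesis by (simp add: sum_distrib_left sum_distrib_right mult_ac)
qed

lemma multi_commute: "multi p f g h = multi p g f h" "multi p f g h = multi p f h g"
  by (simp_all add: multi_def mult_ac)

text \<open>Passing from \<open>f a\<close> to \<open>a * f (a - 1)\<close> multiplies the
  exponential generating function by its variable, which lowers the index of the extracted
  coefficient by one.\<close>

lemma multi_derivative:
  "multi p (\<lambda>a. of_nat a * f (a - 1)) g h = of_nat p * multi (p - 1) f g h"
proof -
  have "egf (\<lambda>a. of_nat a * f (a - 1)) = fps_X * egf f"
  proof (rule fps_ext)
    fix n show "fps_nth (egf (\<lambda>a. of_nat a * f (a - 1))) n = fps_nth (fps_X * egf f) n"
      by (cases n) (simp_all add: egf_def field_simps del: of_nat_Suc)
  qed
  hence "multi p (\<lambda>a. of_nat a * f (a - 1)) g h = fact p * fps_nth (fps_X * (egf f * egf g * egf h)) p"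
    by (simp add: multi_def mult.assoc)
  also have "\<dots> = of_nat p * multi (p - 1) f g h"
    by (cases p) (simp_all add: multi_def)
  finally show ?thesis .
qed

text \<open>The first two colours form a Kronecker sum on the tensor square, so the formula for two
  summands applies twice.\<close>

lemma mtrace_color_sum:
  assumes "M 1 \<in> carrier_mat N N" "M 2 \<in> carrier_mat N N" "M 3 \<in> carrier_mat N N"
  shows "mtrace (color_sum N M ^\<^sub>m p) =
    multi p (\<lambda>a. mtrace (M 1 ^\<^sub>m a)) (\<lambda>a. mtrace (M 2 ^\<^sub>m a)) (\<lambda>a. mtrace (M 3 ^\<^sub>m a))"
proof -
  define S where "S = kron (M 1) (1\<^sub>m N) + kron (1\<^sub>m N) (M 2)"
  have kc: "kron A B \<in> carrier_mat (N * N) (N * N)"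
    if "A \<in> carrier_mat N N" "B \<in> carrier_mat N N" for A B
    using that by (intro carrier_matI) simp_all
  have S: "S \<in> carrier_mat (N * N) (N * N)"
    unfolding S_def by (intro add_carrier_mat kc assms one_carrier_mat)
  have "color_sum N M = kron S (1\<^sub>m N) + kron (1\<^sub>m (N * N)) (M 3)"
    unfolding color_sum_def S_def kron_one
    by (simp only: kron_add_left[OF kc[OF assms(1) one_carrier_mat] kc[OF one_carrier_mat assms(2)]
        one_carrier_mat])
  hence "mtrace (color_sum N M ^\<^sub>m p) =
      (\<Sum>k\<le>p. of_nat (p choose k) * (mtrace (S ^\<^sub>m k) * mtrace (M 3 ^\<^sub>m (p - k))))"
    by (simp only: mtrace_kron_sum_pow[OF S assms(3)])
  also have "\<dots> = multi p (\<lambda>a. mtrace (M 1 ^\<^sub>m a)) (\<lambda>a. mtrace (M 2 ^\<^sub>m a)) (\<lambda>a. mtrace (M 3 ^\<^sub>m a))"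
    unfolding S_def mtrace_kron_sum_pow[OF assms(1,2)] multi_def egf_mult by (simp add: egf_def)
  finally show ?thesis .
qed

section \<open>Loop equations of the interacting model\<close>

text \<open>Integrating each coefficient in \<alpha> separately reduces the interacting model to
  Gaussian integrals of polynomials; the exponential of the interaction never has to be integrated
  as a function.\<close>

definition gfps :: "nat \<Rightarrow> (conf \<Rightarrow> complex fps) \<Rightarrow> complex fps" where
  "gfps N F = Abs_fps (\<lambda>m. gint N (\<lambda>y. fps_nth (F y) m) / gint N (\<lambda>_. 1))"

definition pfps :: "nat \<Rightarrow> (conf \<Rightarrow> complex fps) \<Rightarrow> bool" where
  "pfps N F \<longleftrightarrow> (\<forall>m. poly_fun N (\<lambda>y. fps_nth (F y) m))"

definition fder :: "nat \<Rightarrow> nat \<Rightarrow> nat \<Rightarrow> (conf \<Rightarrow> complex fps) \<Rightarrow> (conf \<Rightarrow> complex fps) \<Rightarrow> bool" where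
  "fder N c k F F' \<longleftrightarrow> (\<forall>m. tder N c k (\<lambda>y. fps_nth (F y) m) (\<lambda>y. fps_nth (F' y) m))"

lemma pfps_const: "pfps N (\<lambda>y. a)"
  by (simp add: pfps_def poly_fun_const)

lemma pfps_add: "pfps N F \<Longrightarrow> pfps N G \<Longrightarrow> pfps N (\<lambda>y. F y + G y)"
  by (simp add: pfps_def poly_fun_add)

lemma pfps_mult: "pfps N F \<Longrightarrow> pfps N G \<Longrightarrow> pfps N (\<lambda>y. F y * G y)"
  by (simp add: pfps_def fps_mult_nth poly_fun_sum poly_fun_mult)

lemma pfps_sum:
  assumes "finite A" "\<And>a. a \<in> A \<Longrightarrow> pfps N (F a)"
  shows "pfps N (\<lambda>y. \<Sum>a\<in>A. F a y)"
  using assms by (simp add: pfps_def fps_sum_nth poly_fun_sum)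

lemma pfps_fps_const: "poly_fun N f \<Longrightarrow> pfps N (\<lambda>y. fps_const (f y))"
  unfolding pfps_def
proof
  fix m assume "poly_fun N f"
  thus "poly_fun N (\<lambda>y. fps_nth (fps_const (f y)) m)"
    using poly_fun_const[of N 0] by (cases "m = 0") auto
qed

lemma gint_1: "N > 0 \<Longrightarrow> gint N (\<lambda>_. 1) \<noteq> 0"
  using gint_mono[of N "\<lambda>_. 0"] gmom_0[OF prec_pos[of N]] by (simp add: cmono_def[abs_def])

context
  fixes N :: nat
  assumes N: "N > 0"
begin

lemma gfps_add: "pfps N F \<Longrightarrow> pfps N G \<Longrightarrow> gfps N (\<lambda>y. F y + G y) = gfps N F + gfps N G"
  by (rule fps_ext) (simp add: gfps_def pfps_def gint_add'[OF N] add_divide_distrib)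

lemma gfps_sum:
  assumes "finite A" "\<And>a. a \<in> A \<Longrightarrow> pfps N (F a)"
  shows "gfps N (\<lambda>y. \<Sum>a\<in>A. F a y) = (\<Sum>a\<in>A. gfps N (F a))"
  using assms
  by (intro fps_ext) (simp add: gfps_def pfps_def fps_sum_nth gint_sum[OF N] sum_divide_distrib)

lemma gfps_cmult:
  assumes "pfps N F"
  shows "gfps N (\<lambda>y. a * F y) = a * gfps N F"
proof (rule fps_ext)
  fix m
  have "gint N (\<lambda>y. fps_nth (a * F y) m) = (\<Sum>i=0..m. gint N (\<lambda>y. fps_nth a i * fps_nth (F y) (m - i)))"
    using assms unfolding fps_mult_nth pfps_def
    by (intro gint_sum[OF N] poly_fun_mult poly_fun_const) auto
  also have "\<dots> = (\<Sum>i=0..m. fps_nth a i * gint N (\<lambda>y. fps_nth (F y) (m - i)))"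
    by (intro sum.cong refl gint_scale)
  finally show "fps_nth (gfps N (\<lambda>y. a * F y)) m = fps_nth (a * gfps N F) m"
    by (simp add: gfps_def fps_mult_nth sum_divide_distrib)
qed

end

context
  fixes N c k :: nat
  assumes N: "N > 0" and c: "c \<in> {1..3}"
begin

lemma fder_const: "fder N c k (\<lambda>y. a) (\<lambda>y. 0)"
  by (simp add: fder_def tder_const[OF N c])

lemma fder_add: "fder N c k F F' \<Longrightarrow> fder N c k G G' \<Longrightarrow> fder N c k (\<lambda>y. F y + G y) (\<lambda>y. F' y + G' y)"
  by (simp add: fder_def tder_add[OF N c])

lemma fder_mult:
  assumes "fder N c k F F'" "fder N c k G G'"
  shows "fder N c k (\<lambda>y. F y * G y) (\<lambda>y. F' y * G y + F y * G' y)"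
  using assms unfolding fder_def fps_mult_nth fps_add_nth sum.distrib[symmetric]
  by (intro allI tder_sum[OF N c] tder_mult[OF N c]) auto

lemma fder_cmult: "fder N c k F F' \<Longrightarrow> fder N c k (\<lambda>y. a * F y) (\<lambda>y. a * F' y)"
  using fder_mult[OF fder_const[of a]] by simp

lemma fder_power:
  assumes "fder N c k F F'"
  shows "fder N c k (\<lambda>y. F y ^ n) (\<lambda>y. of_nat n * F y ^ (n - 1) * F' y)"
proof (induction n)
  case 0
  show ?case using fder_const[of 1] by simp
next
  case (Suc n)
  have "F' y * F y ^ n + F y * (of_nat n * F y ^ (n - 1) * F' y) =
      of_nat (Suc n) * F y ^ (Suc n - 1) * F' y" for y
    by (cases n) (simp_all add: algebra_simps)
  thus ?case using fder_mult[OF assms Suc] by simp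
qed

lemma fder_fps_const:
  assumes "tder N c k f f'"
  shows "fder N c k (\<lambda>y. fps_const (f y)) (\<lambda>y. fps_const (f' y))"
  unfolding fder_def
proof
  fix m show "tder N c k (\<lambda>y. fps_nth (fps_const (f y)) m) (\<lambda>y. fps_nth (fps_const (f' y)) m)"
    using assms tder_const[OF N c, of k 0] by (cases "m = 0") auto
qed

lemma fder_pfps:
  assumes "fder N c k F F'" shows "pfps N F" "pfps N F'"
  using assms tder_poly[OF N c] unfolding fder_def pfps_def by blast+

lemma gfps_loop:
  assumes "fder N c k F F'"
  shows "of_nat N * gfps N (\<lambda>y. fps_const (tr_pow N c (Suc k) y) * F y) =
    (\<Sum>l<k. gfps N (\<lambda>y. fps_const (tr_pow N c l y) * fps_const (tr_pow N c (k - 1 - l) y) * F y)) + gfps N F'"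
proof (rule fps_ext)
  fix m
  have "of_nat N * gint N (\<lambda>y. tr_pow N c (Suc k) y * fps_nth (F y) m) =
    (\<Sum>l<k. gint N (\<lambda>y. tr_pow N c l y * tr_pow N c (k - 1 - l) y * fps_nth (F y) m))
      + gint N (\<lambda>y. fps_nth (F' y) m)"
    using assms unfolding fder_def by (intro loop_equation[OF N c]) auto
  hence "of_nat N * gint N (\<lambda>y. tr_pow N c (Suc k) y * fps_nth (F y) m) / gint N (\<lambda>_. 1) =
    (\<Sum>l<k. gint N (\<lambda>y. tr_pow N c l y * tr_pow N c (k - 1 - l) y * fps_nth (F y) m) / gint N (\<lambda>_. 1))
      + gint N (\<lambda>y. fps_nth (F' y) m) / gint N (\<lambda>_. 1)"
    by (simp add: sum_divide_distrib add_divide_distrib)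
  thus "fps_nth (of_nat N * gfps N (\<lambda>y. fps_const (tr_pow N c (Suc k) y) * F y)) m =
    fps_nth ((\<Sum>l<k. gfps N (\<lambda>y. fps_const (tr_pow N c l y) * fps_const (tr_pow N c (k - 1 - l) y) * F y)) + gfps N F') m"
    by (simp add: gfps_def fps_sum_nth mult.assoc flip: fps_of_nat fps_const_mult)
qed

end

text \<open>Which of the two remaining colours is called first does not matter, since
  \<open>multi\<close> is symmetric.\<close>

definition other1 :: "nat \<Rightarrow> nat" where "other1 c = (if c = 1 then 2 else 1)"
definition other2 :: "nat \<Rightarrow> nat" where "other2 c = (if c = 3 then 2 else 3)"

lemma others: "c \<in> {1..3} \<Longrightarrow> other1 c \<in> {1..3} \<and> other2 c \<in> {1..3} \<and> other1 c \<noteq> c \<and> other2 c \<noteq> c"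
  by (auto simp: other1_def other2_def)

definition vpot :: "nat \<Rightarrow> conf \<Rightarrow> complex fps" where
  "vpot N y = potential N (herm N y)"

definition boltzmann :: "nat \<Rightarrow> conf \<Rightarrow> complex fps" where
  "boltzmann N y = fps_compose (fps_exp 1) (vpot N y)"

text \<open>Derivative of the potential in the direction that sends \<open>M c\<close> to its power
  \<open>k\<close>. Differentiating a trace of a \<open>p\<close>-th power gives a factor
  \<open>p\<close> that cancels the 1 / p of the vertex and leaves \<open>p - 1\<close> free
  factors, with one factor of colour \<open>c\<close> replaced by its power
  \<open>k\<close>.\<close>

definition dpot :: "nat \<Rightarrow> nat \<Rightarrow> nat \<Rightarrow> conf \<Rightarrow> complex fps" where
  "dpot N c k y = Abs_fps (\<lambda>p. if p \<ge> 2 then of_real (real N powr (- (real p / 2))) *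
     multi (p - 1) (\<lambda>a. tr_pow N c (k + a) y) (\<lambda>a. tr_pow N (other1 c) a y) (\<lambda>a. tr_pow N (other2 c) a y)
     else 0)"

lemma vpot_nth: "fps_nth (vpot N y) p = (if p \<ge> 2 then of_real (real N powr (- (real p / 2)) / real p) *
    multi p (\<lambda>a. tr_pow N 1 a y) (\<lambda>a. tr_pow N 2 a y) (\<lambda>a. tr_pow N 3 a y) else 0)"
  using mtrace_color_sum[of "herm N y" N p] by (simp add: vpot_def potential_def tr_pow_def)

lemma tder_multi:
  assumes N: "N > 0" and c: "c \<in> {1..3}"
  shows "tder N c k (\<lambda>y. multi p (\<lambda>a. tr_pow N 1 a y) (\<lambda>a. tr_pow N 2 a y) (\<lambda>a. tr_pow N 3 a y))
    (\<lambda>y. of_nat p * multi (p - 1) (\<lambda>a. tr_pow N c (k + a) y) (\<lambda>a. tr_pow N (other1 c) a y) (\<lambda>a. tr_pow N (other2 c) a y))"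
proof -
  let ?c1 = "other1 c" and ?c2 = "other2 c"
  \<comment> \<open>Colour \<open>c\<close> is brought to the first argument, the only one that
    \<open>multi_derivative\<close> treats.\<close>
  have perm: "multi p (\<lambda>a. tr_pow N 1 a y) (\<lambda>a. tr_pow N 2 a y) (\<lambda>a. tr_pow N 3 a y) =
      multi p (\<lambda>a. tr_pow N c a y) (\<lambda>a. tr_pow N ?c1 a y) (\<lambda>a. tr_pow N ?c2 a y)" for y
  proof -
    let ?t = "\<lambda>c a. tr_pow N c a y"
    have "multi p (?t 1) (?t 2) (?t 3) = multi p (?t 2) (?t 1) (?t 3)"
      "multi p (?t 1) (?t 2) (?t 3) = multi p (?t 1) (?t 3) (?t 2)"
      "multi p (?t 1) (?t 3) (?t 2) = multi p (?t 3) (?t 1) (?t 2)"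
      by (rule multi_commute)+
    moreover have "c = 1 \<or> c = 2 \<or> c = 3" using c by auto
    ultimately show ?thesis by (elim disjE) (simp_all add: other1_def other2_def)
  qed
  have t: "tder N c k (tr_pow N c' a) (\<lambda>y. 0)" if "c' \<in> {1..3}" "c' \<noteq> c" for c' a
    using tder_tr_pow[OF N c that(1), of k a] that(2) by simp
  \<comment> \<open>Natural subtraction makes \<open>k + a - 1\<close> and
    \<open>k + (a - 1)\<close> differ at most for \<open>a = 0\<close>, where the coefficient is
    zero; the second form is the one that \<open>multi_derivative\<close> needs.\<close>
  have t0: "tder N c k (tr_pow N c a) (\<lambda>y. of_nat a * tr_pow N c (k + (a - 1)) y)" for a
  proof -
    have "(\<lambda>y. of_nat a * tr_pow N c (k + a - 1) y) = (\<lambda>y. of_nat a * tr_pow N c (k + (a - 1)) y)"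
      by (cases a) auto
    thus ?thesis using tder_tr_pow[OF N c c, of k a] by simp
  qed
  have "tder N c k (\<lambda>y. r * (tr_pow N c l y * tr_pow N ?c1 j y * tr_pow N ?c2 q y))
      (\<lambda>y. r * (of_nat l * tr_pow N c (k + (l - 1)) y * tr_pow N ?c1 j y * tr_pow N ?c2 q y))" for r l j q
    using tder_mult[OF N c tder_const[OF N c, of k r] tder_mult[OF N c tder_mult[OF N c t0[of l] t[of ?c1 j]] t[of ?c2 q]]]
      others[OF c] by simp
  hence "tder N c k (\<lambda>y. multi p (\<lambda>a. tr_pow N c a y) (\<lambda>a. tr_pow N ?c1 a y) (\<lambda>a. tr_pow N ?c2 a y))
      (\<lambda>y. multi p (\<lambda>a. of_nat a * tr_pow N c (k + (a - 1)) y) (\<lambda>a. tr_pow N ?c1 a y) (\<lambda>a. tr_pow N ?c2 a y))"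
    unfolding multi_sum by (intro tder_sum[OF N c] finite_atMost) auto
  moreover have "multi p (\<lambda>a. of_nat a * tr_pow N c (k + (a - 1)) y) g h =
      of_nat p * multi (p - 1) (\<lambda>a. tr_pow N c (k + a) y) g h" for y g h
    by (rule multi_derivative)
  ultimately show ?thesis unfolding perm by simp
qed

lemma fder_vpot:
  assumes N: "N > 0" and c: "c \<in> {1..3}"
  shows "fder N c k (vpot N) (dpot N c k)"
  unfolding fder_def
proof
  fix p
  show "tder N c k (\<lambda>y. fps_nth (vpot N y) p) (\<lambda>y. fps_nth (dpot N c k y) p)"
  proof (cases "p \<ge> 2")
    case True
    have p: "complex_of_real (real N powr (- (real p / 2)) / real p) * (of_nat p * z) =
        of_real (real N powr (- (real p / 2))) * z" for z
      using True by simp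
    thus ?thesis using tder_mult[OF N c tder_const[OF N c] tder_multi[OF N c], of k
        "of_real (real N powr (- (real p / 2)) / real p)" p]
      by (simp only: p vpot_nth dpot_def True if_True fps_nth_Abs_fps mult_zero_left add_0_left)
  next
    case False
    thus ?thesis using tder_const[OF N c, of k 0] by (simp add: vpot_nth dpot_def)
  qed
qed

text \<open>Chain rule for the exponential series, read off at one coefficient. As \<open>V\<close>
  has no constant term, powers beyond the \<open>m\<close>-th do not reach order \<open>m\<close>,
  so finite sums suffice and only finitely many polynomials are ever differentiated.\<close>

lemma exp_compose_derivative_nth:
  fixes V D :: "complex fps"
  assumes "fps_nth V 0 = 0" "fps_nth D 0 = 0"
  shows "(\<Sum>i=0..m. 1 / fact i * fps_nth (of_nat i * V ^ (i - 1) * D) m) =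
    fps_nth (fps_compose (fps_exp 1) V * D) m"
proof -
  have V0: "fps_nth (V ^ i) j = 0" if "j < i" for i j
    using that assms(1) by (simp add: startsby_zero_power_prefix)
  have e: "fps_nth (fps_compose (fps_exp 1) V) j = (\<Sum>i=0..m. 1 / fact i * fps_nth (V ^ i) j)"
    if "j \<le> m" for j
    unfolding fps_compose_nth using that V0 by (intro sum.mono_neutral_cong_left) auto
  have "fps_nth (fps_compose (fps_exp 1) V * D) m =
      (\<Sum>j=0..m. \<Sum>i=0..m. 1 / fact i * fps_nth (V ^ i) j * fps_nth D (m - j))"
    by (simp add: fps_mult_nth e sum_distrib_right)
  also have "\<dots> = (\<Sum>i=0..m. 1 / fact i * fps_nth (V ^ i * D) m)"
    by (subst sum.swap) (simp add: fps_mult_nth sum_distrib_left mult.assoc)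
  finally have 1: "fps_nth (fps_compose (fps_exp 1) V * D) m = \<dots>" .
  \<comment> \<open>Lowering the exponent by one leaves a sum over \<open>i < m\<close>. The missing
    last term starts at order \<open>m + 1\<close>, because \<open>D\<close> has no constant term
    either.\<close>
  have 2: "fps_nth (V ^ m * D) m = 0"
    unfolding fps_mult_nth
  proof (intro sum.neutral ballI)
    fix j assume "j \<in> {0..m}"
    thus "fps_nth (V ^ m) j * fps_nth D (m - j) = 0" using V0[of j m] assms(2) by (cases "j = m") auto
  qed
  have of_nat_nth: "fps_nth (of_nat n * A) m = of_nat n * fps_nth A m" for n and A :: "complex fps"
    by (metis fps_of_nat fps_mult_left_const_nth)
  have "1 / fact i * fps_nth (of_nat i * V ^ (i - 1) * D) m =
      (if i = 0 then 0 else 1 / fact (i - 1) * fps_nth (V ^ (i - 1) * D) m)" for i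
    by (cases i) (simp_all add: mult.assoc of_nat_nth del: of_nat_Suc)
  hence "(\<Sum>i=0..m. 1 / fact i * fps_nth (of_nat i * V ^ (i - 1) * D) m) =
      (\<Sum>i=0..m. if i = 0 then 0 else 1 / fact (i - 1) * fps_nth (V ^ (i - 1) * D) m)"
    by (intro sum.cong refl)
  also have "\<dots> = (\<Sum>i<m. 1 / fact i * fps_nth (V ^ i * D) m)"
  proof (cases m)
    case (Suc m')
    show ?thesis unfolding Suc sum.atLeast0_atMost_Suc_shift by (simp add: lessThan_Suc_atMost atLeast0AtMost)
  qed auto
  also have "\<dots> = (\<Sum>i=0..m. 1 / fact i * fps_nth (V ^ i * D) m)"
    using 2 by (simp add: atLeast0AtMost lessThan_Suc_atMost[symmetric])
  finally show ?thesis using 1 by simp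
qed

lemma fder_boltzmann:
  assumes N: "N > 0" and c: "c \<in> {1..3}"
  shows "fder N c k (boltzmann N) (\<lambda>y. boltzmann N y * dpot N c k y)"
  unfolding fder_def
proof
  fix m
  have z: "fps_nth (vpot N y) 0 = 0" "fps_nth (dpot N c k y) 0 = 0" for y
    by (simp_all add: vpot_nth dpot_def)
  have "tder N c k (\<lambda>y. 1 / fact i * fps_nth (vpot N y ^ i) m)
      (\<lambda>y. 1 / fact i * fps_nth (of_nat i * vpot N y ^ (i - 1) * dpot N c k y) m)" for i
    using tder_mult[OF N c tder_const[OF N c, of k "1 / fact i"]
        fder_power[OF N c fder_vpot[OF N c, of k], of i, unfolded fder_def, rule_format, of m]] by simp
  hence "tder N c k (\<lambda>y. \<Sum>i=0..m. 1 / fact i * fps_nth (vpot N y ^ i) m)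
      (\<lambda>y. \<Sum>i=0..m. 1 / fact i * fps_nth (of_nat i * vpot N y ^ (i - 1) * dpot N c k y) m)"
    by (intro tder_sum[OF N c]) auto
  thus "tder N c k (\<lambda>y. fps_nth (boltzmann N y) m) (\<lambda>y. fps_nth (boltzmann N y * dpot N c k y) m)"
    unfolding exp_compose_derivative_nth[OF z] by (simp add: boltzmann_def fps_compose_nth)
qed

section \<open>Normalised expectations of the interacting model\<close>

lemma boltzmann_0: "fps_nth (boltzmann N y) 0 = 1"
  by (simp add: boltzmann_def)

definition ev :: "nat \<Rightarrow> (conf \<Rightarrow> complex fps) \<Rightarrow> complex fps" where
  "ev N F = gfps N (\<lambda>y. F y * boltzmann N y) * inverse (gfps N (boltzmann N))"

lemma gfps_boltzmann_0: "N > 0 \<Longrightarrow> fps_nth (gfps N (boltzmann N)) 0 = 1"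
  using gint_1 by (simp add: gfps_def boltzmann_0)

lemma expect_eq_ev:
  assumes "N > 0"
  shows "expect N f = ev N (\<lambda>y. fps_const (f (herm N y)))"
proof -
  have "gauss_expect_fps N F = gfps N (\<lambda>y. F (herm N y))" for F
    by (simp add: gauss_expect_fps_def gfps_def gauss_expect_def gauss_integral_eq)
  thus ?thesis using gfps_boltzmann_0[OF assms]
    by (simp add: expect_def ev_def boltzmann_def[abs_def] vpot_def[abs_def] fps_divide_unit)
qed

lemma moment_eq_ev: "N > 0 \<Longrightarrow> moment N k = ev N (\<lambda>y. fps_const (tr_pow N 1 k y))"
  by (simp add: moment_def expect_eq_ev tr_pow_def)

context
  fixes N :: nat
  assumes N: "N > 0"
begin

lemma pfps_boltzmann: "pfps N (boltzmann N)"
  using fder_pfps(1)[OF N _ fder_boltzmann[OF N], of 1] by simp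

lemma pfps_dpot: "c \<in> {1..3} \<Longrightarrow> pfps N (dpot N c k)"
  using fder_pfps(2)[OF N _ fder_vpot[OF N]] .

lemma ev_add: "pfps N F \<Longrightarrow> pfps N G \<Longrightarrow> ev N (\<lambda>y. F y + G y) = ev N F + ev N G"
  by (simp add: ev_def distrib_right gfps_add[OF N] pfps_mult pfps_boltzmann)

lemma ev_sum:
  assumes "finite A" "\<And>a. a \<in> A \<Longrightarrow> pfps N (F a)"
  shows "ev N (\<lambda>y. \<Sum>a\<in>A. F a y) = (\<Sum>a\<in>A. ev N (F a))"
  using assms by (simp add: ev_def sum_distrib_right gfps_sum[OF N] pfps_mult pfps_boltzmann)

lemma ev_cmult: "pfps N F \<Longrightarrow> ev N (\<lambda>y. a * F y) = a * ev N F"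
  by (simp add: ev_def mult.assoc gfps_cmult[OF N] pfps_mult pfps_boltzmann)

lemma ev_1: "ev N (\<lambda>y. 1) = 1"
  using gfps_boltzmann_0[OF N] by (simp add: ev_def inverse_mult_eq_1')

text \<open>The Gaussian equation is applied to \<open>F\<close> times the Boltzmann factor; the
  derivative of the latter is the source of the vertex term.\<close>

lemma ev_loop:
  assumes c: "c \<in> {1..3}" and F: "fder N c k F F'"
  shows "of_nat N * ev N (\<lambda>y. fps_const (tr_pow N c (Suc k) y) * F y) =
    (\<Sum>l<k. ev N (\<lambda>y. fps_const (tr_pow N c l y) * fps_const (tr_pow N c (k - 1 - l) y) * F y)) +
    ev N F' + ev N (\<lambda>y. dpot N c k y * F y)"
proof -
  note G = fder_mult[OF N c F fder_boltzmann[OF N c, of k]]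
  have "gfps N (\<lambda>y. F' y * boltzmann N y + F y * (boltzmann N y * dpot N c k y)) =
      gfps N (\<lambda>y. F' y * boltzmann N y) + gfps N (\<lambda>y. F y * (boltzmann N y * dpot N c k y))"
    by (intro gfps_add[OF N] pfps_mult fder_pfps[OF N c F] pfps_boltzmann pfps_dpot c)
  moreover have "(\<lambda>y. F y * (boltzmann N y * dpot N c k y)) = (\<lambda>y. dpot N c k y * F y * boltzmann N y)"
    by (simp add: mult_ac)
  ultimately have "of_nat N * gfps N (\<lambda>y. fps_const (tr_pow N c (Suc k) y) * F y * boltzmann N y) =
      (\<Sum>l<k. gfps N (\<lambda>y. fps_const (tr_pow N c l y) * fps_const (tr_pow N c (k - 1 - l) y) * F y * boltzmann N y)) +
      gfps N (\<lambda>y. F' y * boltzmann N y) + gfps N (\<lambda>y. dpot N c k y * F y * boltzmann N y)"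
    using gfps_loop[OF N c G] by (simp only: mult.assoc add.assoc)
  thus ?thesis
    unfolding ev_def mult.assoc[of "of_nat N", symmetric]
    by (simp only: distrib_right sum_distrib_right)
qed

text \<open>\<open>D\<close> depends on the configuration and cannot be pulled out of
  \<open>ev\<close> as a scalar. Splitting off a remainder divisible by \<open>fps_X ^ Suc m\<close>
  leaves finitely many terms, from which the powers of \<alpha> can be pulled out.\<close>

lemma ev_mult_series_nth:
  assumes F: "pfps N F" and D: "pfps N D"
  shows "fps_nth (ev N (\<lambda>y. D y * F y)) m =
    (\<Sum>p\<le>m. fps_nth (ev N (\<lambda>y. fps_const (fps_nth (D y) p) * F y)) (m - p))"
proof -
  have split: "E = (\<Sum>p\<le>m. fps_X ^ p * fps_const (fps_nth E p)) + fps_X ^ Suc m * fps_shift (Suc m) E"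
    for E :: "complex fps"
  proof (rule fps_ext)
    fix n
    have "(\<Sum>p\<le>m. fps_nth (fps_X ^ p * fps_const (fps_nth E p)) n) =
        (\<Sum>p\<le>m. if p = n then fps_nth E n else 0)"
      by (intro sum.cong) (auto simp: fps_X_power_mult_nth)
    also have "\<dots> = (if n \<le> m then fps_nth E n else 0)" by simp
    finally show "fps_nth E n = fps_nth ((\<Sum>p\<le>m. fps_X ^ p * fps_const (fps_nth E p)) +
        fps_X ^ Suc m * fps_shift (Suc m) E) n"
      by (simp add: fps_sum_nth fps_X_power_mult_nth del: power_Suc)
  qed
  have pD: "pfps N (\<lambda>y. fps_const (fps_nth (D y) p) * F y)" for p
    using D by (intro pfps_mult F pfps_fps_const) (simp add: pfps_def)
  have pR: "pfps N (\<lambda>y. fps_shift (Suc m) (D y) * F y)"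
    using D by (intro pfps_mult F) (simp add: pfps_def)
  have "(\<lambda>y. D y * F y) = (\<lambda>y. (\<Sum>p\<le>m. fps_X ^ p * (fps_const (fps_nth (D y) p) * F y)) +
      fps_X ^ Suc m * (fps_shift (Suc m) (D y) * F y))"
    by (rule ext, subst split) (simp add: distrib_right sum_distrib_right mult.assoc del: power_Suc)
  hence "ev N (\<lambda>y. D y * F y) = (\<Sum>p\<le>m. fps_X ^ p * ev N (\<lambda>y. fps_const (fps_nth (D y) p) * F y)) +
      fps_X ^ Suc m * ev N (\<lambda>y. fps_shift (Suc m) (D y) * F y)"
    using pD pR
    by (simp add: ev_add ev_sum ev_cmult pfps_sum pfps_mult pfps_const del: power_Suc)
  thus ?thesis
    by (simp add: fps_sum_nth fps_X_power_mult_nth del: power_Suc)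
qed

end

section \<open>Rescaled fluctuations\<close>

definition eps :: "nat \<Rightarrow> complex" where "eps N = of_real (1 / sqrt (real N))"

lemma fps_const_sum: "fps_const (\<Sum>a\<in>A. f a) = (\<Sum>a\<in>A. fps_const (f a))"
  by (rule fps_ext) (simp add: fps_sum_nth)

lemma eps_nonzero: "N > 0 \<Longrightarrow> eps N \<noteq> 0"
  by (simp add: eps_def)

lemma eps_square: "N > 0 \<Longrightarrow> of_nat N * eps N ^ 2 = 1"
  by (simp add: eps_def power_divide flip: of_real_power)

lemma powr_eps: "N > 0 \<Longrightarrow> of_real (real N powr (- (real p / 2))) = eps N ^ p"
proof -
  assume N: "N > 0"
  have "real N powr (- (real p / 2)) = (real N powr (- (1 / 2))) powr real p"
    by (simp add: powr_powr)
  also have "\<dots> = (1 / sqrt (real N)) ^ p"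
    using N by (simp add: powr_realpow powr_minus_divide powr_half_sqrt)
  finally show ?thesis by (simp add: eps_def)
qed

text \<open>Moments of the semicircle law of variance \<open>1 / (1 - \<alpha>\<^sup>2)\<close>.\<close>

definition variance_fps :: "complex fps" where "variance_fps = inverse (1 - fps_X ^ 2)"

fun sc_moment :: "nat \<Rightarrow> complex fps" where
  "sc_moment 0 = 1"
| "sc_moment (Suc k) = variance_fps * (\<Sum>l<k. sc_moment l * sc_moment (k - 1 - l))"

declare sc_moment.simps(2) [simp del]

lemma variance_fps: "(1 - fps_X ^ 2) * variance_fps = 1"
  unfolding variance_fps_def by (rule inverse_mult_eq_1') simp

lemma sc_moment_rec:
  "(1 - fps_X ^ 2) * sc_moment (Suc k) = (\<Sum>l<k. sc_moment l * sc_moment (k - 1 - l))"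
  by (simp add: sc_moment.simps(2) variance_fps flip: mult.assoc)

lemma sc_moment_1: "sc_moment (Suc 0) = 0" and sc_moment_2: "sc_moment 2 = variance_fps"
  by (simp_all add: sc_moment.simps(2) numeral_2_eq_2)

text \<open>A trace is written as \<open>tr (M c ^ a) = N * (sc_moment a + eps N * fluct N c a)\<close>.\<close>

definition ntr :: "nat \<Rightarrow> nat \<Rightarrow> nat \<Rightarrow> conf \<Rightarrow> complex" where
  "ntr N c a y = tr_pow N c a y / of_nat N"

definition fluct :: "nat \<Rightarrow> nat \<Rightarrow> nat \<Rightarrow> conf \<Rightarrow> complex fps" where
  "fluct N c a y = fps_const (inverse (eps N)) * (fps_const (ntr N c a y) - sc_moment a)"

definition uprod :: "nat \<Rightarrow> (nat \<times> nat) list \<Rightarrow> conf \<Rightarrow> complex fps" where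
  "uprod N us y = (\<Prod>(c, a)\<leftarrow>us. fps_const (ntr N c a y))"

definition sprod :: "nat \<Rightarrow> (nat \<times> nat) list \<Rightarrow> conf \<Rightarrow> complex fps" where
  "sprod N xs y = (\<Prod>(c, a)\<leftarrow>xs. fluct N c a y)"

text \<open>The loop equations produce normalised traces, listed in \<open>us\<close>, while the
  induction concerns fluctuations, listed in \<open>xs\<close>. Keeping both lists allows the former
  to be expanded one at a time by \<open>EV_Cons\<close>.\<close>

definition EV :: "nat \<Rightarrow> (nat \<times> nat) list \<Rightarrow> (nat \<times> nat) list \<Rightarrow> complex fps" where
  "EV N us xs = ev N (\<lambda>y. uprod N us y * sprod N xs y)"

definition colored :: "(nat \<times> nat) list \<Rightarrow> bool" where
  "colored xs \<longleftrightarrow> (\<forall>x\<in>set xs. fst x \<in> {1..3})"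

lemma colored_simps [simp]:
  "colored []" "colored (x # xs) \<longleftrightarrow> fst x \<in> {1..3} \<and> colored xs"
  "colored (xs @ ys) \<longleftrightarrow> colored xs \<and> colored ys"
  by (auto simp: colored_def)

lemma uprod_simps: "uprod N [] y = 1" "uprod N ((c, a) # us) y = fps_const (ntr N c a y) * uprod N us y"
  and sprod_simps: "sprod N [] y = 1" "sprod N ((c, a) # us) y = fluct N c a y * sprod N us y"
  by (simp_all add: uprod_def sprod_def)

definition remove_at :: "nat \<Rightarrow> 'a list \<Rightarrow> 'a list" where "remove_at i xs = take i xs @ drop (Suc i) xs"

lemma colored_remove_at: "colored xs \<Longrightarrow> colored (remove_at i xs)"
  by (auto simp: remove_at_def colored_def dest: in_set_takeD in_set_dropD)

definition multi_EV :: "nat \<Rightarrow> nat \<Rightarrow> nat \<Rightarrow> (nat \<times> nat) list \<Rightarrow> nat \<Rightarrow> complex fps" where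
  "multi_EV N c k xs p = (\<Sum>i\<le>p - 1. \<Sum>l\<le>i. of_nat (((p - 1) choose i) * (i choose l)) *
     EV N [(c, k + l), (other1 c, i - l), (other2 c, p - 1 - i)] xs)"

text \<open>The vertices of order at least 3. After rescaling, the vertex of order \<open>p\<close>
  carries \<open>eps N ^ (p - 2)\<close>; one factor is taken out here because the whole equation
  will later be divided by \<open>eps N\<close>.\<close>

definition rest :: "nat \<Rightarrow> nat \<Rightarrow> nat \<Rightarrow> (nat \<times> nat) list \<Rightarrow> complex fps" where
  "rest N c k xs = Abs_fps (\<lambda>m. \<Sum>p\<in>{3..m}. eps N ^ (p - 3) * fps_nth (multi_EV N c k xs p) (m - p))"

context
  fixes N :: nat
  assumes N: "N > 0"
begin

lemma fps_const_ntr: "fps_const (ntr N c a y) = sc_moment a + fps_const (eps N) * fluct N c a y"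
  using eps_nonzero[OF N] by (simp add: fluct_def flip: mult.assoc)

lemma fluct_0: "fluct N c 0 y = 0"
  using N by (simp add: fluct_def ntr_def tr_pow_0)

lemma poly_fun_ntr: "c \<in> {1..3} \<Longrightarrow> poly_fun N (ntr N c a)"
  unfolding ntr_def[abs_def] divide_inverse by (intro poly_fun_mult poly_fun_tr_pow poly_fun_const)

lemma pfps_fluct: "c \<in> {1..3} \<Longrightarrow> pfps N (fluct N c a)"
  using pfps_mult[OF pfps_const pfps_add[OF pfps_fps_const[OF poly_fun_ntr] pfps_const],
    of c "fps_const (inverse (eps N))" a "- sc_moment a"]
  by (simp add: fluct_def[abs_def])

lemma pfps_uprod: "colored us \<Longrightarrow> pfps N (uprod N us)"
  by (induction us) (auto simp: uprod_simps[abs_def] intro!: pfps_const pfps_mult pfps_fps_const poly_fun_ntr)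

lemma pfps_sprod: "colored us \<Longrightarrow> pfps N (sprod N us)"
  by (induction us) (auto simp: sprod_simps[abs_def] intro!: pfps_const pfps_mult pfps_fluct)

lemma EV_Cons:
  assumes "c \<in> {1..3}" "colored us" "colored xs"
  shows "EV N ((c, a) # us) xs = sc_moment a * EV N us xs + fps_const (eps N) * EV N us ((c, a) # xs)"
proof -
  have "(\<lambda>y. uprod N ((c, a) # us) y * sprod N xs y) = (\<lambda>y. sc_moment a * (uprod N us y * sprod N xs y) +
      fps_const (eps N) * (uprod N us y * sprod N ((c, a) # xs) y))"
    by (simp add: uprod_simps sprod_simps fps_const_ntr algebra_simps)
  thus ?thesis unfolding EV_def using assms
    by (simp add: ev_add[OF N] ev_cmult[OF N] pfps_mult pfps_const pfps_uprod pfps_sprod)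
qed

lemma EV_Nil: "EV N [] [] = 1"
  using ev_1[OF N] by (simp add: EV_def uprod_simps sprod_simps)

lemma sprod_zero: "(c, 0) \<in> set xs \<Longrightarrow> sprod N xs y = 0"
  by (induction xs) (auto simp: sprod_simps fluct_0)

text \<open>The trace of the identity is exactly N, so a factor of degree zero does not
  fluctuate.\<close>

lemma EV_zero:
  assumes "(c, 0) \<in> set xs" shows "EV N us xs = 0"
proof -
  have "EV N us xs = ev N (\<lambda>y. 0 * 0)" by (simp add: EV_def sprod_zero[OF assms])
  also have "\<dots> = 0" using ev_cmult[OF N pfps_const, of 0 0] by simp
  finally show ?thesis .
qed

lemma EV_2:
  assumes "c \<in> {1..3}" "d \<in> {1..3}" "colored xs"
  shows "EV N [(c, a), (d, b)] xs = sc_moment a * sc_moment b * EV N [] xs +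
    fps_const (eps N) * (sc_moment a * EV N [] ((d, b) # xs) + sc_moment b * EV N [] ((c, a) # xs) +
      fps_const (eps N) * EV N [] ((d, b) # (c, a) # xs))"
  using assms by (simp add: EV_Cons algebra_simps)

lemma fder_fluct:
  assumes c: "c \<in> {1..3}" and c': "c' \<in> {1..3}"
  shows "fder N c k (fluct N c' a) (\<lambda>y. if c' = c
    then fps_const (inverse (eps N) * of_nat a) * fps_const (ntr N c (k + a - 1) y) else 0)"
proof -
  have t: "tder N c k (ntr N c' a) (\<lambda>y. inverse (of_nat N) * (if c' = c then of_nat a * tr_pow N c (k + a - 1) y else 0))"
    using tder_mult[OF N c tder_const[OF N c, of k "inverse (of_nat N)"] tder_tr_pow[OF N c c', of k a]]
    by (simp add: ntr_def[abs_def] divide_inverse mult.commute)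
  have "fder N c k (\<lambda>y. fps_const (inverse (eps N)) * (fps_const (ntr N c' a y) + (- sc_moment a)))
     (\<lambda>y. fps_const (inverse (eps N)) * (fps_const (inverse (of_nat N) * (if c' = c then of_nat a * tr_pow N c (k + a - 1) y else 0)) + 0))"
    by (intro fder_cmult[OF N c] fder_add[OF N c] fder_const[OF N c] fder_fps_const[OF N c t])
  also have "(\<lambda>y. fps_const (inverse (eps N)) * (fps_const (ntr N c' a y) + (- sc_moment a))) = fluct N c' a"
    by (simp add: fluct_def[abs_def])
  also have "(\<lambda>y. fps_const (inverse (eps N)) * (fps_const (inverse (of_nat N) * (if c' = c then of_nat a * tr_pow N c (k + a - 1) y else 0)) + 0))
     = (\<lambda>y. if c' = c then fps_const (inverse (eps N) * of_nat a) * fps_const (ntr N c (k + a - 1) y) else 0)"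
    by (auto simp: ntr_def divide_inverse mult_ac)
  finally show ?thesis .
qed

lemma fder_sprod:
  assumes c: "c \<in> {1..3}" and xs: "colored xs"
  shows "fder N c k (sprod N xs) (\<lambda>y. \<Sum>i<length xs. if fst (xs ! i) = c
    then fps_const (inverse (eps N) * of_nat (snd (xs ! i))) *
      (uprod N [(c, k + snd (xs ! i) - 1)] y * sprod N (remove_at i xs) y) else 0)"
  using xs
proof (induction xs)
  case Nil
  show ?case using fder_const[OF N c, of k 1] by (simp add: sprod_simps[abs_def])
next
  case (Cons x xs)
  obtain c' a where x: "x = (c', a)" by (cases x)
  have c': "c' \<in> {1..3}" and xs: "colored xs" using Cons.prems x by auto
  have f: "sprod N (x # xs) = (\<lambda>y. fluct N c' a y * sprod N xs y)" by (simp add: x sprod_simps fun_eq_iff)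
  have s: "fluct N c' a y * (if P then A * (B * sprod N (remove_at i xs) y) else 0) =
      (if P then A * (B * sprod N (remove_at (Suc i) (x # xs)) y) else 0)" for y P A B i
    by (simp add: x remove_at_def sprod_simps mult_ac)
  show ?case
    using fder_mult[OF N c fder_fluct[OF c c', of k a] Cons.IH[OF xs]]
    unfolding f length_Cons sum.lessThan_Suc_shift sum_distrib_left s
    by (simp add: x remove_at_def uprod_simps mult.assoc if_distrib[of "\<lambda>z. z * _"] cong: if_cong
        del: fps_const_mult)
qed

text \<open>Power counting: the vertex of order \<open>p\<close> has the factor
  \<open>eps N ^ p\<close>, its three traces give N^3, which is \<open>eps N\<close> to the power
  -6, and the loop equation is divided by N^2. Together this is
  \<open>eps N ^ (p - 2)\<close>.\<close>

lemma dpot_EV: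
  assumes c: "c \<in> {1..3}" and xs: "colored xs"
  shows "fps_const (eps N ^ 4) * ev N (\<lambda>y. dpot N c k y * sprod N xs y) =
    fps_X ^ 2 * multi_EV N c k xs 2 + fps_const (eps N) * rest N c k xs"
proof (rule fps_ext)
  fix m
  define A where "A = multi_EV N c k xs"
  have c': "other1 c \<in> {1..3}" "other2 c \<in> {1..3}" using others[OF c] by auto
  have coeff_eq: "fps_const (eps N ^ 4) * ev N (\<lambda>y. fps_const (fps_nth (dpot N c k y) p) * sprod N xs y) =
      (if p \<ge> 2 then fps_const (eps N ^ (p - 2)) * A p else 0)" for p
  proof (cases "p \<ge> 2")
    case True
    have tr: "tr_pow N c a y = of_nat N * ntr N c a y" for c a y using N by (simp add: ntr_def)
    have "fps_nth (dpot N c k y) p = eps N ^ p * of_nat N ^ 3 *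
      multi (p - 1) (\<lambda>a. ntr N c (k + a) y) (\<lambda>a. ntr N (other1 c) a y) (\<lambda>a. ntr N (other2 c) a y)" for y
      using True powr_eps[OF N, of p]
      by (simp add: dpot_def multi_sum tr sum_distrib_left power3_eq_cube mult_ac)
    moreover define G where "G i l y =
      uprod N [(c, k + l), (other1 c, i - l), (other2 c, p - 1 - i)] y * sprod N xs y" for i l y
    ultimately have eq: "(\<lambda>y. fps_const (fps_nth (dpot N c k y) p) * sprod N xs y) =
      (\<lambda>y. fps_const (eps N ^ p * of_nat N ^ 3) * (\<Sum>i\<le>p - 1. \<Sum>l\<le>i.
        of_nat (((p - 1) choose i) * (i choose l)) * G i l y))"
      by (simp add: multi_sum fps_const_sum uprod_simps sum_distrib_left sum_distrib_right mult_ac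
          del: fps_const_mult flip: fps_of_nat fps_const_mult)
    have pG: "pfps N (G i l)" for i l
      unfolding G_def[abs_def] using c c' xs by (intro pfps_mult pfps_uprod pfps_sprod) auto
    have "ev N (\<lambda>y. fps_const (fps_nth (dpot N c k y) p) * sprod N xs y) =
      fps_const (eps N ^ p * of_nat N ^ 3) * ev N (\<lambda>y. \<Sum>i\<le>p - 1. \<Sum>l\<le>i.
        of_nat (((p - 1) choose i) * (i choose l)) * G i l y)"
      unfolding eq by (intro ev_cmult[OF N] pfps_sum pfps_mult pfps_const pG) auto
    also have "ev N (\<lambda>y. \<Sum>i\<le>p - 1. \<Sum>l\<le>i. of_nat (((p - 1) choose i) * (i choose l)) * G i l y) =
      (\<Sum>i\<le>p - 1. ev N (\<lambda>y. \<Sum>l\<le>i. of_nat (((p - 1) choose i) * (i choose l)) * G i l y))"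
      by (intro ev_sum[OF N] pfps_sum pfps_mult pfps_const pG) auto
    also have "\<dots> = (\<Sum>i\<le>p - 1. \<Sum>l\<le>i. ev N (\<lambda>y. of_nat (((p - 1) choose i) * (i choose l)) * G i l y))"
      by (intro sum.cong refl ev_sum[OF N] pfps_mult pfps_const pG) auto
    also have "\<dots> = A p"
    proof -
      have EG: "EV N [(c, k + l), (other1 c, i - l), (other2 c, p - 1 - i)] xs = ev N (G i l)" for i l
        by (simp add: EV_def G_def[abs_def])
      show ?thesis unfolding A_def multi_EV_def EG by (intro sum.cong refl ev_cmult[OF N] pG)
    qed
    finally have "ev N (\<lambda>y. fps_const (fps_nth (dpot N c k y) p) * sprod N xs y) =
      fps_const (eps N ^ p * of_nat N ^ 3) * A p" .
    moreover have "eps N ^ 4 * (eps N ^ p * of_nat N ^ 3) = eps N ^ (p - 2)"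
    proof -
      have 1: "eps N ^ p = eps N ^ (p - 2) * eps N ^ 2"
        using True by (metis le_add_diff_inverse2 power_add)
      have 2: "eps N ^ 4 * eps N ^ 2 = (eps N ^ 2) ^ 3"
        by (simp flip: power_mult power_add)
      have "eps N ^ 4 * (eps N ^ p * of_nat N ^ 3) = eps N ^ (p - 2) * ((eps N ^ 4 * eps N ^ 2) * of_nat N ^ 3)"
        unfolding 1 by (simp only: mult_ac)
      also have "\<dots> = eps N ^ (p - 2) * (of_nat N * eps N ^ 2) ^ 3"
        unfolding 2 power_mult_distrib by (simp only: mult_ac)
      finally show ?thesis by (simp only: eps_square[OF N] power_one mult_1_right)
    qed
    ultimately show ?thesis using True by (simp flip: mult.assoc)
  next
    case False
    thus ?thesis using ev_cmult[OF N pfps_const, of 0 0] by (simp add: dpot_def)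
  qed
  have "fps_nth (fps_const (eps N ^ 4) * ev N (\<lambda>y. dpot N c k y * sprod N xs y)) m =
      (\<Sum>p\<le>m. fps_nth (fps_const (eps N ^ 4) * ev N (\<lambda>y. fps_const (fps_nth (dpot N c k y) p) * sprod N xs y)) (m - p))"
    using ev_mult_series_nth[OF N pfps_sprod[OF xs] pfps_dpot[OF N c], of k m]
    by (simp add: sum_distrib_left)
  also have "\<dots> = (\<Sum>p\<le>m. if p \<ge> 2 then eps N ^ (p - 2) * fps_nth (A p) (m - p) else 0)"
    unfolding coeff_eq by (intro sum.cong) auto
  also have "\<dots> = (\<Sum>p\<in>{2..m}. eps N ^ (p - 2) * fps_nth (A p) (m - p))"
    by (intro sum.mono_neutral_cong_right) auto
  also have "\<dots> = (if m \<ge> 2 then fps_nth (A 2) (m - 2) else 0) +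
      (\<Sum>p\<in>{3..m}. eps N ^ (p - 2) * fps_nth (A p) (m - p))"
    by (cases "m \<ge> 2") (simp_all add: sum.atLeast_Suc_atMost numeral_3_eq_3 numeral_2_eq_2)
  also have "(\<Sum>p\<in>{3..m}. eps N ^ (p - 2) * fps_nth (A p) (m - p)) =
      eps N * (\<Sum>p\<in>{3..m}. eps N ^ (p - 3) * fps_nth (A p) (m - p))"
    unfolding sum_distrib_left
  proof (intro sum.cong refl)
    fix p assume "p \<in> {3..m}"
    hence "p - 2 = Suc (p - 3)" by auto
    thus "eps N ^ (p - 2) * fps_nth (A p) (m - p) = eps N * (eps N ^ (p - 3) * fps_nth (A p) (m - p))"
      by simp
  qed
  finally show "fps_nth (fps_const (eps N ^ 4) * ev N (\<lambda>y. dpot N c k y * sprod N xs y)) m =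
      fps_nth (fps_X ^ 2 * multi_EV N c k xs 2 + fps_const (eps N) * rest N c k xs) m"
    by (simp add: A_def rest_def fps_X_power_mult_nth)
qed

text \<open>The loop equation divided by N^2, which makes the left side and the splitting term of
  order one. A contact term comes with the inverse of \<open>eps N\<close>, from the rescaling of
  the fluctuation it differentiates, and so ends up with \<open>eps N ^ 3\<close>.\<close>

lemma scaled_loop_raw:
  assumes c: "c \<in> {1..3}" and xs: "colored xs"
  shows "EV N [(c, Suc k)] xs = (\<Sum>l<k. EV N [(c, l), (c, k - 1 - l)] xs) +
    fps_const (eps N ^ 3) * (\<Sum>i<length xs. if fst (xs ! i) = c
      then of_nat (snd (xs ! i)) * EV N [(c, k + snd (xs ! i) - 1)] (remove_at i xs) else 0) +
    (fps_X ^ 2 * multi_EV N c k xs 2 + fps_const (eps N) * rest N c k xs)"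
proof -
  have tr: "fps_const (tr_pow N c a y) = fps_const (of_nat N) * fps_const (ntr N c a y)" for a y
    using N by (simp add: ntr_def)
  define R where "R = (\<Sum>i<length xs. if fst (xs ! i) = c
      then of_nat (snd (xs ! i)) * EV N [(c, k + snd (xs ! i) - 1)] (remove_at i xs) else 0)"
  have p1: "pfps N (\<lambda>y. uprod N [(c, a)] y * sprod N xs y)"
    and p2: "pfps N (\<lambda>y. uprod N [(c, a), (c, b)] y * sprod N xs y)" for a b
    using c xs by (auto intro!: pfps_mult pfps_uprod pfps_sprod)
  have "(\<lambda>y. fps_const (tr_pow N c (Suc k) y) * sprod N xs y) =
      (\<lambda>y. fps_const (of_nat N) * (uprod N [(c, Suc k)] y * sprod N xs y))"
    by (simp add: tr uprod_simps mult.assoc del: fps_const_mult)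
  hence 1: "ev N (\<lambda>y. fps_const (tr_pow N c (Suc k) y) * sprod N xs y) = fps_const (of_nat N) * EV N [(c, Suc k)] xs"
    unfolding EV_def by (simp only: ev_cmult[OF N p1])
  have "(\<lambda>y. fps_const (tr_pow N c l y) * fps_const (tr_pow N c (k - 1 - l) y) * sprod N xs y) =
      (\<lambda>y. fps_const (of_nat N ^ 2) * (uprod N [(c, l), (c, k - 1 - l)] y * sprod N xs y))" for l
    by (simp add: tr uprod_simps power2_eq_square mult_ac del: fps_const_mult flip: fps_const_mult)
  hence 2: "ev N (\<lambda>y. fps_const (tr_pow N c l y) * fps_const (tr_pow N c (k - 1 - l) y) * sprod N xs y) =
      fps_const (of_nat N ^ 2) * EV N [(c, l), (c, k - 1 - l)] xs" for l
    unfolding EV_def by (simp only: ev_cmult[OF N p2])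
  have 3: "ev N (\<lambda>y. \<Sum>i<length xs. if fst (xs ! i) = c
    then fps_const (inverse (eps N) * of_nat (snd (xs ! i))) *
      (uprod N [(c, k + snd (xs ! i) - 1)] y * sprod N (remove_at i xs) y) else 0) = fps_const (inverse (eps N)) * R"
  proof -
    have p: "pfps N (\<lambda>y. uprod N [(c, k + snd (xs ! i) - 1)] y * sprod N (remove_at i xs) y)" for i
      using c by (intro pfps_mult pfps_uprod pfps_sprod colored_remove_at xs) auto
    have "ev N (\<lambda>y. if fst (xs ! i) = c then fps_const (inverse (eps N) * of_nat (snd (xs ! i))) *
      (uprod N [(c, k + snd (xs ! i) - 1)] y * sprod N (remove_at i xs) y) else 0) = fps_const (inverse (eps N)) *
      (if fst (xs ! i) = c then of_nat (snd (xs ! i)) * EV N [(c, k + snd (xs ! i) - 1)] (remove_at i xs) else 0)" for i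
      using ev_cmult[OF N p, of "fps_const (inverse (eps N) * of_nat (snd (xs ! i)))" i]
        ev_cmult[OF N pfps_const, of 0 0]
      by (simp add: EV_def mult.assoc flip: fps_of_nat fps_const_mult)
    moreover have "pfps N (\<lambda>y. if fst (xs ! i) = c then fps_const (inverse (eps N) * of_nat (snd (xs ! i))) *
      (uprod N [(c, k + snd (xs ! i) - 1)] y * sprod N (remove_at i xs) y) else 0)" for i
      using pfps_mult[OF pfps_const p] pfps_const by (cases "fst (xs ! i) = c") auto
    ultimately show ?thesis by (subst ev_sum[OF N]) (auto simp: R_def sum_distrib_left)
  qed
  have "of_nat N * (fps_const (of_nat N) * EV N [(c, Suc k)] xs) =
      (\<Sum>l<k. fps_const (of_nat N ^ 2) * EV N [(c, l), (c, k - 1 - l)] xs) +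
      fps_const (inverse (eps N)) * R + ev N (\<lambda>y. dpot N c k y * sprod N xs y)"
    using ev_loop[OF N c fder_sprod[OF c xs, of k]] unfolding 1 2 3 .
  hence eq: "fps_const (eps N ^ 4) * (of_nat N * (fps_const (of_nat N) * EV N [(c, Suc k)] xs)) =
      fps_const (eps N ^ 4) * ((\<Sum>l<k. fps_const (of_nat N ^ 2) * EV N [(c, l), (c, k - 1 - l)] xs) +
      fps_const (inverse (eps N)) * R + ev N (\<lambda>y. dpot N c k y * sprod N xs y))" by (rule arg_cong)
  have n4: "eps N ^ 4 * of_nat N ^ 2 = 1"
    using arg_cong[OF eps_square[OF N], of "\<lambda>x. x ^ 2"] by (simp add: power_mult_distrib mult.commute flip: power_mult)
  have a: "fps_const (eps N ^ 4) * (of_nat N * (fps_const (of_nat N) * Z)) = Z" for Z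
  proof -
    have "fps_const (eps N ^ 4) * (of_nat N * (fps_const (of_nat N) * Z)) = fps_const (eps N ^ 4 * of_nat N ^ 2) * Z"
      by (simp only: power2_eq_square fps_const_mult[symmetric] fps_of_nat mult.assoc)
    thus ?thesis by (simp add: n4)
  qed
  have b: "fps_const (eps N ^ 4) * (fps_const (of_nat N ^ 2) * Z) = Z" for Z
    using n4 by (simp flip: mult.assoc)
  have d: "fps_const (eps N ^ 4) * (fps_const (inverse (eps N)) * Z) = fps_const (eps N ^ 3) * Z" for Z
    using eps_nonzero[OF N] by (simp add: power4_eq_xxxx power3_eq_cube flip: mult.assoc)
  show ?thesis
    using eq unfolding distrib_left sum_distrib_left a b d dpot_EV[OF c xs] R_def[symmetric] .
qed

end

section \<open>Polynomiality in the inverse square root of N\<close>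

text \<open>The quadratic vertex inserts one extra factor in one of the three colours. For colour
  \<open>c\<close> this raises \<open>k\<close> to \<open>Suc k\<close>; for the other two the
  semicircle mean \<open>sc_moment 1\<close> vanishes, so these insertions are pure
  fluctuations.\<close>

lemma multi_EV_2:
  assumes N: "N > 0" and c: "c \<in> {1..3}" and xs: "colored xs"
  shows "multi_EV N c k xs 2 =
    sc_moment (Suc k) * EV N [] xs + fps_const (eps N) * (EV N [] ((c, Suc k) # xs) +
     sc_moment k * (EV N [] ((other1 c, 1) # xs) + EV N [] ((other2 c, 1) # xs)) +
     fps_const (eps N) * (EV N [] ((other1 c, 1) # (c, k) # xs) + EV N [] ((other2 c, 1) # (c, k) # xs)))"
proof -
  have o: "other1 c \<in> {1..3}" "other2 c \<in> {1..3}" using others[OF c] by auto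
  have "multi_EV N c k xs 2 = EV N [(c, k), (other1 c, 0), (other2 c, 1)] xs +
      (EV N [(c, k), (other1 c, 1), (other2 c, 0)] xs + EV N [(c, Suc k), (other1 c, 0), (other2 c, 0)] xs)"
    by (simp add: multi_EV_def numeral_2_eq_2)
  also have "\<dots> = sc_moment (Suc k) * EV N [] xs + fps_const (eps N) * (EV N [] ((c, Suc k) # xs) +
     sc_moment k * (EV N [] ((other1 c, 1) # xs) + EV N [] ((other2 c, 1) # xs)) +
     fps_const (eps N) * (EV N [] ((other1 c, 1) # (c, k) # xs) + EV N [] ((other2 c, 1) # (c, k) # xs)))"
    using N c o xs
    by (simp add: EV_Cons EV_zero[OF N, of "other1 c"] EV_zero[OF N, of "other2 c"] sc_moment_1 algebra_simps
        del: fps_const_mult)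
  finally show ?thesis .
qed

text \<open>Expanding the traces in means and fluctuations, the parts free of \<open>eps N\<close>
  agree on both sides and one factor \<open>eps N\<close> can be cancelled. The quadratic vertex
  contributes \<open>fps_X ^ 2\<close> times the expectation on the left side, whence the factor
  \<open>1 - fps_X ^ 2\<close>.\<close>

lemma scaled_loop:
  assumes N: "N > 0" and c: "c \<in> {1..3}" and xs: "colored xs"
  shows "(1 - fps_X ^ 2) * EV N [] ((c, Suc k) # xs) =
    (\<Sum>l<k. sc_moment l * EV N [] ((c, k - 1 - l) # xs) + sc_moment (k - 1 - l) * EV N [] ((c, l) # xs) +
       fps_const (eps N) * EV N [] ((c, k - 1 - l) # (c, l) # xs)) +
    fps_const (eps N) * (fps_const (eps N) * (\<Sum>i<length xs. if fst (xs ! i) = c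
      then of_nat (snd (xs ! i)) * EV N [(c, k + snd (xs ! i) - 1)] (remove_at i xs) else 0)) +
    fps_X ^ 2 * (sc_moment k * (EV N [] ((other1 c, 1) # xs) + EV N [] ((other2 c, 1) # xs)) +
      fps_const (eps N) * (EV N [] ((other1 c, 1) # (c, k) # xs) + EV N [] ((other2 c, 1) # (c, k) # xs))) +
    rest N c k xs"
proof -
  define e where "e = fps_const (eps N)"
  define D where "D = (\<Sum>i<length xs. if fst (xs ! i) = c
      then of_nat (snd (xs ! i)) * EV N [(c, k + snd (xs ! i) - 1)] (remove_at i xs) else 0)"
  define T where "T = (\<Sum>l<k. sc_moment l * EV N [] ((c, k - 1 - l) # xs) +
    sc_moment (k - 1 - l) * EV N [] ((c, l) # xs) + e * EV N [] ((c, k - 1 - l) # (c, l) # xs))"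
  define U where "U = sc_moment k * (EV N [] ((other1 c, 1) # xs) + EV N [] ((other2 c, 1) # xs)) +
      e * (EV N [] ((other1 c, 1) # (c, k) # xs) + EV N [] ((other2 c, 1) # (c, k) # xs))"
  have e0: "e \<noteq> 0" using eps_nonzero[OF N] by (simp add: e_def)
  have 1: "EV N [(c, Suc k)] xs = sc_moment (Suc k) * EV N [] xs + e * EV N [] ((c, Suc k) # xs)"
    using N c xs by (simp add: EV_Cons e_def)
  \<comment> \<open>The product of means becomes \<open>(1 - fps_X ^ 2) * sc_moment (Suc k)\<close>
    by the semicircle recursion; the quadratic vertex supplies the missing
    \<open>fps_X ^ 2 * sc_moment (Suc k)\<close>, so the total matches the mean in 1.\<close>
  have 2: "(\<Sum>l<k. EV N [(c, l), (c, k - 1 - l)] xs) =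
      (1 - fps_X ^ 2) * sc_moment (Suc k) * EV N [] xs + e * T"
  proof -
    have "(\<Sum>l<k. EV N [(c, l), (c, k - 1 - l)] xs) =
      (\<Sum>l<k. sc_moment l * sc_moment (k - 1 - l) * EV N [] xs + e * (sc_moment l * EV N [] ((c, k - 1 - l) # xs) +
         sc_moment (k - 1 - l) * EV N [] ((c, l) # xs) + e * EV N [] ((c, k - 1 - l) # (c, l) # xs)))"
      unfolding e_def by (intro sum.cong refl EV_2[OF N c c xs])
    also have "\<dots> = (\<Sum>l<k. sc_moment l * sc_moment (k - 1 - l)) * EV N [] xs + e * T"
      unfolding T_def sum.distrib[of "\<lambda>l. sc_moment l * sc_moment (k - 1 - l) * EV N [] xs"]
      by (simp only: sum_distrib_left sum_distrib_right)
    finally show ?thesis unfolding sc_moment_rec .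
  qed
  have 3: "multi_EV N c k xs 2 = sc_moment (Suc k) * EV N [] xs + e * (EV N [] ((c, Suc k) # xs) + U)"
    unfolding U_def e_def multi_EV_2[OF assms] by (simp only: add.assoc)
  have 4: "fps_const (eps N ^ 3) = e * (e * e)"
    by (simp add: e_def power3_eq_cube)
  have "e * ((1 - fps_X ^ 2) * EV N [] ((c, Suc k) # xs)) = e * (T + e * (e * D) + fps_X ^ 2 * U + rest N c k xs)"
    using scaled_loop_raw[OF assms, of k] unfolding 1 2 3 4 D_def[symmetric] e_def[symmetric]
    by (simp add: algebra_simps)
  hence "(1 - fps_X ^ 2) * EV N [] ((c, Suc k) # xs) = T + e * (e * D) + fps_X ^ 2 * U + rest N c k xs"
    using e0 by simp
  thus ?thesis unfolding T_def D_def U_def e_def .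
qed

section \<open>Sequences that are polynomial in the inverse square root of N, and the
  induction\<close>

definition eps_poly :: "(nat \<Rightarrow> complex) \<Rightarrow> bool" where
  "eps_poly f \<longleftrightarrow> (\<exists>P. \<forall>N>0. f N = poly P (eps N))"

lemma eps_poly_const: "eps_poly (\<lambda>N. r)"
  unfolding eps_poly_def by (intro exI[of _ "[:r:]"]) simp

lemma eps_poly_eps: "eps_poly eps"
  unfolding eps_poly_def by (intro exI[of _ "[:0, 1:]"]) simp

lemma eps_poly_add: "eps_poly f \<Longrightarrow> eps_poly g \<Longrightarrow> eps_poly (\<lambda>N. f N + g N)"
  unfolding eps_poly_def by (elim exE, rule_tac x = "P + Pa" in exI) simp

lemma eps_poly_mult: "eps_poly f \<Longrightarrow> eps_poly g \<Longrightarrow> eps_poly (\<lambda>N. f N * g N)"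
  unfolding eps_poly_def by (elim exE, rule_tac x = "P * Pa" in exI) simp

lemma eps_poly_power: "eps_poly f \<Longrightarrow> eps_poly (\<lambda>N. f N ^ n)"
  by (induction n) (auto intro: eps_poly_const eps_poly_mult)

lemma eps_poly_sum:
  assumes "finite A" "\<And>a. a \<in> A \<Longrightarrow> eps_poly (f a)"
  shows "eps_poly (\<lambda>N. \<Sum>a\<in>A. f a N)"
  using assms
proof (induction rule: finite_induct)
  case empty
  show ?case using eps_poly_const[of 0] by simp
next
  case (insert a A)
  thus ?case using eps_poly_add[of "f a"] by simp
qed

lemma eps_poly_cong: "(\<And>N. N > 0 \<Longrightarrow> f N = g N) \<Longrightarrow> eps_poly f \<longleftrightarrow> eps_poly g"
  unfolding eps_poly_def by auto

text \<open>The bound \<open>m\<close> is there because, in the middle of the induction,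
  polynomiality is known only up to a given order in \<alpha>.\<close>

definition fps_good :: "nat \<Rightarrow> (nat \<Rightarrow> complex fps) \<Rightarrow> bool" where
  "fps_good m X \<longleftrightarrow> (\<forall>j\<le>m. eps_poly (\<lambda>N. fps_nth (X N) j))"

lemma fps_good_nth: "fps_good m X \<Longrightarrow> j \<le> m \<Longrightarrow> eps_poly (\<lambda>N. fps_nth (X N) j)"
  by (simp add: fps_good_def)

lemma fps_good_add: "fps_good m X \<Longrightarrow> fps_good m Y \<Longrightarrow> fps_good m (\<lambda>N. X N + Y N)"
  by (simp add: fps_good_def eps_poly_add)

lemma fps_good_mult: "fps_good m X \<Longrightarrow> fps_good m Y \<Longrightarrow> fps_good m (\<lambda>N. X N * Y N)"
  unfolding fps_good_def fps_mult_nth by (intro allI impI eps_poly_sum eps_poly_mult) auto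

lemma fps_good_const: "fps_good m (\<lambda>N. a)"
  by (simp add: fps_good_def eps_poly_const)

lemma fps_good_eps: "fps_good m (\<lambda>N. fps_const (eps N))"
  unfolding fps_good_def
proof (intro allI impI)
  fix j show "eps_poly (\<lambda>N. fps_nth (fps_const (eps N)) j)"
    using eps_poly_eps eps_poly_const[of 0] by (cases "j = 0") auto
qed

lemma fps_good_sum:
  assumes "finite A" "\<And>a. a \<in> A \<Longrightarrow> fps_good m (X a)"
  shows "fps_good m (\<lambda>N. \<Sum>a\<in>A. X a N)"
  using assms by (simp add: fps_good_def fps_sum_nth eps_poly_sum)

lemma fps_good_cong: "(\<And>N. N > 0 \<Longrightarrow> X N = Y N) \<Longrightarrow> fps_good m X \<longleftrightarrow> fps_good m Y"
  unfolding fps_good_def eps_poly_def by auto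

lemma fps_good_EV:
  assumes "\<And>ys. colored ys \<Longrightarrow> fps_good m (\<lambda>N. EV N [] ys)" "colored us" "colored xs"
  shows "fps_good m (\<lambda>N. EV N us xs)"
  using assms(2,3)
proof (induction us arbitrary: xs)
  case Nil
  thus ?case using assms(1) by simp
next
  case (Cons u us)
  obtain c a where u: "u = (c, a)" by (cases u)
  have "fps_good m (\<lambda>N. sc_moment a * EV N us xs + fps_const (eps N) * EV N us ((c, a) # xs))"
    using Cons u by (intro fps_good_add fps_good_mult fps_good_const fps_good_eps Cons.IH) auto
  thus ?case using Cons.prems u by (subst fps_good_cong[OF EV_Cons[of _ c us xs a, folded u]]) auto
qed

text \<open>A vertex of order \<open>p\<close> leaves only the order \<open>m - p\<close> to its
  traces. Strictly lower orders therefore suffice, whatever the degree of the traces.\<close>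

lemma fps_good_rest_nth:
  assumes "\<And>j ys. j < m \<Longrightarrow> colored ys \<Longrightarrow> fps_good j (\<lambda>N. EV N [] ys)" "c \<in> {1..3}" "colored xs"
  shows "eps_poly (\<lambda>N. fps_nth (rest N c k xs) m)"
proof -
  have "eps_poly (\<lambda>N. fps_nth (multi_EV N c k xs p) (m - p))" if "p \<in> {3..m}" for p
  proof -
    have "fps_good (m - p) (\<lambda>N. EV N us xs)" if "colored us" for us
      using \<open>p \<in> {3..m}\<close> by (intro fps_good_EV[OF assms(1) that assms(3)]) auto
    thus ?thesis unfolding multi_EV_def using assms(2) others[OF assms(2)]
      by (intro fps_good_nth[OF _ order_refl] fps_good_sum fps_good_mult fps_good_const) auto
  qed
  thus ?thesis unfolding rest_def fps_nth_Abs_fps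
    by (intro eps_poly_sum eps_poly_mult eps_poly_power eps_poly_eps) auto
qed

lemma sum_list_remove_at:
  "i < length xs \<Longrightarrow> sum_list (map f xs) = f (xs ! i) + (sum_list (map f (remove_at i xs)) :: nat)"
  unfolding remove_at_def by (subst id_take_nth_drop[of i xs]) (auto simp del: append_take_drop_id)

text \<open>Induction on the order in \<open>\<alpha>\<close>, then on the total degree: in \<open>scaled_loop\<close> every term on the
  right has lower order or lower degree.\<close>

lemma EV_eps_poly:
  "colored xs \<Longrightarrow> eps_poly (\<lambda>N. fps_nth (EV N [] xs) m)"
proof (induction m arbitrary: xs rule: less_induct)
  case (less m)
  note IHm = less.IH
  have good: "fps_good j (\<lambda>N. EV N [] ys)" if "j < m" "colored ys" for j ys
    using that IHm by (auto simp: fps_good_def)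
  show ?case using less.prems
  proof (induction "sum_list (map snd xs)" arbitrary: xs rule: less_induct)
    case less
    have IHd: "fps_good m (\<lambda>N. EV N [] ys)"
      if "colored ys" "sum_list (map snd ys) < sum_list (map snd xs)" for ys
      unfolding fps_good_def
    proof (intro allI impI)
      fix j assume "j \<le> m"
      thus "eps_poly (\<lambda>N. fps_nth (EV N [] ys) j)"
        using less.hyps[OF that(2,1)] IHm[OF _ that(1)] by (cases "j = m") auto
    qed
    consider "xs = []" | c ys where "xs = (c, 0) # ys" | c k ys where "xs = (c, Suc k) # ys"
    proof (cases xs)
      case (Cons x ys)
      obtain c a where "x = (c, a)" by (cases x)
      thus ?thesis using that Cons by (cases a) auto
    qed (use that in auto)
    thus ?case
    proof cases
      case 1
      have "eps_poly (\<lambda>N. fps_nth 1 m)" by (rule eps_poly_const)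
      thus ?thesis by (subst eps_poly_cong[of _ "\<lambda>N. fps_nth 1 m"]) (simp_all add: 1 EV_Nil)
    next
      case 2
      have "eps_poly (\<lambda>N. 0)" by (rule eps_poly_const)
      thus ?thesis by (subst eps_poly_cong[of _ "\<lambda>N. 0"]) (simp_all add: 2 EV_zero[of _ c])
    next
      case (3 c k ys)
      have c: "c \<in> {1..3}" and ys: "colored ys" using less.prems 3 by auto
      have o: "other1 c \<in> {1..3}" "other2 c \<in> {1..3}" using others[OF c] by auto
      \<comment> \<open>\<open>T\<close> keeps the order in \<alpha> but has lower degree than
        \<open>xs\<close>. The terms collected in \<open>U\<close> below may have the same degree,
        but they are multiplied by \<open>fps_X ^ 2\<close>.\<close>
      define T where "T N = (\<Sum>l<k. sc_moment l * EV N [] ((c, k - 1 - l) # ys) + sc_moment (k - 1 - l) * EV N [] ((c, l) # ys) +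
         fps_const (eps N) * EV N [] ((c, k - 1 - l) # (c, l) # ys)) + 
        fps_const (eps N) * (fps_const (eps N) * (\<Sum>i<length ys. if fst (ys ! i) = c
        then of_nat (snd (ys ! i)) * EV N [(c, k + snd (ys ! i) - 1)] (remove_at i ys) else 0))" for N
      define U where "U N = sc_moment k * (EV N [] ((other1 c, 1) # ys) + EV N [] ((other2 c, 1) # ys)) +
        fps_const (eps N) * (EV N [] ((other1 c, 1) # (c, k) # ys) + EV N [] ((other2 c, 1) # (c, k) # ys))" for N
      have D: "fps_good m (\<lambda>N. if fst (ys ! i) = c
        then of_nat (snd (ys ! i)) * EV N [(c, k + snd (ys ! i) - 1)] (remove_at i ys) else 0)" if i: "i < length ys" for i
      \<comment> \<open>For a contact with a factor of positive degree, two powers are lost and the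
        degree drops; a factor of degree zero has coefficient zero.\<close>
      proof (cases "fst (ys ! i) = c \<and> snd (ys ! i) > 0")
        case True
        have deg: "sum_list (map snd xs) = Suc k + snd (ys ! i) + sum_list (map snd (remove_at i ys))"
          using sum_list_remove_at[OF i, of snd] 3 by simp
        have "fps_good m (\<lambda>N. sc_moment (k + snd (ys ! i) - 1) * EV N [] (remove_at i ys) +
            fps_const (eps N) * EV N [] ((c, k + snd (ys ! i) - 1) # remove_at i ys))"
          using True c colored_remove_at[OF ys]
          by (intro fps_good_add fps_good_mult fps_good_const fps_good_eps IHd) (auto simp: deg)
        hence "fps_good m (\<lambda>N. EV N [(c, k + snd (ys ! i) - 1)] (remove_at i ys))"
          using c colored_remove_at[OF ys] by (subst fps_good_cong[OF EV_Cons[of _ c "[]" "remove_at i ys"]]) auto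
        thus ?thesis using True by (simp add: fps_good_mult fps_good_const)
      next
        case False
        hence "(\<lambda>N. if fst (ys ! i) = c
        then of_nat (snd (ys ! i)) * EV N [(c, k + snd (ys ! i) - 1)] (remove_at i ys) else 0) = (\<lambda>N. 0)"
          by auto
        thus ?thesis using fps_good_const[of m 0] by simp
      qed
      have "fps_good m T" unfolding T_def[abs_def] using c ys
        by (intro fps_good_add fps_good_sum fps_good_mult fps_good_const fps_good_eps D IHd) (auto simp: 3)
      hence T: "eps_poly (\<lambda>N. fps_nth (T N) m)" by (simp add: fps_good_def)
      have U: "eps_poly (\<lambda>N. if m < 2 then 0 else fps_nth (EV N [] xs) (m - 2) + fps_nth (U N) (m - 2))"
      proof (cases "m < 2")
        case False
        have "fps_good (m - 2) (\<lambda>N. EV N [] xs + U N)" unfolding U_def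
          using c o ys False less.prems
          by (intro fps_good_add fps_good_mult fps_good_const fps_good_eps good) auto
        thus ?thesis using False by (simp add: fps_good_def)
      qed (simp add: eps_poly_const)
      have "fps_nth (EV N [] xs) m = fps_nth (T N) m +
          (if m < 2 then 0 else fps_nth (EV N [] xs) (m - 2) + fps_nth (U N) (m - 2)) +
          fps_nth (rest N c k ys) m" if N: "N > 0" for N
      proof -
        \<comment> \<open>Instead of inverting \<open>1 - fps_X ^ 2\<close>, its quadratic part is
          moved to the right, where it refers to the order \<open>m - 2\<close>.\<close>
        have "EV N [] xs = fps_X ^ 2 * EV N [] xs + (1 - fps_X ^ 2) * EV N [] xs"
          by (simp add: algebra_simps)
        also have "(1 - fps_X ^ 2) * EV N [] xs = T N + fps_X ^ 2 * U N + rest N c k ys"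
          unfolding 3 scaled_loop[OF N c ys] T_def U_def ..
        finally have "fps_nth (EV N [] xs) m =
            fps_nth (fps_X ^ 2 * EV N [] xs + (T N + fps_X ^ 2 * U N + rest N c k ys)) m"
          by (rule arg_cong)
        thus ?thesis by (simp add: fps_X_power_mult_nth)
      qed
      hence "eps_poly (\<lambda>N. fps_nth (EV N [] xs) m) \<longleftrightarrow> eps_poly (\<lambda>N. fps_nth (T N) m +
          (if m < 2 then 0 else fps_nth (EV N [] xs) (m - 2) + fps_nth (U N) (m - 2)) +
          fps_nth (rest N c k ys) m)"
        by (rule eps_poly_cong)
      thus ?thesis
        using eps_poly_add[OF eps_poly_add[OF T U] fps_good_rest_nth[OF good c ys]] by simp
    qed
  qed
qed

section \<open>The large-N limit\<close>

text \<open>For coefficients polynomial in \<open>eps N\<close> this limit is the value at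
  \<open>eps N = 0\<close>. Limits are compatible with sums and products and unique, so the
  polynomials themselves need not be carried through the equations.\<close>

definition flim :: "(nat \<Rightarrow> complex fps) \<Rightarrow> complex fps \<Rightarrow> bool" where
  "flim X Z \<longleftrightarrow> (\<forall>m. (\<lambda>N. fps_nth (X N) m) \<longlonglongrightarrow> fps_nth Z m)"

lemma flim_unique: "flim X Y \<Longrightarrow> flim X Z \<Longrightarrow> Y = Z"
proof (rule fps_ext)
  fix m assume "flim X Y" "flim X Z"
  thus "fps_nth Y m = fps_nth Z m"
    by (intro LIMSEQ_unique[of "\<lambda>N. fps_nth (X N) m"]) (simp_all add: flim_def)
qed

lemma flim_const: "flim (\<lambda>N. a) a"
  by (simp add: flim_def)

lemma flim_add: "flim X Y \<Longrightarrow> flim X' Y' \<Longrightarrow> flim (\<lambda>N. X N + X' N) (Y + Y')"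
  unfolding flim_def fps_add_nth by (intro allI tendsto_add) auto

lemma flim_mult: "flim X Y \<Longrightarrow> flim X' Y' \<Longrightarrow> flim (\<lambda>N. X N * X' N) (Y * Y')"
  unfolding flim_def fps_mult_nth by (intro allI tendsto_sum tendsto_mult) auto

lemma flim_sum:
  "(\<And>a. a \<in> A \<Longrightarrow> flim (X a) (Y a)) \<Longrightarrow> flim (\<lambda>N. \<Sum>a\<in>A. X a N) (\<Sum>a\<in>A. Y a)"
  unfolding flim_def fps_sum_nth by (intro allI tendsto_sum) auto

lemma flim_cong: "(\<And>N. N > 0 \<Longrightarrow> X N = Y N) \<Longrightarrow> flim X Z \<longleftrightarrow> flim Y Z"
proof -
  assume "\<And>N. N > 0 \<Longrightarrow> X N = Y N"
  hence ev: "\<forall>\<^sub>F N in sequentially. fps_nth (X N) m = fps_nth (Y N) m" for m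
    by (intro eventually_mono[OF eventually_gt_at_top[of 0]]) auto
  show ?thesis unfolding flim_def by (simp only: tendsto_cong[OF ev])
qed

lemma eps_tendsto_0: "eps \<longlonglongrightarrow> 0"
proof -
  have "(\<lambda>N. sqrt (1 / real N)) \<longlonglongrightarrow> sqrt 0"
    by (intro tendsto_real_sqrt lim_1_over_n)
  hence "(\<lambda>N. 1 / sqrt (real N)) \<longlonglongrightarrow> 0" by (simp add: real_sqrt_divide)
  from tendsto_of_real[OF this] show ?thesis unfolding eps_def[abs_def] by (simp only: of_real_0)
qed

lemma flim_eps: "flim (\<lambda>N. fps_const (eps N)) 0"
  unfolding flim_def
proof
  fix m show "(\<lambda>N. fps_nth (fps_const (eps N)) m) \<longlonglongrightarrow> fps_nth 0 m"
    using eps_tendsto_0 by (cases "m = 0") auto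
qed

lemma eps_poly_tendsto:
  assumes "\<And>N. N > 0 \<Longrightarrow> f N = poly P (eps N)"
  shows "f \<longlonglongrightarrow> poly P 0"
proof -
  have "(\<lambda>N. poly P (eps N)) \<longlonglongrightarrow> poly P 0"
    by (rule isCont_tendsto_compose[OF poly_isCont eps_tendsto_0])
  moreover have ev: "\<forall>\<^sub>F N in sequentially. f N = poly P (eps N)"
    using eventually_gt_at_top[of 0] by eventually_elim (rule assms)
  ultimately show ?thesis by (simp only: tendsto_cong[OF ev])
qed

lemma EV_flim_exists:
  assumes "colored us" "colored xs" shows "\<exists>Z. flim (\<lambda>N. EV N us xs) Z"
proof -
  have ep: "eps_poly (\<lambda>N. fps_nth (EV N us xs) m)" for m
    using fps_good_EV[OF _ assms, of m] EV_eps_poly by (simp add: fps_good_def)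
  have "\<exists>z. (\<lambda>N. fps_nth (EV N us xs) m) \<longlonglongrightarrow> z" for m
  proof -
    obtain P where "\<And>N. N > 0 \<Longrightarrow> fps_nth (EV N us xs) m = poly P (eps N)"
      using ep[of m] unfolding eps_poly_def by auto
    from eps_poly_tendsto[OF this] show ?thesis by blast
  qed
  then obtain z where "\<And>m. (\<lambda>N. fps_nth (EV N us xs) m) \<longlonglongrightarrow> z m" by metis
  thus ?thesis unfolding flim_def by (intro exI[of _ "Abs_fps z"]) simp
qed

lemma flim_eps_EV:
  assumes "colored us" "colored xs"
  shows "flim (\<lambda>N. fps_const (eps N) * EV N us xs) 0"
proof -
  obtain Z where "flim (\<lambda>N. EV N us xs) Z" using EV_flim_exists[OF assms] by blast
  from flim_mult[OF flim_eps this] show ?thesis by simp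
qed

text \<open>Large-N factorisation: each fluctuation comes with a factor \<open>eps N\<close> while
  its expectation converges, so only the means survive.\<close>

lemma flim_EV: "colored us \<Longrightarrow> flim (\<lambda>N. EV N us []) (\<Prod>(c, a)\<leftarrow>us. sc_moment a)"
proof (induction us)
  case Nil
  have "flim (\<lambda>N. 1) 1" by (rule flim_const)
  thus ?case by (subst flim_cong[OF EV_Nil]) auto
next
  case (Cons u us)
  obtain c a where u: "u = (c, a)" by (cases u)
  have "flim (\<lambda>N. sc_moment a * EV N us [] + fps_const (eps N) * EV N us [(c, a)])
      (sc_moment a * (\<Prod>(c, a)\<leftarrow>us. sc_moment a) + 0)"
    using Cons u by (intro flim_add flim_mult flim_const flim_eps_EV) auto
  thus ?case using Cons.prems u by (subst flim_cong[OF EV_Cons[of _ c us "[]" a, folded u]]) auto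
qed

text \<open>In the limit \<open>eps N ^ (p - 3)\<close> keeps only \<open>p = 3\<close>, with 0 ^ 0
  = 1. The cubic vertex distributes two factors over the colours; placing them in different colours
  involves a first moment, which vanishes, so only three placements remain.\<close>

lemma flim_rest:
  assumes c: "c \<in> {1..3}"
  shows "flim (\<lambda>N. rest N c k []) (fps_X ^ 3 * (sc_moment (k + 2) + 2 * sc_moment k * sc_moment 2))"
proof -
  define L where "L p = (\<Sum>i\<le>p - 1. \<Sum>l\<le>i. of_nat (((p - 1) choose i) * (i choose l)) *
     (sc_moment (k + l) * (sc_moment (i - l) * sc_moment (p - 1 - i))))" for p
  have L3: "L 3 = sc_moment (k + 2) + 2 * sc_moment k * sc_moment 2"
    by (simp add: L_def numeral_2_eq_2 numeral_3_eq_3 sc_moment_1 algebra_simps)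
  have "flim (\<lambda>N. EV N [(c, k + l), (other1 c, i - l), (other2 c, p - 1 - i)] [])
     (sc_moment (k + l) * (sc_moment (i - l) * sc_moment (p - 1 - i)))" for p i l
    using flim_EV[of "[(c, k + l), (other1 c, i - l), (other2 c, p - 1 - i)]"] c others[OF c] by simp
  hence "flim (\<lambda>N. multi_EV N c k [] p) (L p)" for p
    unfolding multi_EV_def L_def by (intro flim_sum flim_mult flim_const)
  hence lim: "(\<lambda>N. fps_nth (multi_EV N c k [] p) j) \<longlonglongrightarrow> fps_nth (L p) j" for p j
    by (simp add: flim_def)
  show ?thesis unfolding flim_def
  proof
    fix m
    have "(\<lambda>N. \<Sum>p\<in>{3..m}. eps N ^ (p - 3) * fps_nth (multi_EV N c k [] p) (m - p)) \<longlonglongrightarrow>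
        (\<Sum>p\<in>{3..m}. 0 ^ (p - 3) * fps_nth (L p) (m - p))"
      by (intro tendsto_sum tendsto_mult tendsto_power eps_tendsto_0 lim)
    also have "(\<Sum>p\<in>{3..m}. 0 ^ (p - 3) * fps_nth (L p) (m - p)) =
        (\<Sum>p\<in>{3..m}. if p = 3 then fps_nth (L 3) (m - 3) else 0)"
      by (intro sum.cong) auto
    also have "\<dots> = fps_nth (fps_X ^ 3 * L 3) m"
      by (simp add: fps_X_power_mult_nth)
    finally show "(\<lambda>N. fps_nth (rest N c k []) m) \<longlonglongrightarrow>
        fps_nth (fps_X ^ 3 * (sc_moment (k + 2) + 2 * sc_moment k * sc_moment 2)) m"
      by (simp only: L3 rest_def fps_nth_Abs_fps)
  qed
qed

text \<open>These limits are the coefficients of N^(1/2) in the expected traces, because a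
  fluctuation enters a trace with the factor \<open>N * eps N\<close>.\<close>

definition half_moment :: "nat \<Rightarrow> nat \<Rightarrow> complex fps" where
  "half_moment c k = (SOME Z. flim (\<lambda>N. EV N [] [(c, k)]) Z)"

lemma flim_half_moment: "c \<in> {1..3} \<Longrightarrow> flim (\<lambda>N. EV N [] [(c, k)]) (half_moment c k)"
  unfolding half_moment_def by (rule someI_ex, rule EV_flim_exists) auto

lemma half_moment_0: "c \<in> {1..3} \<Longrightarrow> half_moment c 0 = 0"
proof (rule flim_unique[OF flim_half_moment])
  have "flim (\<lambda>N. 0) 0" by (rule flim_const)
  thus "flim (\<lambda>N. EV N [] [(c, 0)]) 0" by (subst flim_cong[OF EV_zero[of _ c]]) auto
qed auto

text \<open>Limit of \<open>scaled_loop\<close> with no further fluctuations: the contact sum is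
  empty, and products of two fluctuations carry \<open>eps N\<close> and disappear.\<close>

lemma half_moment_rec_color:
  assumes c: "c \<in> {1..3}"
  shows "(1 - fps_X ^ 2) * half_moment c (Suc k) =
    (\<Sum>l<k. sc_moment l * half_moment c (k - 1 - l) + sc_moment (k - 1 - l) * half_moment c l) +
    fps_X ^ 2 * (sc_moment k * (half_moment (other1 c) 1 + half_moment (other2 c) 1)) +
    fps_X ^ 3 * (sc_moment (k + 2) + 2 * sc_moment k * sc_moment 2)"
proof -
  have o: "other1 c \<in> {1..3}" "other2 c \<in> {1..3}" using others[OF c] by auto
  have 1: "flim (\<lambda>N. (1 - fps_X ^ 2) * EV N [] [(c, Suc k)]) ((1 - fps_X ^ 2) * half_moment c (Suc k))"
    by (intro flim_mult flim_const flim_half_moment c)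
  have "flim (\<lambda>N. (\<Sum>l<k. sc_moment l * EV N [] [(c, k - 1 - l)] + sc_moment (k - 1 - l) * EV N [] [(c, l)] +
       fps_const (eps N) * EV N [] [(c, k - 1 - l), (c, l)]) +
    fps_X ^ 2 * (sc_moment k * (EV N [] [(other1 c, 1)] + EV N [] [(other2 c, 1)]) +
      (fps_const (eps N) * EV N [] [(other1 c, 1), (c, k)] + fps_const (eps N) * EV N [] [(other2 c, 1), (c, k)])) +
    rest N c k [])
   ((\<Sum>l<k. sc_moment l * half_moment c (k - 1 - l) + sc_moment (k - 1 - l) * half_moment c l + 0) +
    fps_X ^ 2 * (sc_moment k * (half_moment (other1 c) 1 + half_moment (other2 c) 1) + (0 + 0)) +
    fps_X ^ 3 * (sc_moment (k + 2) + 2 * sc_moment k * sc_moment 2))"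
    using c o by (intro flim_add flim_sum flim_mult flim_const flim_half_moment flim_eps_EV flim_rest) auto
  hence 2: "flim (\<lambda>N. (1 - fps_X ^ 2) * EV N [] [(c, Suc k)])
   ((\<Sum>l<k. sc_moment l * half_moment c (k - 1 - l) + sc_moment (k - 1 - l) * half_moment c l + 0) +
    fps_X ^ 2 * (sc_moment k * (half_moment (other1 c) 1 + half_moment (other2 c) 1) + (0 + 0)) +
    fps_X ^ 3 * (sc_moment (k + 2) + 2 * sc_moment k * sc_moment 2))"
    using c by (subst flim_cong[OF scaled_loop]) (auto simp: distrib_left)
  show ?thesis using flim_unique[OF 1 2] by simp
qed

text \<open>The three first moments solve a colour-symmetric linear system. Differences of two
  equations have the coefficient 1, which forces equality; then both foreign colours contribute the
  same unknown, and 1 - \<alpha>^2 - 2 \<alpha>^2 remains.\<close>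

lemma half_moment_1:
  shows "half_moment 2 1 = half_moment 1 1" "half_moment 3 1 = half_moment 1 1"
    "(1 - 3 * fps_X ^ 2) * half_moment 1 1 = 3 * fps_X ^ 3 * variance_fps"
proof -
  define K :: "complex fps" where "K = 3 * fps_X ^ 3 * variance_fps"
  have m2: "sc_moment (Suc (Suc 0)) = variance_fps" using sc_moment_2 by (simp add: numeral_2_eq_2)
  have eq: "(1 - fps_X ^ 2) * half_moment c 1 = fps_X ^ 2 * (half_moment (other1 c) 1 + half_moment (other2 c) 1) + K"
    if "c \<in> {1..3}" for c
    using half_moment_rec_color[OF that, of 0] by (simp add: K_def sc_moment_2 m2 algebra_simps)
  have e1: "(1 - fps_X ^ 2) * half_moment 1 1 = fps_X ^ 2 * (half_moment 2 1 + half_moment 3 1) + K"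
    and e2: "(1 - fps_X ^ 2) * half_moment 2 1 = fps_X ^ 2 * (half_moment 1 1 + half_moment 3 1) + K"
    and e3: "(1 - fps_X ^ 2) * half_moment 3 1 = fps_X ^ 2 * (half_moment 1 1 + half_moment 2 1) + K"
    using eq[of 1] eq[of 2] eq[of 3] by (simp_all add: other1_def other2_def)
  show 2: "half_moment 2 1 = half_moment 1 1" using e1 e2 by (simp add: algebra_simps)
  show 3: "half_moment 3 1 = half_moment 1 1" using e1 e3 by (simp add: algebra_simps)
  show "(1 - 3 * fps_X ^ 2) * half_moment 1 1 = 3 * fps_X ^ 3 * variance_fps"
    using e1 unfolding 2 3 K_def by (simp add: algebra_simps)
qed

lemma half_moment_rec:
  "(1 - fps_X ^ 2) * half_moment 1 (Suc k) =
    2 * (\<Sum>l<k. sc_moment l * half_moment 1 (k - 1 - l)) +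
    2 * fps_X ^ 2 * half_moment 1 1 * sc_moment k +
    fps_X ^ 3 * (sc_moment (k + 2) + 2 * variance_fps * sc_moment k)"
proof -
  \<comment> \<open>Reversing the summation identifies the two convolutions, hence the factor 2 in
    the claim.\<close>
  have "(\<Sum>l<k. sc_moment (k - 1 - l) * half_moment 1 l) =
      (\<Sum>l<k. sc_moment (k - 1 - (k - Suc l)) * half_moment 1 (k - Suc l))"
    by (rule sum.nat_diff_reindex[symmetric])
  also have "\<dots> = (\<Sum>l<k. sc_moment l * half_moment 1 (k - 1 - l))"
    by (intro sum.cong) auto
  finally have "(\<Sum>l<k. sc_moment (k - 1 - l) * half_moment 1 l) = \<dots>" .
  moreover have "other1 1 = 2" "other2 1 = 3" by (simp_all add: other1_def other2_def)
  ultimately show ?thesis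
    using half_moment_rec_color[of 1 k] half_moment_1(1,2)
    by (simp add: sum.distrib sc_moment_2 algebra_simps)
qed

section \<open>The coefficients of N and N^(1/2) in the moments\<close>

lemma moment_expansion:
  assumes N: "N > 0"
  shows "moment N k = fps_const (of_nat N) * sc_moment k + fps_const (of_nat N * eps N) * EV N [] [(1, k)]"
proof -
  have "(\<lambda>y. fps_const (tr_pow N 1 k y)) = (\<lambda>y. fps_const (of_nat N) * (uprod N [(1, k)] y * sprod N [] y))"
    using N by (simp add: uprod_simps sprod_simps ntr_def)
  hence "moment N k = fps_const (of_nat N) * EV N [(1, k)] []"
    unfolding moment_eq_ev[OF N] EV_def using N
    by (simp only:) (intro ev_cmult pfps_mult pfps_uprod pfps_sprod; simp)
  thus ?thesis using N by (simp add: EV_Cons EV_Nil algebra_simps flip: fps_const_mult del: fps_const_mult)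
qed

lemma moment_laurent:
  obtains L where "laurent_sqrtN (\<lambda>N. fps_nth (moment N k) m) L" "\<forall>j>2. L j = 0"
    "L 2 = fps_nth (sc_moment k) m" "L 1 = fps_nth (half_moment 1 k) m"
proof -
  obtain P where P: "\<And>N. N > 0 \<Longrightarrow> fps_nth (EV N [] [(1, k)]) m = poly P (eps N)"
    using EV_eps_poly[of "[(1, k)]" m] unfolding eps_poly_def by auto
  have "(\<lambda>N. fps_nth (EV N [] [(1, k)]) m) \<longlonglongrightarrow> fps_nth (half_moment 1 k) m"
    using flim_half_moment[of 1 k] by (simp add: flim_def)
  hence P0: "poly P 0 = fps_nth (half_moment 1 k) m"
    using eps_poly_tendsto[OF P] LIMSEQ_unique by blast
  \<comment> \<open>Exponents count powers of N^(1/2). The mean has exponent 2; the term of degree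
    \<open>i\<close> in \<open>P\<close> is multiplied by \<open>N * eps N\<close> and so has
    exponent \<open>1 - i\<close>.\<close>
  define L where "L j = (if j = 2 then fps_nth (sc_moment k) m
    else if j \<le> 1 then coeff P (nat (1 - j)) else 0)" for j :: int
  define A where "A = (\<lambda>i. 1 - int i) ` {..degree P}"
  have sub: "{j. L j \<noteq> 0} \<subseteq> insert 2 A"
  proof
    fix j assume j: "j \<in> {j. L j \<noteq> 0}"
    show "j \<in> insert 2 A"
    proof (cases "j = 2")
      case False
      hence "j \<le> 1" "nat (1 - j) \<le> degree P" using j by (auto simp: L_def le_degree split: if_splits)
      thus ?thesis unfolding A_def by (intro insertI2 image_eqI[of _ _ "nat (1 - j)"]) auto
    qed simp
  qed
  have fin: "finite (insert 2 A)" by (simp add: A_def)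
  have "laurent_sqrtN (\<lambda>N. fps_nth (moment N k) m) L"
    unfolding laurent_sqrtN_def
  proof (intro conjI allI impI)
    show "finite {j. L j \<noteq> 0}" using sub fin by (rule finite_subset)
    fix N :: nat assume "N \<ge> 1"
    hence N: "N > 0" by simp
    define w where "w = complex_of_real (sqrt (real N))"
    have w: "w \<noteq> 0" "of_nat N = w ^ 2" "eps N = inverse w"
      using N by (simp_all add: w_def eps_def inverse_eq_divide flip: of_real_power)
    have "(\<Sum>j | L j \<noteq> 0. L j * w powi j) = (\<Sum>j\<in>insert 2 A. L j * w powi j)"
      using sub fin by (intro sum.mono_neutral_left) auto
    also have "\<dots> = L 2 * w powi 2 + (\<Sum>j\<in>A. L j * w powi j)"
      by (subst sum.insert) (auto simp: A_def)
    also have "(\<Sum>j\<in>A. L j * w powi j) = (\<Sum>i\<le>degree P. L (1 - int i) * w powi (1 - int i))"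
      unfolding A_def by (subst sum.reindex) (auto simp: inj_on_def)
    also have "\<dots> = (\<Sum>i\<le>degree P. w * (coeff P i * eps N ^ i))"
    proof (intro sum.cong refl)
      fix i
      have "w powi (1 - int i) = w * eps N ^ i"
        using w by (simp add: power_int_diff power_inverse divide_inverse)
      thus "L (1 - int i) * w powi (1 - int i) = w * (coeff P i * eps N ^ i)"
        by (simp add: L_def)
    qed
    also have "\<dots> = w * poly P (eps N)"
      by (simp add: poly_altdef sum_distrib_left)
    also have "L 2 * w powi 2 + w * poly P (eps N) = fps_nth (moment N k) m"
    proof -
      have "of_nat N * eps N = w" using w by (simp add: power2_eq_square)
      thus ?thesis unfolding moment_expansion[OF N]
        by (simp add: P[OF N] L_def w(2)[symmetric] del: One_nat_def)
    qed
    finally show "fps_nth (moment N k) m = (\<Sum>j | L j \<noteq> 0. L j * complex_of_real (sqrt (real N)) powi j)"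
      by (simp add: w_def)
  qed
  thus ?thesis using P0 by (intro that[of L]) (auto simp: L_def poly_0_coeff_0)
qed

lemma sqrtN_coeff_moment:
  "sqrtN_coeff (\<lambda>N. fps_nth (moment N k) m) 2 = fps_nth (sc_moment k) m"
  "sqrtN_coeff (\<lambda>N. fps_nth (moment N k) m) 1 = fps_nth (half_moment 1 k) m"
proof -
  obtain L where L: "laurent_sqrtN (\<lambda>N. fps_nth (moment N k) m) L"
    "L 2 = fps_nth (sc_moment k) m" "L 1 = fps_nth (half_moment 1 k) m"
    by (rule moment_laurent)
  have "sqrtN_coeff (\<lambda>N. fps_nth (moment N k) m) = L"
    unfolding sqrtN_coeff_def 
    by (rule the_equality[of "laurent_sqrtN (\<lambda>N. fps_nth (moment N k) m)", OF L(1)])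
      (rule laurent_sqrtN_unique[OF _ L(1)])
  thus "sqrtN_coeff (\<lambda>N. fps_nth (moment N k) m) 2 = fps_nth (sc_moment k) m"
    "sqrtN_coeff (\<lambda>N. fps_nth (moment N k) m) 1 = fps_nth (half_moment 1 k) m"
    using L by auto
qed

section \<open>Generating functions\<close>

text \<open>The generating function \<open>\<Sum>k. a k / x ^ (k + 1)\<close>, as a power series in \<open>1 / x\<close>.\<close>

definition stieltjes :: "(nat \<Rightarrow> complex fps) \<Rightarrow> complex fls fps" where
  "stieltjes a = Abs_fps (\<lambda>n. case n of 0 \<Rightarrow> 0 | Suc k \<Rightarrow> fps_to_fls (a k))"

lemma stieltjes_nth [simp]:
  "fps_nth (stieltjes a) 0 = 0" "fps_nth (stieltjes a) (Suc k) = fps_to_fls (a k)"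
  by (simp_all add: stieltjes_def)

lemma W0_eq: "W0 = fps_to_fls (stieltjes sc_moment)"
  unfolding W0_def W_coeff_def stieltjes_def sqrtN_coeff_moment by (simp add: fps_nth_inverse)

lemma Whalf_eq: "Whalf = fps_to_fls (stieltjes (half_moment 1))"
  unfolding Whalf_def W_coeff_def stieltjes_def sqrtN_coeff_moment by (simp add: fps_nth_inverse)

lemma fps_to_fls_sum: "fps_to_fls (\<Sum>a\<in>A. f a) = (\<Sum>a\<in>A. fps_to_fls (f a))"
  by (induction A rule: infinite_finite_induct) auto

lemma stieltjes_mult:
  "fps_nth (stieltjes a * stieltjes b) 0 = 0"
  "fps_nth (stieltjes a * stieltjes b) (Suc k) = fps_to_fls (\<Sum>l<k. a l * b (k - 1 - l))"
proof -
  show "fps_nth (stieltjes a * stieltjes b) 0 = 0" by simp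
  have "fps_nth (stieltjes a * stieltjes b) (Suc k) =
      (\<Sum>i\<le>k. fps_nth (stieltjes a) (Suc i) * fps_nth (stieltjes b) (k - i))"
    unfolding fps_mult_nth atLeast0AtMost by (subst sum.atMost_Suc_shift) simp
  also have "\<dots> = (\<Sum>i<k. fps_nth (stieltjes a) (Suc i) * fps_nth (stieltjes b) (k - i))"
    by (simp add: lessThan_Suc_atMost[symmetric])
  also have "\<dots> = (\<Sum>l<k. fps_to_fls (a l * b (k - 1 - l)))"
  proof (intro sum.cong refl)
    fix l assume "l \<in> {..<k}"
    hence "k - l = Suc (k - 1 - l)" by auto
    thus "fps_nth (stieltjes a) (Suc l) * fps_nth (stieltjes b) (k - l) = fps_to_fls (a l * b (k - 1 - l))"
      by (simp add: fls_times_fps_to_fls)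
  qed
  finally show "fps_nth (stieltjes a * stieltjes b) (Suc k) = fps_to_fls (\<Sum>l<k. a l * b (k - 1 - l))"
    by (simp add: fps_to_fls_sum)
qed

text \<open>\<open>lift_const\<close> and \<open>emb\<close> embed the same scalars, before and
  after the passage from power series to Laurent series in 1/x.\<close>

definition lift_const :: "complex fps \<Rightarrow> complex fls fps" where "lift_const a = fps_const (fps_to_fls a)"

definition emb :: "complex fps \<Rightarrow> complex fls fls" where "emb a = fls_const (fps_to_fls a)"

text \<open>The semicircle recursion, with \<open>fps_X\<close> in the role of 1/x. The equation is
  multiplied by 1/x so that both sides are power series, and subtracting \<open>fps_X\<close>
  removes the moment of order zero.\<close>

lemma planar_equation:
  "lift_const (1 - fps_X ^ 2) * (stieltjes sc_moment - fps_X) = fps_X * stieltjes sc_moment ^ 2"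
proof (rule fps_ext)
  fix n :: nat
  consider "n = 0" | "n = Suc 0" | k where "n = Suc (Suc k)" by (metis not0_implies_Suc)
  thus "fps_nth (lift_const (1 - fps_X ^ 2) * (stieltjes sc_moment - fps_X)) n =
      fps_nth (fps_X * stieltjes sc_moment ^ 2) n"
  proof cases
    case (3 k)
    have "fps_nth (lift_const (1 - fps_X ^ 2) * (stieltjes sc_moment - fps_X)) n =
        fps_to_fls ((1 - fps_X ^ 2) * sc_moment (Suc k))"
      by (simp add: lift_const_def 3 right_diff_distrib fls_times_fps_to_fls)
    moreover have "fps_nth (fps_X * stieltjes sc_moment ^ 2) n =
        fps_to_fls (\<Sum>l<k. sc_moment l * sc_moment (k - 1 - l))"
      by (simp add: 3 power2_eq_square stieltjes_mult(2))
    ultimately show ?thesis by (simp only: sc_moment_rec)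
  qed (simp_all add: power2_eq_square lift_const_def)
qed

text \<open>Multiplied by 1/x^2 to stay among power series: the coefficient of index
  \<open>k + 3\<close> is \<open>half_moment_rec\<close>. The lower coefficients vanish because
  \<open>half_moment 1 0\<close> and the first semicircle moment are zero.\<close>

lemma half_equation:
  "lift_const (1 - fps_X ^ 2) * (fps_X * stieltjes (half_moment 1)) =
    2 * (fps_X ^ 2 * (stieltjes sc_moment * stieltjes (half_moment 1))) +
    lift_const (2 * fps_X ^ 2 * half_moment 1 1) * (fps_X ^ 2 * stieltjes sc_moment) +
    lift_const (fps_X ^ 3) * (stieltjes sc_moment - fps_X) +
    lift_const (fps_X ^ 3 * (2 * variance_fps)) * (fps_X ^ 2 * stieltjes sc_moment)"
  (is "?L = ?R")
proof (rule fps_ext)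
  fix n :: nat
  have X2: "fps_nth (fps_X ^ 2 * F) (Suc (Suc m)) = fps_nth F m"
    "fps_nth (fps_X ^ 2 * F) 0 = 0" "fps_nth (fps_X ^ 2 * F) (Suc 0) = 0"
    for F :: "complex fls fps" and m
    by (simp_all add: fps_X_power_mult_nth)
  have two: "fps_nth (2 * F) m = 2 * fps_nth F m" for F :: "complex fls fps" and m
    by (simp add: fps_numeral_fps_const)
  have two': "2 * fps_to_fls F = fps_to_fls (2 * F)" for F :: "complex fps"
    by (simp add: fls_times_fps_to_fls)
  consider "n = 0" | "n = Suc 0" | "n = Suc (Suc 0)" | k where "n = Suc (Suc (Suc k))"
    by (metis not0_implies_Suc)
  thus "fps_nth ?L n = fps_nth ?R n"
  proof cases
    case 1
    thus ?thesis by (simp add: lift_const_def X2 two)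
  next
    case 2
    thus ?thesis by (simp add: lift_const_def X2 two)
  next
    case 3
    thus ?thesis by (simp add: lift_const_def X2 two sc_moment_1 half_moment_0)
  next
    case (4 k)
    have "fps_nth ?L n = fps_to_fls ((1 - fps_X ^ 2) * half_moment 1 (Suc k))"
      by (simp add: lift_const_def 4 fls_times_fps_to_fls)
    also have "\<dots> = fps_to_fls (2 * (\<Sum>l<k. sc_moment l * half_moment 1 (k - 1 - l))) +
        fps_to_fls (2 * fps_X ^ 2 * half_moment 1 1 * sc_moment k) +
        fps_to_fls (fps_X ^ 3 * sc_moment (Suc (Suc k))) +
        fps_to_fls (fps_X ^ 3 * (2 * variance_fps) * sc_moment k)"
      unfolding half_moment_rec by (simp only: fps_to_fls_plus[symmetric]) (simp add: algebra_simps)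
    also have "\<dots> = fps_nth ?R n"
      unfolding 4 lift_const_def fps_add_nth two fps_mult_left_const_nth X2 stieltjes_mult(2) fps_sub_nth two'
      by (simp add: fls_times_fps_to_fls)
    finally show ?thesis .
  qed
qed

lemma fps_to_fls_lift_const: "fps_to_fls (lift_const a) = emb a"
  unfolding lift_const_def emb_def by (rule fls_eqI) (auto simp: nat_eq_iff)

lemma emb_hom:
  "emb (a + b) = emb a + emb b" "emb (a - b) = emb a - emb b" "emb (a * b) = emb a * emb b"
  "emb (a ^ n) = emb a ^ n" "emb 1 = 1" "emb (numeral k) = numeral k"
  by (simp_all add: emb_def fls_times_fps_to_fls fps_to_fls_power fls_const_power
      flip: fls_plus_const fls_minus_const)

lemma emb_X: "emb fps_X = alpha"
  by (simp add: alpha_def emb_def)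

lemma emb_nonzero: "fps_nth a 0 \<noteq> 0 \<Longrightarrow> emb a \<noteq> 0"
  by (auto simp: emb_def)

lemma alpha_nonzero: "1 - alpha ^ 2 \<noteq> 0" "1 - 3 * alpha ^ 2 \<noteq> 0"
  using emb_nonzero[of "1 - fps_X ^ 2"] emb_nonzero[of "1 - 3 * fps_X ^ 2"]
  by (simp_all add: emb_hom emb_X)

definition variance_fls :: "complex fls fls" where "variance_fls = emb variance_fps"

lemma variance_fls_eq: "variance_fls = 1 / (1 - alpha ^ 2)"
proof -
  have "(1 - alpha ^ 2) * variance_fls = 1"
    using arg_cong[OF variance_fps, of emb] by (simp add: emb_hom emb_X variance_fls_def)
  thus ?thesis using alpha_nonzero(1) by (simp add: field_simps)
qed

lemma half_moment_1_fls:
  "emb (half_moment 1 1) = 3 * alpha ^ 3 * variance_fls / (1 - 3 * alpha ^ 2)"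
proof -
  have "(1 - 3 * alpha ^ 2) * emb (half_moment 1 1) = 3 * alpha ^ 3 * variance_fls"
    using arg_cong[OF half_moment_1(3), of emb] by (simp add: emb_hom emb_X variance_fls_def)
  thus ?thesis using alpha_nonzero(2) by (simp add: field_simps)
qed

lemma x_var_inverse: "x_var * fls_X = 1"
  by (simp add: x_var_def fls_X_inv_times_conv_shift fls_X_conv_shift_1)

lemma planar_equation_x: "(1 - alpha ^ 2) * (x_var * W0 - 1) = W0 ^ 2"
proof -
  have "fps_to_fls (lift_const (1 - fps_X ^ 2) * (stieltjes sc_moment - fps_X)) =
      fps_to_fls (fps_X * stieltjes sc_moment ^ 2)" by (simp only: planar_equation)
  hence "(1 - alpha ^ 2) * (W0 - fls_X) = fls_X * W0 ^ 2"
    by (simp add: fls_times_fps_to_fls fps_to_fls_lift_const emb_hom emb_X W0_eq fps_to_fls_power)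
  hence "x_var * ((1 - alpha ^ 2) * (W0 - fls_X)) = x_var * (fls_X * W0 ^ 2)" by (rule arg_cong)
  hence "(1 - alpha ^ 2) * (x_var * W0 - x_var * fls_X) = (x_var * fls_X) * W0 ^ 2"
    by (simp only: algebra_simps)
  thus ?thesis by (simp only: x_var_inverse mult_1_left)
qed

lemma half_equation_x:
  "(1 - alpha ^ 2) * (x_var * Whalf) = 2 * W0 * Whalf +
    2 * alpha ^ 3 * variance_fls / (1 - 3 * alpha ^ 2) * W0 + alpha ^ 3 * (x_var * (x_var * W0 - 1))"
proof -
  define h where "h = emb (half_moment 1 1)"
  have 2: "fps_to_fls (2 * F) = 2 * fps_to_fls F" for F :: "complex fls fps"
    by (simp add: fls_times_fps_to_fls)
  from half_equation have "fps_to_fls (lift_const (1 - fps_X ^ 2) * (fps_X * stieltjes (half_moment 1))) =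
    fps_to_fls (2 * (fps_X ^ 2 * (stieltjes sc_moment * stieltjes (half_moment 1))) +
    lift_const (2 * fps_X ^ 2 * half_moment 1 1) * (fps_X ^ 2 * stieltjes sc_moment) +
    lift_const (fps_X ^ 3) * (stieltjes sc_moment - fps_X) +
    lift_const (fps_X ^ 3 * (2 * variance_fps)) * (fps_X ^ 2 * stieltjes sc_moment))" by (rule arg_cong)
  hence "(1 - alpha ^ 2) * (fls_X * Whalf) = 2 * (fls_X ^ 2 * (W0 * Whalf)) +
    2 * alpha ^ 2 * h * (fls_X ^ 2 * W0) + alpha ^ 3 * (W0 - fls_X) + alpha ^ 3 * (2 * variance_fls) * (fls_X ^ 2 * W0)"
    by (simp add: 2 fls_times_fps_to_fls fps_to_fls_lift_const emb_hom emb_X W0_eq Whalf_eq fps_to_fls_power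
        variance_fls_def h_def)
  hence "x_var ^ 2 * ((1 - alpha ^ 2) * (fls_X * Whalf)) = x_var ^ 2 * (2 * (fls_X ^ 2 * (W0 * Whalf)) +
    2 * alpha ^ 2 * h * (fls_X ^ 2 * W0) + alpha ^ 3 * (W0 - fls_X) + alpha ^ 3 * (2 * variance_fls) * (fls_X ^ 2 * W0))"
    by (rule arg_cong)
  hence "(1 - alpha ^ 2) * (x_var * Whalf) * (x_var * fls_X) =
      2 * W0 * Whalf * (x_var * fls_X) ^ 2 + 2 * alpha ^ 2 * h * W0 * (x_var * fls_X) ^ 2 +
      alpha ^ 3 * (x_var * (x_var * W0 - x_var * fls_X)) + alpha ^ 3 * (2 * variance_fls) * W0 * (x_var * fls_X) ^ 2"
    by (simp only: algebra_simps power2_eq_square)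
  hence "(1 - alpha ^ 2) * (x_var * Whalf) = 2 * W0 * Whalf + 2 * alpha ^ 2 * h * W0 +
      alpha ^ 3 * (x_var * (x_var * W0 - 1)) + alpha ^ 3 * (2 * variance_fls) * W0"
    by (simp only: x_var_inverse power_one mult_1_right)
  \<comment> \<open>The feedback of the first moments adds to the direct contribution of the cubic
    vertex as 3 \<alpha>^2 / (1 - 3 \<alpha>^2) + 1 = 1 / (1 - 3 \<alpha>^2).\<close>
  moreover have "2 * alpha ^ 2 * h + alpha ^ 3 * (2 * variance_fls) = 2 * alpha ^ 3 * variance_fls / (1 - 3 * alpha ^ 2)"
    unfolding h_def half_moment_1_fls using alpha_nonzero(2)
    by (simp add: field_simps power2_eq_square power3_eq_cube)
  hence "2 * alpha ^ 2 * h * W0 + alpha ^ 3 * (2 * variance_fls) * W0 = 2 * alpha ^ 3 * variance_fls / (1 - 3 * alpha ^ 2) * W0"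
    by (metis distrib_right)
  ultimately show ?thesis by (simp only: add_ac) 
qed

text \<open>\<open>W0\<close> solves a quadratic equation whose discriminant is, up to the factor (1
  - \<alpha>^2)^2, the radicand of \<open>sigma_x\<close>. The sign follows from the leading
  coefficient in x, since \<open>W0\<close> starts at 1/x.\<close>

lemma sigma_eq: "sigma_x = x_var - 2 * variance_fls * W0"
proof -
  define s where "s = x_var - 2 * variance_fls * W0"
  have "s ^ 2 = x_var ^ 2 - 4 * variance_fls * (x_var * W0 - variance_fls * W0 ^ 2)"
    by (simp add: s_def power2_eq_square algebra_simps)
  also have "variance_fls * W0 ^ 2 = x_var * W0 - 1"
    unfolding planar_equation_x[symmetric] variance_fls_eq using alpha_nonzero(1) by simp
  finally have "s ^ 2 = x_var ^ 2 - 4 / (1 - alpha ^ 2)"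
    by (simp add: variance_fls_eq)
  hence "sigma_x ^ 2 = s ^ 2" by (simp only: sigma_x(1))
  hence "sigma_x = s \<or> sigma_x = - s" by (simp only: power2_eq_iff)
  moreover have "fls_nth s (-1) = 1"
  proof -
    have "2 * variance_fls * W0 = fps_to_fls (lift_const (2 * variance_fps) * stieltjes sc_moment)"
      by (simp add: variance_fls_def W0_eq fls_times_fps_to_fls fps_to_fls_lift_const emb_hom)
    thus ?thesis by (simp add: s_def x_var_def)
  qed
  ultimately have "sigma_x = s" using sigma_x(3) by (metis fls_uminus_nth one_neq_neg_one)
  thus ?thesis by (simp add: s_def)
qed

lemma sigma_nonzero: "sigma_x \<noteq> 0"
  using sigma_x(3) by auto

text \<open>The equation for \<open>Whalf\<close> is linear with coefficient (1 - \<alpha>^2) x - 2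
  \<open>W0\<close>, which by \<open>sigma_eq\<close> equals (1 - \<alpha>^2)
  \<open>sigma_x\<close>.\<close>

lemma Whalf_formula:
  "Whalf = alpha ^ 3 / ((1 - alpha ^ 2) * sigma_x) *
    (x_var * (x_var * W0 - 1) + 2 / ((1 - alpha ^ 2) * (1 - 3 * alpha ^ 2)) * W0)"
proof -
  have "(1 - alpha ^ 2) * sigma_x * Whalf = (1 - alpha ^ 2) * (x_var * Whalf) - 2 * W0 * Whalf"
    unfolding sigma_eq variance_fls_eq using alpha_nonzero(1) by (simp add: field_simps)
  also have "\<dots> = alpha ^ 3 * (x_var * (x_var * W0 - 1) + 2 / ((1 - alpha ^ 2) * (1 - 3 * alpha ^ 2)) * W0)"
    unfolding half_equation_x variance_fls_eq by (simp add: algebra_simps)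
  finally show ?thesis using alpha_nonzero(1) sigma_nonzero by (simp add: field_simps)
qed

section \<open>The spectral curve\<close>

lemma sqrt_nonzero: "sqrt_one_minus_alpha2 \<noteq> 0"
  using sqrt_one_minus_alpha2_squared alpha_nonzero(1) by auto

lemma z_var_inverse: "1 / z_var = fls_X" "z_var \<noteq> 0" "z_var * fls_X = 1"
proof -
  show zX: "z_var * fls_X = 1" using x_var_inverse by (simp only: z_var_def x_var_def)
  thus z: "z_var \<noteq> 0" by auto
  from zX z show "1 / z_var = fls_X" by (metis nonzero_mult_div_cancel_left)
qed

text \<open>The reciprocal of \<open>x(z)\<close>, as a power series in \<open>1 / z\<close>.\<close>

definition x_of_z_recip :: "complex fls fps" where
  "x_of_z_recip = fps_const (fls_sqrt (1 - fls_X ^ 2)) * fps_X * inverse (1 + fps_X ^ 2)"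

lemma x_of_z_recip: "x_of_z * fps_to_fls x_of_z_recip = 1"
proof -
  define J where "J = fps_to_fls (inverse (1 + fps_X ^ 2 :: complex fls fps))"
  have "(1 + fps_X ^ 2) * inverse (1 + fps_X ^ 2 :: complex fls fps) = 1"
    by (rule inverse_mult_eq_1') simp
  from arg_cong[OF this, of fps_to_fls] have J: "(1 + fls_X ^ 2) * J = 1"
    by (simp add: J_def fls_times_fps_to_fls fps_to_fls_power)
  have u: "fps_to_fls x_of_z_recip = sqrt_one_minus_alpha2 * fls_X * J"
    unfolding x_of_z_recip_def J_def by (simp add: fls_times_fps_to_fls sqrt_one_minus_alpha2_def)
  have "x_of_z * fps_to_fls x_of_z_recip = (z_var * fls_X + fls_X ^ 2) * J"
    unfolding u x_of_z_def z_var_inverse(1) using sqrt_nonzero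
    by (simp add: field_simps power2_eq_square)
  thus ?thesis using J by (simp add: z_var_inverse(3))
qed

lemma subst_x_of_z_eq: "subst_x_of_z F = fls_compose_fps F x_of_z_recip"
proof -
  have "1 / x_of_z = fps_to_fls x_of_z_recip"
    using x_of_z_recip by (metis mult_zero_left nonzero_mult_div_cancel_left one_neq_zero)
  thus ?thesis by (simp add: subst_x_of_z_def)
qed

lemma x_of_z_recip_nonzero: "x_of_z_recip \<noteq> 0" "fps_nth x_of_z_recip 0 = 0"
  using x_of_z_recip by (auto simp: x_of_z_recip_def)

text \<open>Substitution respects the field operations, so the equations for \<open>W0\<close> and
  \<open>Whalf\<close> can be transported to z as they stand.\<close>

lemmas subst_hom =
  fls_compose_fps_mult[OF x_of_z_recip_nonzero, folded subst_x_of_z_eq]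
  fls_compose_fps_add[OF x_of_z_recip_nonzero, folded subst_x_of_z_eq]
  fls_compose_fps_diff[OF x_of_z_recip_nonzero, folded subst_x_of_z_eq]
  fls_compose_fps_power[OF x_of_z_recip_nonzero, folded subst_x_of_z_eq]
  fls_compose_fps_divide[OF x_of_z_recip_nonzero, folded subst_x_of_z_eq]

lemma subst_const: "subst_x_of_z (fls_const a) = fls_const a" "subst_x_of_z 1 = 1"
  "subst_x_of_z (numeral n) = numeral n" "subst_x_of_z alpha = alpha" "subst_x_of_z variance_fls = variance_fls"
  using fls_compose_fps_const[of "numeral n" x_of_z_recip]
  by (simp_all add: subst_x_of_z_eq alpha_def variance_fls_def emb_def)

lemma subst_x_var: "subst_x_of_z x_var = x_of_z"
proof -
  have "subst_x_of_z x_var * fps_to_fls x_of_z_recip = subst_x_of_z (x_var * fls_X)"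
    unfolding subst_hom by (simp add: subst_x_of_z_eq)
  hence "subst_x_of_z x_var * fps_to_fls x_of_z_recip = x_of_z * fps_to_fls x_of_z_recip"
    by (simp only: x_var_inverse subst_const x_of_z_recip)
  thus ?thesis using x_of_z_recip_nonzero(1) by simp
qed

text \<open>With x = (z + 1/z) / r the planar equation is a quadratic in \<open>w\<close> whose
  roots have sum r (z + 1/z) and product r^2.\<close>

lemma quadratic_factor:
  fixes r z w :: "'a::field"
  assumes "r \<noteq> 0" "z \<noteq> 0" "r ^ 2 * (1 / r * (z + 1 / z) * w - 1) = w ^ 2"
  shows "(w - r * z) * (w - r / z) = 0"
proof -
  have "(w - r * z) * (w - r / z) = w ^ 2 - r ^ 2 * (1 / r * (z + 1 / z) * w - 1)"
    using assms(1,2) by (simp add: field_simps power2_eq_square)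
  thus ?thesis using assms(3) by simp
qed

lemma subst_W0: "subst_x_of_z W0 = sqrt_one_minus_alpha2 / z_var"
proof -
  define w where "w = subst_x_of_z W0"
  define r where "r = sqrt_one_minus_alpha2"
  have r: "r \<noteq> 0" "r ^ 2 = 1 - alpha ^ 2"
    using sqrt_nonzero sqrt_one_minus_alpha2_squared by (simp_all add: r_def)
  have "(1 - alpha ^ 2) * (x_of_z * w - 1) = w ^ 2"
    using arg_cong[OF planar_equation_x, of subst_x_of_z]
    by (simp only: subst_hom subst_const subst_x_var w_def)
  hence "r ^ 2 * (1 / r * (z_var + 1 / z_var) * w - 1) = w ^ 2"
    unfolding r(2) unfolding r_def x_of_z_def .
  hence "(w - r * z_var) * (w - r / z_var) = 0"
    by (rule quadratic_factor[OF r(1) z_var_inverse(2)])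
  hence "w = r * z_var \<or> w = r / z_var" by auto
  \<comment> \<open>Substituting into \<open>W0\<close> gives a power series in 1/z, whereas this
    root grows like z.\<close>
  moreover have "w \<noteq> r * z_var"
  proof
    assume w: "w = r * z_var"
    have "w = fps_to_fls (stieltjes sc_moment oo x_of_z_recip)"
      by (simp add: w_def subst_x_of_z_eq W0_eq x_of_z_recip_nonzero)
    hence "fls_nth (r * z_var) (-1) = 0" using w by simp
    moreover have "fls_nth (r * z_var) (-1) = fls_sqrt (1 - fls_X ^ 2)"
      by (simp add: r_def sqrt_one_minus_alpha2_def z_var_def)
    ultimately show False using r(1) by (simp add: r_def sqrt_one_minus_alpha2_def)
  qed
  ultimately show ?thesis by (simp add: w_def r_def)
qed

lemma dz_deriv_x_of_z: "dz_deriv x_of_z = (1 - 1 / z_var ^ 2) / sqrt_one_minus_alpha2"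
proof -
  define c where "c = inverse (fls_sqrt (1 - fls_X ^ 2 :: complex fls))"
  have c: "1 / sqrt_one_minus_alpha2 = fls_const c"
    by (simp add: c_def sqrt_one_minus_alpha2_def fls_inverse_const inverse_eq_divide[symmetric])
  have "fls_deriv x_of_z = fls_const c * (1 - z_var ^ 2)"
    unfolding x_of_z_def c z_var_inverse(1) by (simp add: z_var_def)
  hence "dz_deriv x_of_z = fls_const c * ((z_var * fls_X) ^ 2 - fls_X ^ 2)"
    unfolding dz_deriv_def by (simp only:) (simp add: algebra_simps power_mult_distrib)
  also have "\<dots> = (1 - 1 / z_var ^ 2) / sqrt_one_minus_alpha2"
    unfolding z_var_inverse(3) c[symmetric]
    by (simp add: z_var_inverse(1)[symmetric] power_one_over)
  finally show ?thesis .
qed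

text \<open>The coefficient of \<open>w\<close> is r (z - 1/z), which is r^2 z times the derivative
  of x(z). Multiplying by dx thus cancels it completely; this is why no poles remain at z = 1 and z
  = -1. With q = 1 - 3 \<alpha>^2 the quotient \<open>(q + 2) / q\<close> is the constant of the
  theorem.\<close>

lemma half_form_solve:
  fixes r z q w A :: "'a::field"
  assumes nz: "r \<noteq> 0" "z \<noteq> 0" "q \<noteq> 0"
    and E: "r ^ 2 * ((z + 1 / z) / r * w) = 2 * (r / z) * w + 2 * A * (1 / r ^ 2) / q * (r / z) +
      A * ((z + 1 / z) / r * ((z + 1 / z) / r * (r / z) - 1))"
  shows "w * ((1 - 1 / z ^ 2) / r) = A / r ^ 3 * (1 / z ^ 2 + (q + 2) / q) * (1 / z ^ 2)"
proof -
  define K where "K = 2 * A * (1 / r ^ 2) / q * (r / z) +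
      A * ((z + 1 / z) / r * ((z + 1 / z) / r * (r / z) - 1))"
  have "w * ((1 - 1 / z ^ 2) / r) = (r ^ 2 * ((z + 1 / z) / r * w) - 2 * (r / z) * w) / (r ^ 2 * z)"
    using nz by (simp add: field_simps power2_eq_square)
  also have "\<dots> = K / (r ^ 2 * z)" unfolding E K_def by simp
  also have "\<dots> = A / r ^ 3 * (1 / z ^ 2 + (q + 2) / q) * (1 / z ^ 2)"
    unfolding K_def using nz by (simp add: field_simps power2_eq_square power3_eq_cube)
  finally show ?thesis .
qed

lemma Whalf_form_formula:
  "Whalf_form = alpha ^ 3 / sqrt_one_minus_alpha2 ^ 3 *
    (1 / z_var ^ 2 + 3 * (1 - alpha ^ 2) / (1 - 3 * alpha ^ 2)) * (1 / z_var ^ 2)"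
proof -
  define w where "w = subst_x_of_z Whalf"
  define r where "r = sqrt_one_minus_alpha2"
  define q where "q = 1 - 3 * alpha ^ 2"
  have r: "r \<noteq> 0" "1 - alpha ^ 2 = r ^ 2"
    using sqrt_nonzero sqrt_one_minus_alpha2_squared by (simp_all add: r_def)
  have q: "q \<noteq> 0" using alpha_nonzero(2) by (simp_all add: q_def)
  have z: "z_var \<noteq> 0" by (rule z_var_inverse)
  have "(1 - alpha ^ 2) * (x_of_z * w) = 2 * (r / z_var) * w +
      2 * alpha ^ 3 * variance_fls / q * (r / z_var) + alpha ^ 3 * (x_of_z * (x_of_z * (r / z_var) - 1))"
    using arg_cong[OF half_equation_x, of subst_x_of_z]
    by (simp only: subst_hom subst_const subst_x_var subst_W0 w_def r_def q_def)
  hence E: "r ^ 2 * ((z_var + 1 / z_var) / r * w) = 2 * (r / z_var) * w + 2 * alpha ^ 3 * (1 / r ^ 2) / q * (r / z_var) +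
      alpha ^ 3 * ((z_var + 1 / z_var) / r * ((z_var + 1 / z_var) / r * (r / z_var) - 1))"
    unfolding variance_fls_eq r(2) by (simp add: x_of_z_def r_def)
  have "3 * (1 - alpha ^ 2) = q + 2" by (simp add: q_def)
  thus ?thesis
    unfolding Whalf_form_def dz_deriv_x_of_z w_def[symmetric] r_def[symmetric] q_def[symmetric]
    using half_form_solve[OF r(1) z q(1) E] by simp
qed

lemma no_pole_quartic:
  fixes a b c :: "'a::field"
  assumes "c \<noteq> 0"
  shows "no_pole_at (fls_const a * (1 / fls_X_inv ^ 2 + fls_const b) * (1 / fls_X_inv ^ 2)) c"
  unfolding no_pole_at_def
proof (intro exI conjI)
  \<comment> \<open>Over the common denominator z^4 the numerator is a + a b z^2, so the only
    possible pole is at 0.\<close>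
  show "poly (monom 1 4) c \<noteq> 0" using assms by (simp add: poly_monom)
  have z: "fls_X_inv \<noteq> (0 :: 'a fls)" by simp
  show "fls_const a * (1 / fls_X_inv ^ 2 + fls_const b) * (1 / fls_X_inv ^ 2) =
      poly (map_poly fls_const [:a, 0, a * b:]) fls_X_inv / poly (map_poly fls_const (monom 1 4)) fls_X_inv"
    using z by (simp add: map_poly_pCons map_poly_monom poly_monom field_simps power2_eq_square power4_eq_xxxx)
qed

lemma no_pole_Whalf_form:
  assumes "c \<noteq> 0" shows "no_pole_at Whalf_form c"
proof -
  define a where "a = fls_X ^ 3 / fls_sqrt (1 - fls_X ^ 2 :: complex fls) ^ 3"
  define b where "b = 3 * (1 - fls_X ^ 2) / (1 - 3 * fls_X ^ 2 :: complex fls)"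
  have "alpha ^ 3 / sqrt_one_minus_alpha2 ^ 3 = fls_const a"
    by (simp add: a_def alpha_def sqrt_one_minus_alpha2_def fls_const_power fls_const_divide_const[symmetric])
  moreover have "3 * (1 - alpha ^ 2) / (1 - 3 * alpha ^ 2) = fls_const b"
    by (simp add: b_def alpha_def fls_const_power fls_const_divide_const[symmetric]
        fls_const_mult_const[symmetric] fls_minus_const[symmetric] del: fls_const_mult_const)
  ultimately have eq: "Whalf_form = fls_const a * (1 / fls_X_inv ^ 2 + fls_const b) * (1 / fls_X_inv ^ 2)"
    unfolding Whalf_form_formula z_var_def by simp
  show ?thesis unfolding eq by (rule no_pole_quartic[OF assms])
qed

theorem mainTheorem5:
  shows "(\<forall>k m. \<exists>L. laurent_sqrtN (\<lambda>N. fps_nth (moment N k) m) L \<and> (\<forall>j>2. L j = 0)) \<and>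
    Whalf = alpha ^ 3 / ((1 - alpha ^ 2) * sigma_x) *
      (x_var * (x_var * W0 - 1) + 2 / ((1 - alpha ^ 2) * (1 - 3 * alpha ^ 2)) * W0) \<and>
    Whalf_form = alpha ^ 3 / sqrt_one_minus_alpha2 ^ 3 *
      (1 / z_var ^ 2 + 3 * (1 - alpha ^ 2) / (1 - 3 * alpha ^ 2)) * (1 / z_var ^ 2) \<and>
    no_pole_at Whalf_form 1 \<and> no_pole_at Whalf_form (- 1)"
proof (intro conjI allI)
  fix k m
  obtain L where "laurent_sqrtN (\<lambda>N. fps_nth (moment N k) m) L" "\<forall>j>2. L j = 0"
    using moment_laurent[of k m] .
  thus "\<exists>L. laurent_sqrtN (\<lambda>N. fps_nth (moment N k) m) L \<and> (\<forall>j>2. L j = 0)" by blast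
qed (rule Whalf_formula Whalf_form_formula no_pole_Whalf_form; simp)+

end
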